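(* Let $m\geq 2$, let $n\ge 1$, and let $V=\mathbb{M}(\lambda,\mathcal{H})$ be any $m$th order Verma module over $\mathfrak{sl}_{n+1}(\mathbb{C})$ that lacks singleton holes (i.e. no minimal hole in $\mathcal{H}^{\min}$ is a singleton). Then $\operatorname{char} V$ is not discretely log-concave; that is, there exist $\mu\in\mathfrak{h}^*$ and $i,j\in[n+1]$ such that $$(\dim V_\mu)^2<\dim V_{\mu+\varepsilon_i-\varepsilon_j}\cdot\dim V_{\mu-\varepsilon_i+\varepsilon_j}.$$
   Context: $\mathbb{N}$ denotes the nonnegative integers and $[m]=\{1,\dots,m\}$. $\mathfrak{g}=\mathfrak{sl}_{n+1}(\mathbb{C})$, $\mathfrak{h}$ is the Cartan subalgebra of traceless diagonal matrices, $I=[n]$ is the set of nodes of the Dynkin diagram, and for $i\in I$: $e_i=E_{i,i+1}$, $f_i=E_{i+1,i}$, $h_i=E_{ii}-E_{i+1,i+1}$. $\mathfrak{n}^+$ is the strictly upper triangular subalgebra, $U\mathfrak{g}$ the universal enveloping algebra. $\varepsilon_i\in\mathfrak{h}^*$ sends a diagonal matrix to its $(i,i)$ entry. $V_\mu$ is the $\mu$-weight space of $V$ for $\mu\in\mathfrak{h}^*$. For $\lambda\in\mathfrak{h}^*$ the Verma module is $M(\lambda)=U\mathfrak{g}/\bigl(U\mathfrak{g}\cdot\mathfrak{n}^+ +\sum_{i\in I}U\mathfrak{g}\cdot(h_i-\lambda(h_i))\bigr)$, with highest weight vector $m_\lambda$ (the image of $1$). For $J\subseteq I$ let $\Lambda_J^+=\{\lambda\in\mathfrak{h}^*:\lambda(h_i)\in\mathbb{N}\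 \forall i\in J\}$. A hole is a subset $H\subseteq I$ which is independent in the Dynkin diagram (the corresponding simple roots are pairwise orthogonal; here, no two elements of $H$ are consecutive integers), so the $f_i$, $i\in H$, commute. Given a finite collection $\mathcal{H}=\{H_1,\dots,H_l\}$ of holes and $\lambda\in\bigcap_{j=1}^l\Lambda_{H_j}^+$, the higher order Verma module is $$\mathbb{M}(\lambda,\mathcal{H})=M(\lambda)\Big/\sum_{j=1}^lU\mathfrak{g}\cdot\prod_{i\in H_j}f_i^{\lambda(h_i)+1}\cdot m_\lambda.$$ $\mathcal{H}^{\min}$ denotes the set of inclusion-minimal elements of $\mathcal{H}$; one has $\mathbb{M}(\lambda,\mathcal{H})=\mathbb{M}(\lambda,\mathcal{H}^{\min})$. The module $\mathbb{M}(\lambda,\mathcal{H})$ is said to be an $m$th order Verma module, where $m=\max_{H\in\mathcal{H}^{\min}}|H|$. *)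

theory Defs
  imports "HOL-Algebra.QuotRing" "Jordan_Normal_Form.VS_Connect" "HOL-Library.Poly_Mapping"
begin

section \<open>Free associative algebras\<close>

text \<open>Words form the free monoid, written additively, so that \<open>'a fword \<Rightarrow>\<^sub>0 complex\<close>
  (with the convolution product of \<open>Poly_Mapping\<close>) is the free associative unital complex algebra
  on the type \<open>'a\<close>.\<close>

datatype 'a fword = FWord (fletters: "'a list")

instantiation fword :: (type) monoid_add
begin

definition zero_fword :: "'a fword" where "zero_fword = FWord []"

definition plus_fword :: "'a fword \<Rightarrow> 'a fword \<Rightarrow> 'a fword" where
  "plus_fword u v = FWord (fletters u @ fletters v)"

instance by standard (auto simp: zero_fword_def plus_fword_def)

end

definition free_alg :: "'a set \<Rightarrow> ('a fword \<Rightarrow>\<^sub>0 complex) ring" where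
  "free_alg X = \<lparr>carrier = {p. \<forall>w \<in> Poly_Mapping.keys p. set (fletters w) \<subseteq> X},
     mult = (*), one = 1, zero = 0, add = (+)\<rparr>"

definition letter :: "'a \<Rightarrow> 'a fword \<Rightarrow>\<^sub>0 complex" where
  "letter x = Poly_Mapping.single (FWord [x]) 1"

definition scalar :: "complex \<Rightarrow> 'a fword \<Rightarrow>\<^sub>0 complex" where
  "scalar c = Poly_Mapping.single 0 c"

section \<open>The universal enveloping algebra of a Lie algebra of matrices\<close>

definition bracket :: "complex mat \<Rightarrow> complex mat \<Rightarrow> complex mat" where
  "bracket A B = A * B - B * A"

text \<open>The relations that make \<open>letter\<close> linear turn the free algebra on the set \<open>G\<close> into the tensor
  algebra of the vector space \<open>G\<close>; the commutator relations then cut out the enveloping algebra.\<close>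

definition env_relations :: "complex mat set \<Rightarrow> (complex mat fword \<Rightarrow>\<^sub>0 complex) set" where
  "env_relations G =
     {letter (A + B) - letter A - letter B | A B. A \<in> G \<and> B \<in> G}
   \<union> {letter (c \<cdot>\<^sub>m A) - scalar c * letter A | c A. A \<in> G}
   \<union> {letter A * letter B - letter B * letter A - letter (bracket A B) | A B. A \<in> G \<and> B \<in> G}"

definition env_ideal :: "complex mat set \<Rightarrow> (complex mat fword \<Rightarrow>\<^sub>0 complex) set" where
  "env_ideal G = Idl\<^bsub>free_alg G\<^esub> (env_relations G)"

type_synonym env = "(complex mat fword \<Rightarrow>\<^sub>0 complex) set"

definition env_alg :: "complex mat set \<Rightarrow> env ring" where
  "env_alg G = free_alg G Quot env_ideal G"

definition env_of :: "complex mat set \<Rightarrow> complex mat \<Rightarrow> env" where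
  "env_of G A = env_ideal G +>\<^bsub>free_alg G\<^esub> letter A"

definition env_scalar :: "complex mat set \<Rightarrow> complex \<Rightarrow> env" where
  "env_scalar G c = env_ideal G +>\<^bsub>free_alg G\<^esub> scalar c"

section \<open>Left modules over a not necessarily commutative ring\<close>

text \<open>The library locale \<open>module\<close> assumes a commutative ring of scalars. Here the record type
  \<open>module\<close> is used with the left action of an arbitrary ring in the field \<open>smult\<close>; the
  fields \<open>mult\<close> and \<open>one\<close> play no role. The locale \<open>Module.submodule\<close> does not
  need commutativity.\<close>

definition regular_module :: "'r ring \<Rightarrow> ('r, 'r) module" where
  "regular_module R = \<lparr>carrier = carrier R, mult = mult R, one = one R, zero = zero R, add = add R,
     smult = mult R\<rparr>"

definition submodule_gen :: "'r ring \<Rightarrow> ('r, 'm) module \<Rightarrow> 'm set \<Rightarrow> 'm set" where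
  "submodule_gen R M S = \<Inter>{N. Module.submodule N R M \<and> S \<subseteq> N}"

definition quotient_module :: "('r, 'm) module \<Rightarrow> 'm set \<Rightarrow> ('r, 'm set) module" where
  "quotient_module M N = \<lparr>carrier = a_rcosets\<^bsub>M\<^esub> N, mult = undefined, one = undefined,
     zero = N, add = set_add M, smult = (\<lambda>r X. \<Union>x\<in>X. N +>\<^bsub>M\<^esub> (r \<odot>\<^bsub>M\<^esub> x))\<rparr>"

section \<open>The Lie algebra of traceless matrices of size n + 1\<close>

text \<open>Matrix entries are accessed with indices starting at 0; \<open>mat_unit n i j\<close>, \<open>chev_f n i\<close>,
  \<open>chev_h n i\<close> and \<open>eps i\<close> use the numbering starting at 1.\<close>

definition sl :: "nat \<Rightarrow> complex mat set" where
  "sl n = {A \<in> carrier_mat (n + 1) (n + 1). (\<Sum>k<n + 1. A $$ (k, k)) = 0}"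

definition cartan :: "nat \<Rightarrow> complex mat set" where
  "cartan n = {A \<in> sl n. diagonal_mat A}"

definition nplus :: "nat \<Rightarrow> complex mat set" where
  "nplus n = {A \<in> carrier_mat (n + 1) (n + 1). \<forall>r<n + 1. \<forall>c\<le>r. A $$ (r, c) = 0}"

definition mat_unit :: "nat \<Rightarrow> nat \<Rightarrow> nat \<Rightarrow> complex mat" where
  "mat_unit n i j = mat (n + 1) (n + 1) (\<lambda>(r, c). if r + 1 = i \<and> c + 1 = j then 1 else 0)"

definition chev_f :: "nat \<Rightarrow> nat \<Rightarrow> complex mat" where
  "chev_f n i = mat_unit n (i + 1) i"

definition chev_h :: "nat \<Rightarrow> nat \<Rightarrow> complex mat" where
  "chev_h n i = mat_unit n i i - mat_unit n (i + 1) (i + 1)"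

text \<open>Functionals on the Cartan subalgebra are represented by functions on all matrices, of which
  only the restriction to \<open>cartan n\<close> matters.\<close>

definition cartan_dual :: "nat \<Rightarrow> (complex mat \<Rightarrow> complex) set" where
  "cartan_dual n = {\<mu>. (\<forall>A\<in>cartan n. \<forall>B\<in>cartan n. \<mu> (A + B) = \<mu> A + \<mu> B) \<and>
     (\<forall>c. \<forall>A\<in>cartan n. \<mu> (c \<cdot>\<^sub>m A) = c * \<mu> A)}"

definition eps :: "nat \<Rightarrow> complex mat \<Rightarrow> complex" where
  "eps i A = A $$ (i - 1, i - 1)"

abbreviation Usl :: "nat \<Rightarrow> env ring" where
  "Usl n \<equiv> env_alg (sl n)"

section \<open>Weight spaces\<close>

text \<open>As a complex vector space, scalars acting through \<open>env_scalar\<close>.\<close>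

definition weight_space ::
    "nat \<Rightarrow> (env, 'm) module \<Rightarrow> (complex mat \<Rightarrow> complex) \<Rightarrow> (complex, 'm) module" where
  "weight_space n V \<mu> = \<lparr>carrier = {v \<in> carrier V. \<forall>A\<in>cartan n.
       env_of (sl n) A \<odot>\<^bsub>V\<^esub> v = env_scalar (sl n) (\<mu> A) \<odot>\<^bsub>V\<^esub> v},
     mult = mult V, one = one V, zero = zero V, add = add V,
     smult = (\<lambda>c v. env_scalar (sl n) c \<odot>\<^bsub>V\<^esub> v)\<rparr>"

definition weight_dim :: "nat \<Rightarrow> (env, 'm) module \<Rightarrow> (complex mat \<Rightarrow> complex) \<Rightarrow> nat" where
  "weight_dim n V \<mu> = vectorspace.dim class_ring (weight_space n V \<mu>)"

section \<open>Verma modules and higher order Verma modules\<close>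

text \<open>A sum of the form \<open>U s\<^sub>1 + U s\<^sub>2 + \<dots>\<close> is the submodule generated by all the \<open>s\<^sub>i\<close>.\<close>

definition verma_ideal :: "nat \<Rightarrow> (complex mat \<Rightarrow> complex) \<Rightarrow> env set" where
  "verma_ideal n lam = submodule_gen (Usl n) (regular_module (Usl n))
     (env_of (sl n) ` nplus n \<union>
      {env_of (sl n) (chev_h n i) \<ominus>\<^bsub>Usl n\<^esub> env_scalar (sl n) (lam (chev_h n i)) | i. i \<in> {1..n}})"

definition verma :: "nat \<Rightarrow> (complex mat \<Rightarrow> complex) \<Rightarrow> (env, env set) module" where
  "verma n lam = quotient_module (regular_module (Usl n)) (verma_ideal n lam)"

definition verma_hw :: "nat \<Rightarrow> (complex mat \<Rightarrow> complex) \<Rightarrow> env set" where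
  "verma_hw n lam = verma_ideal n lam +>\<^bsub>regular_module (Usl n)\<^esub> \<one>\<^bsub>Usl n\<^esub>"

definition dominant_on :: "nat \<Rightarrow> nat set \<Rightarrow> (complex mat \<Rightarrow> complex) set" where
  "dominant_on n J = {lam \<in> cartan_dual n. \<forall>i\<in>J. lam (chev_h n i) \<in> \<nat>}"

definition dynkin_adjacent :: "nat \<Rightarrow> nat \<Rightarrow> bool" where
  "dynkin_adjacent i j \<longleftrightarrow> j = i + 1 \<or> i = j + 1"

definition hole :: "nat \<Rightarrow> nat set \<Rightarrow> bool" where
  "hole n H \<longleftrightarrow> H \<subseteq> {1..n} \<and> (\<forall>i\<in>H. \<forall>j\<in>H. \<not> dynkin_adjacent i j)"

text \<open>The natural number \<open>k\<close> with \<open>lam (chev_h n i) = k\<close>, for \<open>lam\<close> dominant at \<open>i\<close>.\<close>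

definition dyn_label :: "nat \<Rightarrow> (complex mat \<Rightarrow> complex) \<Rightarrow> nat \<Rightarrow> nat" where
  "dyn_label n lam i = (THE k. lam (chev_h n i) = of_nat k)"

text \<open>The factors commute for a hole \<open>H\<close>; the increasing order of the nodes is an arbitrary
  choice.\<close>

definition hole_element :: "nat \<Rightarrow> (complex mat \<Rightarrow> complex) \<Rightarrow> nat set \<Rightarrow> env" where
  "hole_element n lam H =
     foldr (\<lambda>i u. (env_of (sl n) (chev_f n i) [^]\<^bsub>Usl n\<^esub> (dyn_label n lam i + 1)) \<otimes>\<^bsub>Usl n\<^esub> u)
       (sorted_list_of_set H) \<one>\<^bsub>Usl n\<^esub>"

definition hverma ::
    "nat \<Rightarrow> (complex mat \<Rightarrow> complex) \<Rightarrow> nat set set \<Rightarrow> (env, env set set) module" where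
  "hverma n lam \<H> = quotient_module (verma n lam)
     (submodule_gen (Usl n) (verma n lam)
       {hole_element n lam H \<odot>\<^bsub>verma n lam\<^esub> verma_hw n lam | H. H \<in> \<H>})"

definition min_holes :: "nat set set \<Rightarrow> nat set set" where
  "min_holes \<H> = {H \<in> \<H>. \<forall>H'\<in>\<H>. H' \<subseteq> H \<longrightarrow> H' = H}"

text \<open>The maximum over the empty collection is 0: a Verma module has order 0.\<close>

definition hverma_order :: "nat set set \<Rightarrow> nat" where
  "hverma_order \<H> = Max (insert 0 (card ` min_holes \<H>))"

end

theory Submission
  imports Defs
begin

text \<open>Choose a minimal hole \<open>H\<close> with the least spread and then with the smallest gap between its two
  smallest elements \<open>i < j\<close>, and put \<open>a\<^sub>k = lam (h\<^sub>k)\<close>. Let \<open>C p\<close> be the combination of simple roots with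
  coefficient \<open>p\<close> at \<open>i\<close>, \<open>1\<close> strictly between \<open>i\<close> and \<open>j\<close>, and \<open>a\<^sub>k + 1\<close> at the other elements of \<open>H\<close>.
  With \<open>p = a\<^sub>i + 1\<close>, log-concavity fails along \<open>\<alpha>\<^sub>i\<close> at the weights \<open>lam - C p\<close>, \<open>lam - C (p + 1)\<close>,
  \<open>lam - C (p + 2)\<close>, whose dimensions satisfy \<open>d\<^sub>1 > d\<^sub>2 > 0\<close> and \<open>d\<^sub>2 \<le> d\<^sub>3\<close>. By the Serre relations \<open>f\<^sub>i\<close>
  maps the first weight space onto the second, and it is not injective there, because \<open>f\<^sub>i\<close> to the power \<open>p\<close>
  applied to \<open>x = f\<^bsub>j-1\<^esub> \<dots> f\<^bsub>i+1\<^esub> \<cdot> \<Prod>\<^sub>k f\<^sub>k\<^bsup>a\<^sub>k+1\<^esup> m\<close>, \<open>k \<in> H - {i}\<close>, survives but is killed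
  by \<open>f\<^sub>i\<close>. By \<open>sl\<^sub>2\<close>-theory \<open>f\<^sub>i\<close> is injective on the second weight space.

  The choice of \<open>H\<close> ensures that the words in the \<open>f\<^sub>k\<close> that have to be nonzero lie in weights that the
  singular vectors of the holes do not reach, so it suffices that words in the \<open>f\<^sub>k\<close> are nonzero in the
  Verma module. Instead of the Poincare--Birkhoff--Witt theorem, this uses an explicit module of
  highest weight \<open>lam\<close>, built from copies of the Weyl algebra, with a functional that takes the
  value \<open>1\<close> on these words.\<close>

text \<open>The chain strictly between \<open>i\<close> and \<open>j\<close> works at both of its
  ends. Its node \<open>i + 1\<close> raises the weight of \<open>x\<close> at
  \<open>h\<^sub>i\<close> from \<open>a\<^sub>i\<close> to \<open>a\<^sub>i + 1\<close>, so
  \<open>f\<^sub>i\<close> to the power \<open>a\<^sub>i + 1\<close> survives on \<open>x\<close>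
  although it kills the vector without the chain; the Serre relation delays the vanishing by one
  power and no more. Its node \<open>j - 1\<close> does the same at \<open>h\<^sub>j\<close>. The
  second end answers an obstacle: \<open>C p\<close> with \<open>p > a\<^sub>i\<close> contains all
  of \<open>H\<close> with full multiplicities, so the singular vector of \<open>H\<close> itself
  reaches this weight and the functional alone cannot show that the weight space is nonzero. The
  functional is applied to a word without \<open>j\<close> instead, and
  \<open>sl\<^sub>2\<close>-theory at \<open>j\<close> restores the power
  \<open>a\<^sub>j + 1\<close> of \<open>f\<^sub>j\<close>. So one word avoids \<open>i\<close> and
  one avoids \<open>j\<close>. A minimal hole in the support of the first has smaller spread than
  \<open>H\<close>; one in the support of the second has smaller spread, or the same spread and a
  smaller gap. This is where the two-stage choice of \<open>H\<close> comes from.\<close>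

section \<open>Dimensions\<close>

lemma dim_pos:
  fixes V (structure)
  assumes "vectorspace K V" "vectorspace.fin_dim K V" "v \<in> carrier V" "v \<noteq> \<zero>\<^bsub>V\<^esub>"
  shows "vectorspace.dim K V > 0"
proof -
  interpret vectorspace K V by fact
  obtain B where B: "finite B" "basis B"
    using finite_basis_exists assms(2) by auto
  have "B \<noteq> {}"
  proof
    assume "B = {}"
    then have "carrier V = {\<zero>\<^bsub>V\<^esub>}"
      using B(2) span_empty by (simp add: basis_def)
    then show False using assms(3,4) by auto
  qed
  then show ?thesis
    using dim_basis[OF B] B(1) by (simp add: card_gt_0_iff)
qed

text \<open>Independent subsets of \<open>N\<close> remain independent in \<open>V\<close>, so
  \<open>dim\<close> bounds their sizes and a maximal one exists.\<close>

lemma (in vectorspace) subspace_fin_dim: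
  assumes sub: "subspace K N V" and fd: "fin_dim"
  shows "vectorspace.fin_dim K (vs N)"
proof -
  interpret N: vectorspace K "vs N" using sub by (rule subspace_is_vs)
  have NV: "N \<subseteq> carrier V"
    using sub by (auto simp: subspace_def submodule_def)
  have sm: "submodule K N V" using sub by simp
  have small: "finite A \<and> card A \<le> dim" if A: "A \<subseteq> N" "N.lin_indpt A" for A
  proof -
    have "lin_indpt A"
      using span_li_not_depend(2)[OF A(1) sm] A(2) by simp
    then show ?thesis
      using li_le_dim[OF fd] A(1) NV by (meson subset_trans)
  qed
  have "\<exists>A. finite A \<and> maximal A (\<lambda>S. S \<subseteq> carrier (vs N) \<and> N.lin_indpt S)"
    using small by (intro maximal_exists[where ?N = dim and ?B = "{}"])
      (auto simp: N.lin_dep_def)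
  then obtain A where A: "finite A" "maximal A (\<lambda>S. S \<subseteq> carrier (vs N) \<and> N.lin_indpt S)"
    by blast
  then have "N.basis A" by (intro N.max_li_is_basis) auto
  then show ?thesis
    using A(1) unfolding N.fin_dim_def N.basis_def by blast
qed

lemma dim_le_of_inj:
  assumes lm: "linear_map K V W T" and fd: "vectorspace.fin_dim K V" "vectorspace.fin_dim K W"
    and inj: "\<And>v. v \<in> carrier V \<Longrightarrow> T v = \<zero>\<^bsub>W\<^esub> \<Longrightarrow> v = \<zero>\<^bsub>V\<^esub>"
  shows "vectorspace.dim K V \<le> vectorspace.dim K W"
proof -
  interpret linear_map K V W T by fact
  have ker: "kerT = {\<zero>\<^bsub>V\<^esub>}"
    using inj by (auto simp: ker_def)
  have injT: "inj_on T (carrier V)"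
    using Ke0_imp_inj ker by simp
  obtain B where B: "finite B" "V.basis B"
    using V.finite_basis_exists fd(1) by auto
  have BV: "B \<subseteq> carrier V" and li: "V.module.lin_indpt B"
    using B(2) by (auto simp: V.basis_def)
  have "W.module.lin_indpt (T ` B)"
  proof
    assume "W.module.lin_dep (T ` B)"
    then obtain A a w where A: "finite A" "A \<subseteq> T ` B" "a \<in> A \<rightarrow> carrier K"
      "W.module.lincomb a A = \<zero>\<^bsub>W\<^esub>" "w \<in> A" "a w \<noteq> \<zero>\<^bsub>K\<^esub>"
      unfolding W.module.lin_dep_def by blast
    define A' where "A' = {v \<in> B. T v \<in> A}"
    have A': "A' \<subseteq> B" "T ` A' = A" using A(2) by (auto simp: A'_def)
    have fA': "finite A'" using B(1) A'(1) finite_subset by blast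
    have A'V: "A' \<subseteq> carrier V" using A'(1) BV by blast
    have coef: "a \<circ> T \<in> A' \<rightarrow> carrier K" using A(3) A'(2) by auto
    have "T (V.module.lincomb (a \<circ> T) A') = \<zero>\<^bsub>W\<^esub>"
      using lincomb_linear_image[OF injT A'V _ fA', of a] A'(2) A(3,4) by simp
    then have z: "V.module.lincomb (a \<circ> T) A' = \<zero>\<^bsub>V\<^esub>"
      using inj V.module.lincomb_closed[OF A'V coef] by blast
    obtain v where "v \<in> A'" "T v = w" using A(5) A'(2) by blast
    then have "V.module.lin_dep B"
      unfolding V.module.lin_dep_def using fA' A'(1) coef z A(6)
      by (metis comp_apply)
    then show False using li by simp
  qed
  moreover have "T ` B \<subseteq> carrier W" using BV by auto
  ultimately have "card (T ` B) \<le> W.dim"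
    using W.li_le_dim(2) fd(2) by blast
  moreover have "card (T ` B) = card B"
    using injT BV by (meson card_image inj_on_subset)
  ultimately show ?thesis
    using V.dim_basis[OF B] by simp
qed

lemma dim_less_of_surj:
  assumes lm: "linear_map K V W T" and fd: "vectorspace.fin_dim K V"
    and surj: "T ` carrier V = carrier W"
    and v: "v \<in> carrier V" "v \<noteq> \<zero>\<^bsub>V\<^esub>" "T v = \<zero>\<^bsub>W\<^esub>"
  shows "vectorspace.dim K W < vectorspace.dim K V"
proof -
  interpret linear_map K V W T by fact
  have "vectorspace.dim K (W.vs imT) + vectorspace.dim K (V.vs kerT) = V.dim"
    by (rule rank_nullity[OF fd])
  moreover have "imT = carrier W"
    using surj by (simp add: im_def)
  moreover have "vectorspace.dim K (V.vs kerT) > 0"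
  proof (rule dim_pos)
    show vs: "vectorspace K (V.vs kerT)"
      using V.subspace_is_vs kerT_is_subspace by blast
    show "vectorspace.fin_dim K (V.vs kerT)"
      using V.subspace_fin_dim kerT_is_subspace fd by blast
    show "v \<in> carrier (V.vs kerT)" using v by (simp add: ker_def)
    show "v \<noteq> \<zero>\<^bsub>V.vs kerT\<^esub>" using v by simp
  qed
  ultimately show ?thesis by simp
qed

section \<open>Left modules\<close>

locale left_module = R?: ring R + M?: abelian_group M
  for R :: "'r ring" (structure) and M :: "('r, 'm) module" (structure) +
  assumes smult_closed [simp, intro]: "\<lbrakk>r \<in> carrier R; x \<in> carrier M\<rbrakk> \<Longrightarrow> r \<odot>\<^bsub>M\<^esub> x \<in> carrier M"
    and smult_l_distr: "\<lbrakk>r \<in> carrier R; s \<in> carrier R; x \<in> carrier M\<rbrakk> \<Longrightarrow>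
      (r \<oplus>\<^bsub>R\<^esub> s) \<odot>\<^bsub>M\<^esub> x = r \<odot>\<^bsub>M\<^esub> x \<oplus>\<^bsub>M\<^esub> s \<odot>\<^bsub>M\<^esub> x"
    and smult_r_distr: "\<lbrakk>r \<in> carrier R; x \<in> carrier M; y \<in> carrier M\<rbrakk> \<Longrightarrow>
      r \<odot>\<^bsub>M\<^esub> (x \<oplus>\<^bsub>M\<^esub> y) = r \<odot>\<^bsub>M\<^esub> x \<oplus>\<^bsub>M\<^esub> r \<odot>\<^bsub>M\<^esub> y"
    and smult_assoc: "\<lbrakk>r \<in> carrier R; s \<in> carrier R; x \<in> carrier M\<rbrakk> \<Longrightarrow>
      (r \<otimes>\<^bsub>R\<^esub> s) \<odot>\<^bsub>M\<^esub> x = r \<odot>\<^bsub>M\<^esub> (s \<odot>\<^bsub>M\<^esub> x)"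
    and smult_one: "x \<in> carrier M \<Longrightarrow> \<one>\<^bsub>R\<^esub> \<odot>\<^bsub>M\<^esub> x = x"
begin

lemma smult_zero: "r \<in> carrier R \<Longrightarrow> r \<odot>\<^bsub>M\<^esub> \<zero>\<^bsub>M\<^esub> = \<zero>\<^bsub>M\<^esub>"
  by (metis M.add.r_cancel_one M.l_zero M.zero_closed smult_closed smult_r_distr)

lemma zero_smult: "x \<in> carrier M \<Longrightarrow> \<zero>\<^bsub>R\<^esub> \<odot>\<^bsub>M\<^esub> x = \<zero>\<^bsub>M\<^esub>"
  by (metis M.add.r_cancel_one R.l_zero R.zero_closed smult_closed smult_l_distr)

lemma smult_neg:
  assumes "r \<in> carrier R" "x \<in> carrier M"
  shows "r \<odot>\<^bsub>M\<^esub> (\<ominus>\<^bsub>M\<^esub> x) = \<ominus>\<^bsub>M\<^esub> (r \<odot>\<^bsub>M\<^esub> x)"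
  by (metis M.a_inv_closed M.minus_equality M.l_neg assms smult_closed smult_r_distr smult_zero)

lemma neg_smult:
  assumes "r \<in> carrier R" "x \<in> carrier M"
  shows "(\<ominus>\<^bsub>R\<^esub> r) \<odot>\<^bsub>M\<^esub> x = \<ominus>\<^bsub>M\<^esub> (r \<odot>\<^bsub>M\<^esub> x)"
  by (metis M.minus_equality R.a_inv_closed R.l_neg assms smult_closed smult_l_distr zero_smult)

lemma submoduleI:
  assumes "N \<subseteq> carrier M" "\<zero>\<^bsub>M\<^esub> \<in> N"
    and "\<And>x y. \<lbrakk>x \<in> N; y \<in> N\<rbrakk> \<Longrightarrow> x \<oplus>\<^bsub>M\<^esub> y \<in> N"
    and smult: "\<And>r x. \<lbrakk>r \<in> carrier R; x \<in> N\<rbrakk> \<Longrightarrow> r \<odot>\<^bsub>M\<^esub> x \<in> N"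
  shows "Module.submodule N R M"
proof -
  have "\<ominus>\<^bsub>M\<^esub> x \<in> N" if "x \<in> N" for x
    using smult[of "\<ominus>\<^bsub>R\<^esub> \<one>\<^bsub>R\<^esub>" x] that assms(1) neg_smult[of "\<one>\<^bsub>R\<^esub>" x] smult_one[of x] by auto
  then show ?thesis
    unfolding Module.submodule_def submodule_axioms_def
    using assms by (auto intro!: M.add.subgroupI simp: a_inv_def[symmetric])
qed

lemma submodule_abelian_subgroup:
  assumes "Module.submodule N R M"
  shows "abelian_subgroup N M"
  using assms abelian_subgroupI3[of N M]
  by (simp add: additive_subgroup_def Module.submodule_def M.abelian_group_axioms)

lemma submodule_gen_subset:
  "S \<subseteq> submodule_gen R M S"
  by (auto simp: submodule_gen_def)

lemma submodule_gen_minimal: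
  "Module.submodule N R M \<Longrightarrow> S \<subseteq> N \<Longrightarrow> submodule_gen R M S \<subseteq> N"
  by (auto simp: submodule_gen_def)

lemma submodule_gen_is_submodule:
  assumes S: "S \<subseteq> carrier M"
  shows "Module.submodule (submodule_gen R M S) R M"
proof (rule submoduleI)
  have whole: "Module.submodule (carrier M) R M"
    by (rule submoduleI) auto
  then show "submodule_gen R M S \<subseteq> carrier M"
    using S by (rule submodule_gen_minimal)
  show "\<zero>\<^bsub>M\<^esub> \<in> submodule_gen R M S"
    using subgroup.one_closed[of _ "add_monoid M"]
    by (auto simp: submodule_gen_def Module.submodule_def)
  show "x \<oplus>\<^bsub>M\<^esub> y \<in> submodule_gen R M S"
    if "x \<in> submodule_gen R M S" "y \<in> submodule_gen R M S" for x y
    using that subgroup.m_closed[of _ "add_monoid M" x y]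
    by (auto simp: submodule_gen_def Module.submodule_def)
  show "r \<odot>\<^bsub>M\<^esub> x \<in> submodule_gen R M S"
    if "r \<in> carrier R" "x \<in> submodule_gen R M S" for r x
    using that Module.submodule.smult_closed[of _ R M r x]
    by (auto simp: submodule_gen_def)
qed

end

locale left_module_quotient = left_module +
  fixes N
  assumes submod: "Module.submodule N R M"
begin

sublocale N: abelian_subgroup N M
  using submodule_abelian_subgroup submod .

abbreviation "Q \<equiv> quotient_module M N"
abbreviation "proj x \<equiv> N +>\<^bsub>M\<^esub> x"

lemma carrier_quotient: "carrier Q = proj ` carrier M"
  by (auto simp: quotient_module_def A_RCOSETS_def')

lemma proj_eq_iff:
  assumes "x \<in> carrier M" "y \<in> carrier M"
  shows "proj x = proj y \<longleftrightarrow> x \<ominus>\<^bsub>M\<^esub> y \<in> N"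
proof -
  have "proj x = proj y \<longleftrightarrow> x \<in> proj y"
    using N.a_rcos_self[OF assms(1)] M.a_repr_independence[OF _ assms(2) N.a_subgroup] by auto
  then show ?thesis
    using N.a_rcos_module[OF assms(2,1)] by (simp add: a_minus_def)
qed

lemma add_quotient:
  "\<lbrakk>x \<in> carrier M; y \<in> carrier M\<rbrakk> \<Longrightarrow> proj x \<oplus>\<^bsub>Q\<^esub> proj y = proj (x \<oplus>\<^bsub>M\<^esub> y)"
  by (simp add: quotient_module_def N.a_rcos_sum)

lemma zero_quotient: "\<zero>\<^bsub>Q\<^esub> = proj \<zero>\<^bsub>M\<^esub>"
  using M.a_coset_join2[OF _ N.a_subgroup]
  by (simp add: quotient_module_def)

lemma smult_quotient:
  assumes r: "r \<in> carrier R" and x: "x \<in> carrier M"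
  shows "r \<odot>\<^bsub>Q\<^esub> proj x = proj (r \<odot>\<^bsub>M\<^esub> x)"
proof -
  \<comment> \<open>The action on a coset is a union over all its representatives; each of them
    contributes the same coset, so the union collapses.\<close>
  have "proj (r \<odot>\<^bsub>M\<^esub> y) = proj (r \<odot>\<^bsub>M\<^esub> x)" if y: "y \<in> proj x" for y
  proof -
    have yM: "y \<in> carrier M"
      using y x N.a_elemrcos_carrier by blast
    have "y \<ominus>\<^bsub>M\<^esub> x \<in> N"
      using y N.a_rcos_module[OF x yM] by (simp add: a_minus_def)
    then have "r \<odot>\<^bsub>M\<^esub> (y \<ominus>\<^bsub>M\<^esub> x) \<in> N"
      using submod r Module.submodule.smult_closed by metis
    then have "r \<odot>\<^bsub>M\<^esub> y \<ominus>\<^bsub>M\<^esub> r \<odot>\<^bsub>M\<^esub> x \<in> N"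
      using r x yM by (simp add: M.minus_eq smult_r_distr smult_neg)
    then show ?thesis
      using proj_eq_iff r x yM by simp
  qed
  then have "(\<Union>y\<in>proj x. proj (r \<odot>\<^bsub>M\<^esub> y)) = (\<Union>y\<in>proj x. proj (r \<odot>\<^bsub>M\<^esub> x))"
    by (intro SUP_cong) blast+
  moreover have "x \<in> proj x" using x N.a_rcos_self by blast
  ultimately have "(\<Union>y\<in>proj x. proj (r \<odot>\<^bsub>M\<^esub> y)) = proj (r \<odot>\<^bsub>M\<^esub> x)"
    by blast
  then show ?thesis
    by (simp add: quotient_module_def)
qed

lemma proj_eq_zero_iff:
  "x \<in> carrier M \<Longrightarrow> proj x = \<zero>\<^bsub>Q\<^esub> \<longleftrightarrow> x \<in> N"
  using M.a_coset_join1[OF _ _ N.a_subgroup] M.a_coset_join2[OF _ N.a_subgroup]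
  by (auto simp: quotient_module_def)

lemma left_module_quotient: "left_module R Q"
proof -
  interpret Q: abelian_group Q
  proof (rule abelian_groupI)
    fix X assume "X \<in> carrier Q"
    then obtain x where x: "x \<in> carrier M" "X = proj x" by (auto simp: carrier_quotient)
    then have "proj (\<ominus>\<^bsub>M\<^esub> x) \<oplus>\<^bsub>Q\<^esub> X = \<zero>\<^bsub>Q\<^esub>"
      using add_quotient[of "\<ominus>\<^bsub>M\<^esub> x" x] by (simp add: zero_quotient M.l_neg)
    then show "\<exists>Y\<in>carrier Q. Y \<oplus>\<^bsub>Q\<^esub> X = \<zero>\<^bsub>Q\<^esub>"
      using x(1) by (auto simp: carrier_quotient)
  qed (auto simp: carrier_quotient add_quotient zero_quotient M.a_ac)
  show ?thesis
  proof (intro left_module.intro R.ring_axioms Q.abelian_group_axioms left_module_axioms.intro)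
    fix r s X Y
    assume rs: "r \<in> carrier R" "s \<in> carrier R" and "X \<in> carrier Q" "Y \<in> carrier Q"
    then obtain x y where xy: "x \<in> carrier M" "X = proj x" "y \<in> carrier M" "Y = proj y"
      by (auto simp: carrier_quotient)
    show "(r \<oplus>\<^bsub>R\<^esub> s) \<odot>\<^bsub>Q\<^esub> X = r \<odot>\<^bsub>Q\<^esub> X \<oplus>\<^bsub>Q\<^esub> s \<odot>\<^bsub>Q\<^esub> X"
      "r \<odot>\<^bsub>Q\<^esub> (X \<oplus>\<^bsub>Q\<^esub> Y) = r \<odot>\<^bsub>Q\<^esub> X \<oplus>\<^bsub>Q\<^esub> r \<odot>\<^bsub>Q\<^esub> Y"
      "(r \<otimes>\<^bsub>R\<^esub> s) \<odot>\<^bsub>Q\<^esub> X = r \<odot>\<^bsub>Q\<^esub> (s \<odot>\<^bsub>Q\<^esub> X)"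
      using rs xy by (simp_all add: add_quotient smult_quotient smult_l_distr smult_r_distr smult_assoc)
  qed (auto simp: carrier_quotient smult_quotient smult_one)
qed

end

lemma regular_left_module:
  assumes "ring R"
  shows "left_module R (regular_module R)"
proof -
  interpret ring R by fact
  interpret Q: abelian_group "regular_module R"
  proof (rule abelian_groupI)
    fix x assume "x \<in> carrier (regular_module R)"
    then show "\<exists>y\<in>carrier (regular_module R).
        y \<oplus>\<^bsub>regular_module R\<^esub> x = \<zero>\<^bsub>regular_module R\<^esub>"
      by (intro bexI[of _ "\<ominus>\<^bsub>R\<^esub> x"]) (auto simp: regular_module_def l_neg)
  qed (auto simp: regular_module_def a_ac)
  show ?thesis
    by (intro left_module.intro ring_axioms Q.abelian_group_axioms left_module_axioms.intro)
      (simp_all add: regular_module_def l_distr r_distr m_assoc)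
qed

section \<open>The enveloping algebra as a quotient of the free algebra\<close>

lemma poly_mapping_induct [case_names zero single add]:
  assumes "P 0" and single: "\<And>w c. P (Poly_Mapping.single w c)"
    and add: "\<And>p q. P p \<Longrightarrow> P q \<Longrightarrow> P (p + q)"
  shows "P (p :: 'a \<Rightarrow>\<^sub>0 'b::comm_monoid_add)"
proof (induction p rule: update_induct)
  case const
  then show ?case using assms(1) by simp
next
  case (update f a b)
  have "Poly_Mapping.update a b f = f + Poly_Mapping.single a b"
    using update by (intro poly_mapping_eqI) (auto simp: lookup_update lookup_add lookup_single
        when_def in_keys_iff)
  then show ?case using update single add by metis
qed

lemma scalar_central: "scalar c * p = p * scalar c"
proof (induction p rule: poly_mapping_induct)
  case (single w d)
  then show ?case
    by (simp add: scalar_def mult_single mult.commute)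
qed (simp_all add: distrib_left distrib_right)

lemma scalar_left_commute: "p * (scalar c * q) = scalar c * (p * q)"
  by (metis mult.assoc scalar_central)

lemma scalar_add: "scalar (a + b) = scalar a + scalar b"
  by (simp add: scalar_def single_add)

lemma scalar_mult: "scalar (a * b) = scalar a * scalar b"
  by (simp add: scalar_def mult_single)

lemma scalar_0 [simp]: "scalar 0 = 0"
  by (simp add: scalar_def)

lemma scalar_1 [simp]: "scalar 1 = 1"
  by (simp add: scalar_def)

lemma scalar_minus: "scalar (- a) = - scalar a"
  by (simp add: scalar_def single_uminus)

lemma scalar_diff: "scalar (a - b) = scalar a - scalar b"
  by (simp add: scalar_def single_diff)

lemma free_alg_simps [simp]:
  "mult (free_alg X) = (*)" "one (free_alg X) = 1" "zero (free_alg X) = 0" "add (free_alg X) = (+)"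
  by (simp_all add: free_alg_def)

lemma in_free_alg_iff:
  "p \<in> carrier (free_alg X) \<longleftrightarrow> (\<forall>w\<in>Poly_Mapping.keys p. set (fletters w) \<subseteq> X)"
  by (simp add: free_alg_def)

lemma free_alg_zero [simp]: "0 \<in> carrier (free_alg X)"
  by (simp add: in_free_alg_iff)

lemma free_alg_add [simp, intro]:
  "p \<in> carrier (free_alg X) \<Longrightarrow> q \<in> carrier (free_alg X) \<Longrightarrow> p + q \<in> carrier (free_alg X)"
  using keys_add[of p q] by (auto simp: in_free_alg_iff dest!: subsetD)

lemma free_alg_uminus [simp, intro]:
  "p \<in> carrier (free_alg X) \<Longrightarrow> - p \<in> carrier (free_alg X)"
  by (simp add: in_free_alg_iff)

lemma free_alg_diff [simp, intro]:
  "p \<in> carrier (free_alg X) \<Longrightarrow> q \<in> carrier (free_alg X) \<Longrightarrow> p - q \<in> carrier (free_alg X)"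
  using free_alg_add[of p X "- q"] by simp

lemma free_alg_mult [simp, intro]:
  "p \<in> carrier (free_alg X) \<Longrightarrow> q \<in> carrier (free_alg X) \<Longrightarrow> p * q \<in> carrier (free_alg X)"
  using keys_mult[of p q] by (auto simp: in_free_alg_iff plus_fword_def dest!: subsetD)

lemma free_alg_single:
  "set (fletters w) \<subseteq> X \<Longrightarrow> Poly_Mapping.single w c \<in> carrier (free_alg X)"
  by (cases "c = 0") (simp_all add: in_free_alg_iff)

lemma free_alg_scalar [simp, intro]: "scalar c \<in> carrier (free_alg X)"
  unfolding scalar_def by (rule free_alg_single) (simp add: zero_fword_def)

lemma free_alg_one [simp]: "1 \<in> carrier (free_alg X)"
  using free_alg_scalar[of 1 X] by simp

lemma free_alg_letter [simp, intro]: "A \<in> X \<Longrightarrow> letter A \<in> carrier (free_alg X)"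
  unfolding letter_def by (rule free_alg_single) simp

lemma free_alg_power [simp, intro]:
  "p \<in> carrier (free_alg X) \<Longrightarrow> p ^ k \<in> carrier (free_alg X)"
  by (induction k) auto

text \<open>A word is built from the empty one by prepending letters, and prepending is left
  multiplication, the operation under which left ideals and modules are closed.\<close>

lemma free_alg_induct [consumes 1, case_names scalar letter add]:
  assumes p: "p \<in> carrier (free_alg X)"
    and scalar: "\<And>c. P (scalar c)"
    and letter: "\<And>A q. A \<in> X \<Longrightarrow> q \<in> carrier (free_alg X) \<Longrightarrow> P q \<Longrightarrow> P (letter A * q)"
    and add: "\<And>p q. p \<in> carrier (free_alg X) \<Longrightarrow> q \<in> carrier (free_alg X) \<Longrightarrow> P p \<Longrightarrow> P q \<Longrightarrow> P (p + q)"
  shows "P p"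
proof -
  have single: "P (Poly_Mapping.single (FWord u) c)" if "set u \<subseteq> X" for u c
    using that
  proof (induction u)
    case Nil
    then show ?case using scalar[of c] by (simp add: scalar_def zero_fword_def)
  next
    case (Cons A u)
    have "Poly_Mapping.single (FWord (A # u)) c = letter A * Poly_Mapping.single (FWord u) c"
      by (simp add: letter_def mult_single plus_fword_def)
    then show ?case
      using Cons letter[of A "Poly_Mapping.single (FWord u) c"] by (simp add: free_alg_single)
  qed
  have "(\<forall>w\<in>Poly_Mapping.keys p. set (fletters w) \<subseteq> X) \<longrightarrow> P p"
  proof (induction p rule: update_induct)
    case const
    then show ?case using scalar[of 0] by simp
  next
    case (update f w c)
    have eq: "Poly_Mapping.update w c f = f + Poly_Mapping.single w c"
      using update by (intro poly_mapping_eqI) (auto simp: lookup_update lookup_add lookup_single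
          when_def in_keys_iff)
    show ?case
    proof
      assume *: "\<forall>w\<in>Poly_Mapping.keys (Poly_Mapping.update w c f). set (fletters w) \<subseteq> X"
      have "\<forall>w\<in>Poly_Mapping.keys f. set (fletters w) \<subseteq> X"
        using * update(1) by (auto simp: keys_update)
      moreover have "set (fletters w) \<subseteq> X"
        using * update(2) by (auto simp: keys_update split: if_splits)
      ultimately show "P (Poly_Mapping.update w c f)"
        unfolding eq using update(3) single[of "fletters w" c]
        by (intro add) (auto simp: in_free_alg_iff[symmetric] intro: free_alg_single)
    qed
  qed
  then show ?thesis using p by (simp add: in_free_alg_iff)
qed

lemma free_alg_ring: "ring (free_alg X)"
proof (rule ringI)
  show "abelian_group (free_alg X)"
  proof (rule abelian_groupI)
    fix x assume "x \<in> carrier (free_alg X)"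
    then show "\<exists>y\<in>carrier (free_alg X). y \<oplus>\<^bsub>free_alg X\<^esub> x = \<zero>\<^bsub>free_alg X\<^esub>"
      by (intro bexI[of _ "- x"]) auto
  qed (auto simp: algebra_simps)
  show "monoid (free_alg X)"
    by unfold_locales (auto simp: algebra_simps)
qed (auto simp: algebra_simps)

lemma free_alg_a_inv [simp]: "p \<in> carrier (free_alg X) \<Longrightarrow> \<ominus>\<^bsub>free_alg X\<^esub> p = - p"
  using abelian_group.minus_equality[OF ring.is_abelian_group[OF free_alg_ring], of X "- p" p] by simp

section \<open>Matrix units and the Lie algebra sl\<close>

lemma sl_carrier: "A \<in> sl n \<Longrightarrow> A \<in> carrier_mat (n + 1) (n + 1)"
  by (simp add: sl_def)

lemma sl_zero [simp]: "0\<^sub>m (n + 1) (n + 1) \<in> sl n"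
  by (simp add: sl_def)

lemma sl_add [simp, intro]: "A \<in> sl n \<Longrightarrow> B \<in> sl n \<Longrightarrow> A + B \<in> sl n"
  by (auto simp: sl_def sum.distrib simp del: sum.lessThan_Suc)

lemma sl_smult [simp, intro]: "A \<in> sl n \<Longrightarrow> c \<cdot>\<^sub>m A \<in> sl n"
  by (auto simp: sl_def sum_distrib_left[symmetric] simp del: sum.lessThan_Suc)

lemma trace_commute:
  assumes "A \<in> carrier_mat N N" "B \<in> carrier_mat N N"
  shows "(\<Sum>k<N. (A * B) $$ (k, k)) = (\<Sum>k<N. (B * (A :: complex mat)) $$ (k, k))"
proof -
  have "(\<Sum>k<N. (A * B) $$ (k, k)) = (\<Sum>k<N. \<Sum>l<N. A $$ (k, l) * B $$ (l, k))"
    using assms by (auto simp: scalar_prod_def lessThan_atLeast0 intro!: sum.cong)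
  also have "\<dots> = (\<Sum>l<N. \<Sum>k<N. B $$ (l, k) * A $$ (k, l))"
    by (subst sum.swap) (simp add: mult.commute)
  also have "\<dots> = (\<Sum>l<N. (B * A) $$ (l, l))"
    using assms by (auto simp: scalar_prod_def lessThan_atLeast0 intro!: sum.cong)
  finally show ?thesis .
qed

lemma sl_bracket [simp, intro]:
  assumes "A \<in> sl n" "B \<in> sl n"
  shows "bracket A B \<in> sl n"
proof -
  note c = sl_carrier[OF assms(1)] sl_carrier[OF assms(2)]
  have "(\<Sum>k<n + 1. bracket A B $$ (k, k))
      = (\<Sum>k<n + 1. (A * B) $$ (k, k)) - (\<Sum>k<n + 1. (B * A) $$ (k, k))"
    unfolding sum_subtractf[symmetric]
    using c by (intro sum.cong) (auto simp: bracket_def)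
  also have "\<dots> = 0"
    using trace_commute[OF c] by simp
  finally have "(\<Sum>k<n + 1. bracket A B $$ (k, k)) = 0" .
  moreover have "bracket A B \<in> carrier_mat (n + 1) (n + 1)"
    unfolding bracket_def using c by (intro minus_carrier_mat mult_carrier_mat)
  ultimately show ?thesis
    by (simp only: sl_def mem_Collect_eq simp_thms)
qed

lemma mat_unit_carrier [simp]: "mat_unit n i j \<in> carrier_mat (n + 1) (n + 1)"
  by (simp add: mat_unit_def)

lemma mat_unit_dim [simp]: "dim_row (mat_unit n i j) = n + 1" "dim_col (mat_unit n i j) = n + 1"
  by (simp_all add: mat_unit_def)

lemma mat_unit_index [simp]:
  "r < n + 1 \<Longrightarrow> c < n + 1 \<Longrightarrow> mat_unit n i j $$ (r, c) = (if r + 1 = i \<and> c + 1 = j then 1 else 0)"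
  by (simp add: mat_unit_def)

text \<open>For \<open>j\<close> outside the range of columns both factors can be zero while
  \<open>mat_unit n i l\<close> is not; hence the bounds on \<open>j\<close>.\<close>

lemma mat_unit_mult:
  assumes "1 \<le> j" "j \<le> n + 1"
  shows "mat_unit n i j * mat_unit n k l = (if j = k then mat_unit n i l else 0\<^sub>m (n + 1) (n + 1))"
proof (rule eq_matI)
  fix r c assume rc: "r < dim_row (if j = k then mat_unit n i l else 0\<^sub>m (n + 1) (n + 1))"
    "c < dim_col (if j = k then mat_unit n i l else 0\<^sub>m (n + 1) (n + 1))"
  then have rc': "r < n + 1" "c < n + 1" by (auto split: if_splits)
  have "(mat_unit n i j * mat_unit n k l) $$ (r, c)
      = (\<Sum>t<n + 1. mat_unit n i j $$ (r, t) * mat_unit n k l $$ (t, c))"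
    using rc' by (simp add: scalar_prod_def lessThan_atLeast0)
  also have "\<dots> = (\<Sum>t<n + 1. if t = j - 1 then (if r + 1 = i \<and> j = k \<and> c + 1 = l then 1 else 0) else 0)"
    using rc' assms by (intro sum.cong) auto
  also have "\<dots> = (if r + 1 = i \<and> j = k \<and> c + 1 = l then 1 else 0)"
    using assms by (subst sum.delta) auto
  finally show "(mat_unit n i j * mat_unit n k l) $$ (r, c)
      = (if j = k then mat_unit n i l else 0\<^sub>m (n + 1) (n + 1)) $$ (r, c)"
    using rc' by auto
qed auto

lemma mat_unit_in_sl: "i \<noteq> j \<Longrightarrow> mat_unit n i j \<in> sl n"
  by (auto simp: sl_def intro!: sum.neutral)

definition chev_e :: "nat \<Rightarrow> nat \<Rightarrow> complex mat" where
  "chev_e n i = mat_unit n i (i + 1)"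

lemma chev_f_in_sl [simp, intro]: "chev_f n i \<in> sl n"
  and chev_e_in_sl [simp, intro]: "chev_e n i \<in> sl n"
  by (auto simp: chev_f_def chev_e_def intro!: mat_unit_in_sl)

lemma chev_h_in_sl:
  assumes "i \<in> {1..n}"
  shows "chev_h n i \<in> sl n"
proof -
  have "(\<Sum>k<n + 1. chev_h n i $$ (k, k))
     = (\<Sum>k<n + 1. if k = i - 1 then 1 else 0) - (\<Sum>k<n + 1. if k = i then 1 else (0::complex))"
    unfolding sum_subtractf[symmetric] using assms
    by (intro sum.cong) (auto simp: chev_h_def)
  also have "\<dots> = 0" using assms by (subst (1 2) sum.delta) auto
  finally show ?thesis by (simp only: sl_def mem_Collect_eq) (simp add: chev_h_def minus_mat_def)
qed

lemma chev_h_in_cartan [simp, intro]: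
  assumes "i \<in> {1..n}"
  shows "chev_h n i \<in> cartan n"
  using chev_h_in_sl[OF assms] by (auto simp: cartan_def diagonal_mat_def chev_h_def)

lemma cartan_in_sl [intro]: "A \<in> cartan n \<Longrightarrow> A \<in> sl n"
  by (simp add: cartan_def)

definition simple_root :: "nat \<Rightarrow> complex mat \<Rightarrow> complex" where
  "simple_root i A = eps i A - eps (i + 1) A"

lemma cartan_mult_mat_unit:
  assumes A: "A \<in> cartan n" and i: "i \<in> {1..n + 1}" and j: "j \<in> {1..n + 1}"
  shows "A * mat_unit n i j = eps i A \<cdot>\<^sub>m mat_unit n i j"
    and "mat_unit n i j * A = eps j A \<cdot>\<^sub>m mat_unit n i j"
proof -
  have Ac: "A \<in> carrier_mat (n + 1) (n + 1)" and diag: "\<And>r c. r < n + 1 \<Longrightarrow> c < n + 1 \<Longrightarrow> r \<noteq> c \<Longrightarrow> A $$ (r, c) = 0"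
    using A by (auto simp: cartan_def sl_def diagonal_mat_def)
  show "A * mat_unit n i j = eps i A \<cdot>\<^sub>m mat_unit n i j"
  proof (rule eq_matI)
    fix r c assume "r < dim_row (eps i A \<cdot>\<^sub>m mat_unit n i j)" "c < dim_col (eps i A \<cdot>\<^sub>m mat_unit n i j)"
    then have rc: "r < n + 1" "c < n + 1" by auto
    have "(A * mat_unit n i j) $$ (r, c) = (\<Sum>t<n + 1. A $$ (r, t) * mat_unit n i j $$ (t, c))"
      using rc Ac by (simp add: scalar_prod_def lessThan_atLeast0)
    also have "\<dots> = (\<Sum>t<n + 1. if t = r then A $$ (r, r) * mat_unit n i j $$ (r, c) else 0)"
      using diag rc by (intro sum.cong) (auto simp del: mat_unit_index)
    also have "\<dots> = A $$ (r, r) * mat_unit n i j $$ (r, c)"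
      using rc by simp
    finally show "(A * mat_unit n i j) $$ (r, c) = (eps i A \<cdot>\<^sub>m mat_unit n i j) $$ (r, c)"
      using rc i by (auto simp: eps_def)
  qed (use Ac in auto)
  show "mat_unit n i j * A = eps j A \<cdot>\<^sub>m mat_unit n i j"
  proof (rule eq_matI)
    fix r c assume "r < dim_row (eps j A \<cdot>\<^sub>m mat_unit n i j)" "c < dim_col (eps j A \<cdot>\<^sub>m mat_unit n i j)"
    then have rc: "r < n + 1" "c < n + 1" by auto
    have "(mat_unit n i j * A) $$ (r, c) = (\<Sum>t<n + 1. mat_unit n i j $$ (r, t) * A $$ (t, c))"
      using rc Ac by (simp add: scalar_prod_def lessThan_atLeast0)
    also have "\<dots> = (\<Sum>t<n + 1. if t = c then mat_unit n i j $$ (r, c) * A $$ (c, c) else 0)"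
      using diag rc by (intro sum.cong) (auto simp del: mat_unit_index)
    also have "\<dots> = mat_unit n i j $$ (r, c) * A $$ (c, c)"
      using rc by simp
    finally show "(mat_unit n i j * A) $$ (r, c) = (eps j A \<cdot>\<^sub>m mat_unit n i j) $$ (r, c)"
      using rc j by (auto simp: eps_def)
  qed (use Ac in auto)
qed

lemma bracket_cartan_f:
  assumes "A \<in> cartan n" "i \<in> {1..n}"
  shows "bracket A (chev_f n i) = (- simple_root i A) \<cdot>\<^sub>m chev_f n i"
  using assms
  by (auto simp: bracket_def chev_f_def cartan_mult_mat_unit simple_root_def algebra_simps intro!: eq_matI)

lemma bracket_cartan_e:
  assumes "A \<in> cartan n" "i \<in> {1..n}"
  shows "bracket A (chev_e n i) = simple_root i A \<cdot>\<^sub>m chev_e n i"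
  using assms
  by (auto simp: bracket_def chev_e_def cartan_mult_mat_unit simple_root_def algebra_simps intro!: eq_matI)

lemma bracket_e_f:
  assumes "i \<in> {1..n}" "j \<in> {1..n}"
  shows "bracket (chev_e n i) (chev_f n j) = (if i = j then chev_h n i else 0\<^sub>m (n + 1) (n + 1))"
  using assms by (auto simp: bracket_def chev_e_def chev_f_def chev_h_def mat_unit_mult)

lemma bracket_f_f:
  assumes "i \<in> {1..n}" "j \<in> {1..n}" "\<not> dynkin_adjacent i j"
  shows "bracket (chev_f n i) (chev_f n j) = 0\<^sub>m (n + 1) (n + 1)"
  using assms by (auto simp: bracket_def chev_f_def mat_unit_mult dynkin_adjacent_def)

lemma bracket_smult_right:
  assumes "A \<in> carrier_mat N N" "B \<in> carrier_mat N N"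
  shows "bracket A (c \<cdot>\<^sub>m B) = c \<cdot>\<^sub>m bracket A B"
  using assms mult_smult_distrib[OF assms, of c] mult_smult_assoc_mat[OF assms(2,1), of c]
  by (auto simp: bracket_def algebra_simps intro!: eq_matI)

text \<open>The inner bracket is plus or minus a matrix unit \<open>mat_unit n k l\<close> with
  \<open>k \<noteq> i\<close> and \<open>l \<noteq> i + 1\<close>, so its products with
  \<open>mat_unit n (i + 1) i\<close> vanish on both sides.\<close>

lemma serre_bracket:
  assumes "i \<in> {1..n}" "j \<in> {1..n}" "dynkin_adjacent i j"
  shows "bracket (chev_f n i) (bracket (chev_f n i) (chev_f n j)) = 0\<^sub>m (n + 1) (n + 1)"
proof -
  obtain k l c where kl: "bracket (chev_f n i) (chev_f n j) = c \<cdot>\<^sub>m mat_unit n k l"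
    "k \<noteq> i" "l \<noteq> i + 1" "k \<in> {1..n + 1}" "l \<in> {1..n + 1}"
  proof (cases "j = i + 1")
    case True
    then have "bracket (chev_f n i) (chev_f n j) = (- 1) \<cdot>\<^sub>m mat_unit n (i + 2) i"
      using assms by (auto simp: bracket_def chev_f_def mat_unit_mult intro!: eq_matI)
    then show ?thesis using True assms by (intro that[of "- 1" "i + 2" i]) auto
  next
    case False
    then have i: "i = j + 1" using assms(3) by (simp add: dynkin_adjacent_def)
    have "bracket (chev_f n i) (chev_f n j) = 1 \<cdot>\<^sub>m mat_unit n (j + 2) j"
      using assms(1,2) unfolding i by (auto simp: bracket_def chev_f_def mat_unit_mult intro!: eq_matI)
    then show ?thesis using i assms by (intro that[of 1 "j + 2" j]) auto
  qed
  have "mat_unit n (i + 1) i * mat_unit n k l = 0\<^sub>m (n + 1) (n + 1)"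
    using kl(2) assms(1) by (subst mat_unit_mult) auto
  moreover have "mat_unit n k l * mat_unit n (i + 1) i = 0\<^sub>m (n + 1) (n + 1)"
    using kl(3,5) by (subst mat_unit_mult) auto
  ultimately have "bracket (chev_f n i) (mat_unit n k l) = 0\<^sub>m (n + 1) (n + 1)"
    by (simp add: bracket_def chev_f_def)
  then show ?thesis
    unfolding kl(1) unfolding chev_f_def
    by (subst bracket_smult_right[OF mat_unit_carrier mat_unit_carrier]) simp_all
qed

section \<open>Calculations modulo a left ideal\<close>

lemma env_relations_subset: "env_relations (sl n) \<subseteq> carrier (free_alg (sl n))"
  by (auto simp: env_relations_def)

lemma env_ideal_ideal: "ideal (env_ideal (sl n)) (free_alg (sl n))"
  unfolding env_ideal_def by (rule ring.genideal_ideal[OF free_alg_ring env_relations_subset])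

lemma env_relations_in_ideal: "env_relations (sl n) \<subseteq> env_ideal (sl n)"
  unfolding env_ideal_def by (rule ring.genideal_self[OF free_alg_ring env_relations_subset])

lemma env_ideal_minimal:
  "ideal K (free_alg (sl n)) \<Longrightarrow> env_relations (sl n) \<subseteq> K \<Longrightarrow> env_ideal (sl n) \<subseteq> K"
  unfolding env_ideal_def by (rule ring.genideal_minimal[OF free_alg_ring])

lemma env_ideal_subset: "env_ideal (sl n) \<subseteq> carrier (free_alg (sl n))"
  using ideal.Icarr[OF env_ideal_ideal] by blast

lemma env_ideal_mult_right:
  "p \<in> env_ideal (sl n) \<Longrightarrow> q \<in> carrier (free_alg (sl n)) \<Longrightarrow> p * q \<in> env_ideal (sl n)"
  using ideal.I_r_closed[OF env_ideal_ideal] by fastforce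

text \<open>Models a cyclic module over the enveloping algebra with a chosen generator:
  \<open>J\<close> is the annihilator of the generator, pulled back to the free algebra. Two
  polynomials are congruent when they act on the generator in the same way.\<close>

locale left_ideal =
  fixes n :: nat and J :: "(complex mat fword \<Rightarrow>\<^sub>0 complex) set"
  assumes J_subset: "J \<subseteq> carrier (free_alg (sl n))"
    and env_J: "env_ideal (sl n) \<subseteq> J"
    and add_J: "p \<in> J \<Longrightarrow> q \<in> J \<Longrightarrow> p + q \<in> J"
    and mult_J: "q \<in> carrier (free_alg (sl n)) \<Longrightarrow> p \<in> J \<Longrightarrow> q * p \<in> J"
begin

abbreviation "F \<equiv> carrier (free_alg (sl n))"

definition cong_J (infix "\<approx>" 50) where "p \<approx> q \<longleftrightarrow> p - q \<in> J"

lemma J_F: "p \<in> J \<Longrightarrow> p \<in> F"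
  using J_subset by blast

lemma zero_J [simp]: "0 \<in> J"
  using env_J additive_subgroup.zero_closed[OF ideal.axioms(1)[OF env_ideal_ideal]] by auto

lemma uminus_J: "p \<in> J \<Longrightarrow> - p \<in> J"
  using mult_J[of "- 1" p] by simp

lemma diff_J: "p \<in> J \<Longrightarrow> q \<in> J \<Longrightarrow> p - q \<in> J"
  using add_J[of p "- q"] uminus_J by simp

lemma scalar_J_iff: "c \<noteq> 0 \<Longrightarrow> scalar c * p \<in> J \<longleftrightarrow> p \<in> J"
  using mult_J[of "scalar c" p] mult_J[of "scalar (1 / c)" "scalar c * p"]
  by (auto simp: mult.assoc[symmetric] scalar_mult[symmetric])

lemma J_iff: "p \<in> J \<longleftrightarrow> p \<approx> 0"
  by (simp add: cong_J_def)

lemma cong_refl [simp, intro]: "p \<approx> p"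
  by (simp add: cong_J_def)

lemma cong_sym: "p \<approx> q \<Longrightarrow> q \<approx> p"
  using uminus_J[of "p - q"] by (simp add: cong_J_def)

lemma cong_trans [trans]: "p \<approx> q \<Longrightarrow> q \<approx> r \<Longrightarrow> p \<approx> r"
  using add_J[of "p - q" "q - r"] by (simp add: cong_J_def)

lemma cong_add: "p \<approx> q \<Longrightarrow> p' \<approx> q' \<Longrightarrow> p + p' \<approx> q + q'"
  using add_J[of "p - q" "p' - q'"] by (simp add: cong_J_def algebra_simps)

lemma cong_diff: "p \<approx> q \<Longrightarrow> p' \<approx> q' \<Longrightarrow> p - p' \<approx> q - q'"
  using diff_J[of "p - q" "p' - q'"] by (simp add: cong_J_def algebra_simps)

lemma cong_mult: "r \<in> F \<Longrightarrow> p \<approx> q \<Longrightarrow> r * p \<approx> r * q"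
  using mult_J[of r "p - q"] by (simp add: cong_J_def algebra_simps)

lemma cong_J_iff: "p \<approx> q \<Longrightarrow> p \<in> J \<longleftrightarrow> q \<in> J"
  unfolding J_iff using cong_trans cong_sym by blast

lemma cong_sum: "(\<And>x. x \<in> S \<Longrightarrow> g x \<approx> h x) \<Longrightarrow> sum g S \<approx> sum h S"
  by (induction S rule: infinite_finite_induct) (auto intro: cong_add)

text \<open>As \<open>J\<close> is only a left ideal, a congruence may not be multiplied from the
  right. The defining relations may, because \<open>env_ideal\<close> is two-sided; this is why
  every commutation rule below carries a right factor \<open>q\<close>.\<close>

lemma cong_env: "p - q \<in> env_relations (sl n) \<Longrightarrow> r \<in> F \<Longrightarrow> p * r \<approx> q * r"
  unfolding cong_J_def left_diff_distrib[symmetric]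
  using env_J env_ideal_mult_right env_relations_in_ideal by blast

lemma letter_add:
  assumes "A \<in> sl n" "B \<in> sl n" "q \<in> F"
  shows "letter (A + B) * q \<approx> letter A * q + letter B * q"
proof -
  have "letter (A + B) * q \<approx> (letter A + letter B) * q"
    using assms by (intro cong_env) (auto simp: env_relations_def algebra_simps)
  then show ?thesis by (simp add: algebra_simps)
qed

lemma letter_smult:
  assumes "A \<in> sl n" "q \<in> F"
  shows "letter (c \<cdot>\<^sub>m A) * q \<approx> scalar c * (letter A * q)"
  unfolding mult.assoc[symmetric]
  using assms by (intro cong_env) (auto simp: env_relations_def)

lemma letter_zero: "q \<in> F \<Longrightarrow> letter (0\<^sub>m (n + 1) (n + 1)) * q \<approx> 0"
  using letter_smult[OF sl_zero, of q 0] by simp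

lemma letter_bracket:
  assumes "A \<in> sl n" "B \<in> sl n" "q \<in> F"
  shows "letter A * (letter B * q) \<approx> letter B * (letter A * q) + letter (bracket A B) * q"
proof -
  have "(letter A * letter B) * q \<approx> (letter B * letter A + letter (bracket A B)) * q"
  proof (rule cong_env)
    have "letter A * letter B - (letter B * letter A + letter (bracket A B))
      = letter A * letter B - letter B * letter A - letter (bracket A B)"
      by simp
    then show "letter A * letter B - (letter B * letter A + letter (bracket A B)) \<in> env_relations (sl n)"
      unfolding env_relations_def using assms by blast
  qed (rule assms)
  then show ?thesis by (simp add: algebra_simps)
qed

abbreviation "f i \<equiv> letter (chev_f n i)"
abbreviation "e i \<equiv> letter (chev_e n i)"
abbreviation "h i \<equiv> letter (chev_h n i)"

lemma h_F [simp, intro]: "i \<in> {1..n} \<Longrightarrow> h i \<in> F"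
  using chev_h_in_sl by auto

lemma cartan_f:
  assumes "A \<in> cartan n" "i \<in> {1..n}" "q \<in> F"
  shows "letter A * (f i * q) \<approx> f i * (letter A * q) - scalar (simple_root i A) * (f i * q)"
proof -
  have "letter A * (f i * q) \<approx> f i * (letter A * q) + letter ((- simple_root i A) \<cdot>\<^sub>m chev_f n i) * q"
    using letter_bracket[of A "chev_f n i" q] assms bracket_cartan_f[of A n i] by auto
  also have "\<dots> \<approx> f i * (letter A * q) + scalar (- simple_root i A) * (f i * q)"
    using assms by (intro cong_add letter_smult) auto
  also have "\<dots> = f i * (letter A * q) - scalar (simple_root i A) * (f i * q)"
    by (simp add: scalar_minus)
  finally show ?thesis .
qed

lemma cartan_e:
  assumes "A \<in> cartan n" "i \<in> {1..n}" "q \<in> F"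
  shows "letter A * (e i * q) \<approx> e i * (letter A * q) + scalar (simple_root i A) * (e i * q)"
proof -
  have "letter A * (e i * q) \<approx> e i * (letter A * q) + letter (simple_root i A \<cdot>\<^sub>m chev_e n i) * q"
    using letter_bracket[of A "chev_e n i" q] assms bracket_cartan_e[of A n i] by auto
  also have "\<dots> \<approx> e i * (letter A * q) + scalar (simple_root i A) * (e i * q)"
    using assms by (intro cong_add letter_smult) auto
  finally show ?thesis .
qed

lemma e_f:
  assumes "i \<in> {1..n}" "j \<in> {1..n}" "q \<in> F"
  shows "e i * (f j * q) \<approx> f j * (e i * q) + (if i = j then h i * q else 0)"
proof -
  have "e i * (f j * q) \<approx> f j * (e i * q) + letter (if i = j then chev_h n i else 0\<^sub>m (n + 1) (n + 1)) * q"
    using letter_bracket[of "chev_e n i" "chev_f n j" q] assms bracket_e_f[of i n j] by auto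
  also have "\<dots> \<approx> f j * (e i * q) + (if i = j then h i * q else 0)"
    using assms letter_zero[of q] by (intro cong_add) auto
  finally show ?thesis .
qed

lemma f_commute:
  assumes "i \<in> {1..n}" "j \<in> {1..n}" "\<not> dynkin_adjacent i j" "q \<in> F"
  shows "f i * (f j * q) \<approx> f j * (f i * q)"
proof -
  have "f i * (f j * q) \<approx> f j * (f i * q) + letter (0\<^sub>m (n + 1) (n + 1)) * q"
    using letter_bracket[of "chev_f n i" "chev_f n j" q] assms bracket_f_f[of i n j] by auto
  also have "\<dots> \<approx> f j * (f i * q) + 0"
    using assms letter_zero by (intro cong_add) auto
  finally show ?thesis by simp
qed

text \<open>The vanishing double bracket says that \<open>f i\<close> commutes with the bracket of
  \<open>f i\<close> and \<open>f j\<close>; expanding that bracket on both sides gives the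
  relation.\<close>

lemma serre:
  assumes "i \<in> {1..n}" "j \<in> {1..n}" "dynkin_adjacent i j" "q \<in> F"
  shows "f i * (f i * (f j * q)) + f j * (f i * (f i * q)) \<approx> scalar 2 * (f i * (f j * (f i * q)))"
proof -
  let ?B = "bracket (chev_f n i) (chev_f n j)"
  have B: "letter ?B * q \<approx> f i * (f j * q) - f j * (f i * q)" if "q \<in> F" for q
  proof -
    have "f i * (f j * q) - (f j * (f i * q) + letter ?B * q) \<in> J"
      using letter_bracket[of "chev_f n i" "chev_f n j" q] that by (simp add: cong_J_def)
    from uminus_J[OF this] show ?thesis
      by (simp add: cong_J_def algebra_simps)
  qed
  have "f i * (letter ?B * q) \<approx> letter ?B * (f i * q) + letter (0\<^sub>m (n + 1) (n + 1)) * q"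
    using letter_bracket[of "chev_f n i" ?B q] assms serre_bracket[of i n j] by auto
  also have "\<dots> \<approx> letter ?B * (f i * q) + 0"
    using assms letter_zero by (intro cong_add) auto
  finally have 1: "f i * (letter ?B * q) \<approx> letter ?B * (f i * q)" by simp
  have "f i * (f i * (f j * q) - f j * (f i * q)) \<approx> f i * (letter ?B * q)"
    using assms B by (intro cong_mult cong_sym[OF B]) auto
  also note 1
  also have "letter ?B * (f i * q) \<approx> f i * (f j * (f i * q)) - f j * (f i * (f i * q))"
    using assms by (intro B) auto
  finally show ?thesis
    unfolding cong_J_def
    by (simp add: algebra_simps mult_2 scalar_add[of 1 1, simplified])
qed

end

section \<open>Lowering words and weights\<close>

definition fword_f :: "nat \<Rightarrow> nat list \<Rightarrow> complex mat fword \<Rightarrow>\<^sub>0 complex" where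
  "fword_f n w = foldr (\<lambda>i p. letter (chev_f n i) * p) w 1"

lemma fword_f_Nil [simp]: "fword_f n [] = 1"
  by (simp add: fword_f_def)

lemma fword_f_Cons [simp]: "fword_f n (i # w) = letter (chev_f n i) * fword_f n w"
  by (simp add: fword_f_def)

lemma fword_f_append: "fword_f n (u @ w) = fword_f n u * fword_f n w"
  by (induction u) (simp_all add: mult.assoc)

lemma fword_f_replicate: "fword_f n (replicate k i) = letter (chev_f n i) ^ k"
  by (induction k) simp_all

lemma fword_f_in [simp, intro]: "fword_f n w \<in> carrier (free_alg (sl n))"
  by (induction w) auto

text \<open>The preimage of a linear span in the quotient by \<open>J\<close>: containing
  \<open>J\<close> makes it stable under congruence.\<close>

inductive_set lspan :: "('a fword \<Rightarrow>\<^sub>0 complex) set \<Rightarrow> ('a fword \<Rightarrow>\<^sub>0 complex) set \<Rightarrow> ('a fword \<Rightarrow>\<^sub>0 complex) set"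
  for J G where
    ideal: "p \<in> J \<Longrightarrow> p \<in> lspan J G"
  | gen: "g \<in> G \<Longrightarrow> g \<in> lspan J G"
  | add: "p \<in> lspan J G \<Longrightarrow> q \<in> lspan J G \<Longrightarrow> p + q \<in> lspan J G"
  | scale: "p \<in> lspan J G \<Longrightarrow> scalar c * p \<in> lspan J G"

lemma lspan_subset:
  assumes "G \<subseteq> lspan J G'"
  shows "lspan J G \<subseteq> lspan J G'"
proof
  fix p assume "p \<in> lspan J G"
  then show "p \<in> lspan J G'"
    by induction (use assms in \<open>auto intro: lspan.intros\<close>)
qed

lemma lspan_mono: "G \<subseteq> G' \<Longrightarrow> lspan J G \<subseteq> lspan J G'"
  by (intro lspan_subset) (auto intro: lspan.gen)

lemma mat_unit_bracket:
  assumes "i \<in> {1..n + 1}" "j \<in> {1..n + 1}" "k \<in> {1..n + 1}" "i \<noteq> k"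
  shows "bracket (mat_unit n i j) (mat_unit n j k) = mat_unit n i k"
proof -
  have "mat_unit n i j * mat_unit n j k = mat_unit n i k"
    "mat_unit n j k * mat_unit n i j = 0\<^sub>m (n + 1) (n + 1)"
    using assms by (subst mat_unit_mult; simp)+
  then show ?thesis
    unfolding bracket_def by (intro eq_matI) auto
qed

text \<open>Brackets of neighbouring matrix units yield all off-diagonal matrix units. Clearing the
  off-diagonal entries of \<open>A\<close> one at a time then leaves an element of the Cartan
  subalgebra.\<close>

lemma sl_generated:
  assumes A: "A \<in> sl n"
    and cartan: "\<And>A. A \<in> cartan n \<Longrightarrow> A \<in> S"
    and e: "\<And>i. i \<in> {1..n} \<Longrightarrow> chev_e n i \<in> S"
    and f: "\<And>i. i \<in> {1..n} \<Longrightarrow> chev_f n i \<in> S"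
    and add: "\<And>A B. A \<in> S \<Longrightarrow> B \<in> S \<Longrightarrow> A \<in> sl n \<Longrightarrow> B \<in> sl n \<Longrightarrow> A + B \<in> S"
    and smult: "\<And>A c. A \<in> S \<Longrightarrow> A \<in> sl n \<Longrightarrow> c \<cdot>\<^sub>m A \<in> S"
    and bracket: "\<And>A B. A \<in> S \<Longrightarrow> B \<in> S \<Longrightarrow> A \<in> sl n \<Longrightarrow> B \<in> sl n \<Longrightarrow> bracket A B \<in> S"
  shows "A \<in> S"
proof -
  have up: "mat_unit n i (i + Suc d) \<in> S" if "i \<in> {1..n + 1}" "i + Suc d \<le> n + 1" for i d
    using that
  proof (induction d)
    case 0
    then show ?case using e[of i] by (simp add: chev_e_def)
  next
    case (Suc d)
    have "bracket (mat_unit n i (i + Suc d)) (mat_unit n (i + Suc d) (i + Suc d + 1)) \<in> S"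
      using Suc e[of "i + Suc d"] by (intro bracket) (auto simp: chev_e_def mat_unit_in_sl)
    then show ?case
      using Suc.prems by (subst (asm) mat_unit_bracket) auto
  qed
  have down: "mat_unit n (i + Suc d) i \<in> S" if "i \<in> {1..n + 1}" "i + Suc d \<le> n + 1" for i d
    using that
  proof (induction d)
    case 0
    then show ?case using f[of i] by (simp add: chev_f_def)
  next
    case (Suc d)
    have "bracket (mat_unit n (i + Suc d + 1) (i + Suc d)) (mat_unit n (i + Suc d) i) \<in> S"
      using Suc f[of "i + Suc d"] by (intro bracket) (auto simp: chev_f_def mat_unit_in_sl)
    then show ?case
      using Suc.prems by (subst (asm) mat_unit_bracket) auto
  qed
  have unit: "mat_unit n i j \<in> S" if "i \<in> {1..n + 1}" "j \<in> {1..n + 1}" "i \<noteq> j" for i j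
  proof (cases "i < j")
    case True
    then show ?thesis using up[of i "j - i - 1"] that by simp
  next
    case False
    then show ?thesis using down[of j "i - j - 1"] that by simp
  qed
  define off where "off A = {(r, c). r < n + 1 \<and> c < n + 1 \<and> r \<noteq> c \<and> A $$ (r, c) \<noteq> 0}"
    for A :: "complex mat"
  have fin: "finite (off A)" for A
    by (rule finite_subset[of _ "{..<n + 1} \<times> {..<n + 1}"]) (auto simp: off_def)
  show ?thesis
    using A
  proof (induction "card (off A)" arbitrary: A rule: less_induct)
    case less
    have Ac: "A \<in> carrier_mat (n + 1) (n + 1)" using less.prems by (rule sl_carrier)
    show ?case
    proof (cases "off A = {}")
      case True
      then have "A \<in> cartan n"
        using less.prems Ac by (auto simp: cartan_def diagonal_mat_def off_def)
      then show ?thesis by (rule cartan)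
    next
      case False
      then obtain r c where rc: "r < n + 1" "c < n + 1" "r \<noteq> c" "A $$ (r, c) \<noteq> 0"
        by (auto simp: off_def)
      define E where "E = mat_unit n (r + 1) (c + 1)"
      have E: "E \<in> S" "E \<in> sl n" and Ec: "E \<in> carrier_mat (n + 1) (n + 1)"
        using unit[of "r + 1" "c + 1"] rc mat_unit_in_sl[of "r + 1" "c + 1" n]
        unfolding E_def by auto
      define B where "B = A + (- A $$ (r, c)) \<cdot>\<^sub>m E"
      have B: "B \<in> sl n" unfolding B_def by (rule sl_add[OF less.prems sl_smult[OF E(2)]])
      have "off B \<subseteq> off A - {(r, c)}"
        using Ac Ec rc by (auto simp: off_def B_def E_def split: if_splits)
      moreover have "(r, c) \<in> off A" using rc by (simp add: off_def)
      ultimately have "off B \<subset> off A" by blast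
      then have "card (off B) < card (off A)" by (rule psubset_card_mono[OF fin])
      then have "B \<in> S" using B by (rule less.hyps)
      moreover have "A = B + A $$ (r, c) \<cdot>\<^sub>m E"
        using Ac Ec by (intro eq_matI) (auto simp: B_def)
      moreover have "A $$ (r, c) \<cdot>\<^sub>m E \<in> S" "A $$ (r, c) \<cdot>\<^sub>m E \<in> sl n"
        by (rule smult[OF E], rule sl_smult[OF E(2)])
      ultimately show ?thesis using add[of B "A $$ (r, c) \<cdot>\<^sub>m E"] B by simp
    qed
  qed
qed

text \<open>The fundamental coweights, dual to the simple roots; the constant subtracted makes the
  trace zero. Evaluation at \<open>coweight n k\<close> recovers the multiplicity of
  \<open>k\<close> in a \<open>root_sum\<close>, so different multisets give different
  weights.\<close>

definition coweight :: "nat \<Rightarrow> nat \<Rightarrow> complex mat" where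
  "coweight n k = mat (n + 1) (n + 1) (\<lambda>(r, c). if r = c then (if r < k then 1 else 0) - of_nat k / of_nat (n + 1) else 0)"

lemma coweight_in_cartan:
  assumes "k \<in> {1..n}"
  shows "coweight n k \<in> cartan n"
proof -
  have "(\<Sum>r<n + 1. coweight n k $$ (r, r))
     = (\<Sum>r<n + 1. if r < k then 1 else (0 :: complex)) - (\<Sum>r<n + 1. of_nat k / of_nat (n + 1))"
    unfolding sum_subtractf[symmetric] by (intro sum.cong) (auto simp: coweight_def)
  also have "(\<Sum>r<n + 1. if r < k then 1 else (0 :: complex)) = (\<Sum>r<k. 1)"
    using assms by (intro sum.mono_neutral_cong_right) auto
  also have "(\<Sum>r<k. 1) - (\<Sum>r<n + 1. of_nat k / of_nat (n + 1)) = (0 :: complex)"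
    by (simp only: sum_constant card_lessThan) (simp del: of_nat_Suc)
  finally have "(\<Sum>r<n + 1. coweight n k $$ (r, r)) = 0" .
  then show ?thesis
    by (simp only: cartan_def sl_def mem_Collect_eq)
      (auto simp: coweight_def diagonal_mat_def)
qed

lemma root_coweight:
  "k \<in> {1..n} \<Longrightarrow> l \<in> {1..n} \<Longrightarrow> simple_root l (coweight n k) = (if k = l then 1 else 0)"
  by (auto simp: simple_root_def eps_def coweight_def)

definition root_sum :: "nat multiset \<Rightarrow> complex mat \<Rightarrow> complex" where
  "root_sum c A = (\<Sum>k\<in>#c. simple_root k A)"

lemma root_sum_simps [simp]:
  "root_sum {#} A = 0" "root_sum (add_mset k c) A = simple_root k A + root_sum c A"
  "root_sum (c + d) A = root_sum c A + root_sum d A"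
  by (simp_all add: root_sum_def)

lemma root_sum_coweight:
  "k \<in> {1..n} \<Longrightarrow> set_mset c \<subseteq> {1..n} \<Longrightarrow> root_sum c (coweight n k) = of_nat (count c k)"
  by (induction c) (auto simp: root_coweight)

section \<open>Spans of lowering words and their weights\<close>

context left_ideal
begin

abbreviation "fw \<equiv> fword_f n"

lemma lspan_F:
  assumes "G \<subseteq> F" "p \<in> lspan J G"
  shows "p \<in> F"
  using assms(2) by induction (use assms(1) in \<open>auto intro: J_F\<close>)

lemma lspan_cong: "p \<approx> q \<Longrightarrow> q \<in> lspan J G \<Longrightarrow> p \<in> lspan J G"
  using lspan.add[OF lspan.ideal, of "p - q" J q G] by (simp add: cong_J_def)

lemma lspan_zero [simp, intro]: "0 \<in> lspan J G"
  by (rule lspan.ideal) simp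

lemma lspan_diff: "p \<in> lspan J G \<Longrightarrow> q \<in> lspan J G \<Longrightarrow> p - q \<in> lspan J G"
  using lspan.add[OF _ lspan.scale[of q J G "- 1"], of p] by (simp add: scalar_minus)

lemma lspan_empty: "lspan J {} = J"
proof -
  have "p \<in> J" if "p \<in> lspan J {}" for p
    using that by induction (auto intro: add_J mult_J)
  then show ?thesis by (auto intro: lspan.ideal)
qed

lemma lspan_mult:
  assumes r: "r \<in> F" and G: "\<And>g. g \<in> G \<Longrightarrow> r * g \<in> lspan J G'" and p: "p \<in> lspan J G"
  shows "r * p \<in> lspan J G'"
  using p
proof induction
  case (ideal p)
  then show ?case using r by (intro lspan.ideal mult_J)
next
  case (scale p c)
  then show ?case by (simp add: scalar_left_commute lspan.scale)
qed (auto simp: distrib_left intro: G lspan.add)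

lemma cartan_weight_f:
  assumes "A \<in> cartan n" "i \<in> {1..n}" "q \<in> F" "letter A * q \<approx> scalar c * q"
  shows "letter A * (f i * q) \<approx> scalar (c - simple_root i A) * (f i * q)"
proof -
  have "letter A * (f i * q) \<approx> f i * (letter A * q) - scalar (simple_root i A) * (f i * q)"
    using assms by (intro cartan_f)
  also have "\<dots> \<approx> f i * (scalar c * q) - scalar (simple_root i A) * (f i * q)"
    using assms by (intro cong_diff cong_mult) auto
  also have "f i * (scalar c * q) = scalar c * (f i * q)"
    by (rule scalar_left_commute)
  finally show ?thesis by (simp add: scalar_diff left_diff_distrib)
qed

lemma cartan_weight_e:
  assumes "A \<in> cartan n" "i \<in> {1..n}" "q \<in> F" "letter A * q \<approx> scalar c * q"
  shows "letter A * (e i * q) \<approx> scalar (c + simple_root i A) * (e i * q)"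
proof -
  have "letter A * (e i * q) \<approx> e i * (letter A * q) + scalar (simple_root i A) * (e i * q)"
    using assms by (intro cartan_e)
  also have "\<dots> \<approx> e i * (scalar c * q) + scalar (simple_root i A) * (e i * q)"
    using assms by (intro cong_add cong_mult) auto
  also have "e i * (scalar c * q) = scalar c * (e i * q)"
    by (rule scalar_left_commute)
  finally show ?thesis by (simp add: scalar_add distrib_right)
qed

lemma cartan_weight_fw:
  assumes "A \<in> cartan n" "set w \<subseteq> {1..n}" "q \<in> F" "letter A * q \<approx> scalar c * q"
  shows "letter A * (fw w * q) \<approx> scalar (c - root_sum (mset w) A) * (fw w * q)"
  using assms(2)
proof (induction w)
  case Nil
  then show ?case using assms by simp
next
  case (Cons i w)
  have "letter A * (f i * (fw w * q)) \<approx> scalar (c - root_sum (mset w) A - simple_root i A) * (f i * (fw w * q))"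
    using Cons assms by (intro cartan_weight_f) auto
  then show ?case by (simp add: mult.assoc algebra_simps)
qed

text \<open>Moving \<open>e i\<close> to the right, one commutator with each \<open>f i\<close>
  turns that letter into \<open>h i\<close>, which acts on the remaining word by a scalar; at the
  end \<open>e i\<close> meets \<open>y\<close> and dies. Every surviving term has lost exactly one
  letter \<open>i\<close>.\<close>

lemma e_fw:
  assumes i: "i \<in> {1..n}" and w: "set w \<subseteq> {1..n}" and y: "y \<in> F" "e i * y \<in> J"
    and wt: "h i * y \<approx> scalar c * y"
  shows "e i * (fw w * y) \<in> lspan J {fw u * y | u. add_mset i (mset u) = mset w}"
  using w
proof (induction w)
  case Nil
  then show ?case using y by (auto intro: lspan.ideal)
next
  case (Cons k w)
  let ?G = "{fw u * y | u. add_mset i (mset u) = mset (k # w)}"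
  have "f k * (e i * (fw w * y)) \<in> lspan J ?G"
  proof (rule lspan_mult)
    show "e i * (fw w * y) \<in> lspan J {fw u * y | u. add_mset i (mset u) = mset w}"
      using Cons by simp
    fix g assume "g \<in> {fw u * y | u. add_mset i (mset u) = mset w}"
    then obtain u where u: "g = fw u * y" "add_mset i (mset u) = mset w" by blast
    then have "f k * g = fw (k # u) * y" "add_mset i (mset (k # u)) = mset (k # w)"
      by (simp_all add: mult.assoc add_mset_commute)
    then show "f k * g \<in> lspan J ?G" by (intro lspan.gen) blast
  qed auto
  moreover have "(if i = k then h i * (fw w * y) else 0) \<in> lspan J ?G"
  proof (cases "i = k")
    case True
    have "h i * (fw w * y) \<approx> scalar (c - root_sum (mset w) (chev_h n i)) * (fw w * y)"
      using i Cons.prems y wt by (intro cartan_weight_fw) auto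
    moreover have "fw w * y \<in> lspan J ?G"
      using True by (intro lspan.gen) auto
    ultimately have "h i * (fw w * y) \<in> lspan J ?G"
      by (rule lspan_cong[OF _ lspan.scale])
    then show ?thesis using True by simp
  qed simp
  ultimately have "f k * (e i * (fw w * y)) + (if i = k then h i * (fw w * y) else 0) \<in> lspan J ?G"
    by (rule lspan.add)
  moreover have "e i * (f k * (fw w * y)) \<approx> f k * (e i * (fw w * y)) + (if i = k then h i * (fw w * y) else 0)"
    using i Cons.prems y by (intro e_f) auto
  ultimately have "e i * (f k * (fw w * y)) \<in> lspan J ?G"
    using lspan_cong by blast
  then show ?case by (simp only: fword_f_Cons mult.assoc)
qed

text \<open>The matrices that preserve the span form a Lie subalgebra, so Cartan elements and
  Chevalley generators suffice. This is the spanning half of the triangular decomposition: on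
  singular weight vectors the whole enveloping algebra produces no more than the lowering words do.
  Taking \<open>Y\<close> to be \<open>{1}\<close> treats highest weight modules, taking the hole
  vectors treats the submodule they generate.\<close>

theorem word_span_stable:
  assumes Y: "Y \<subseteq> F" "\<And>y i. y \<in> Y \<Longrightarrow> i \<in> {1..n} \<Longrightarrow> e i * y \<in> J"
    and wt: "\<And>y A. y \<in> Y \<Longrightarrow> A \<in> cartan n \<Longrightarrow> letter A * y \<approx> scalar (wt y A) * y"
    and p: "p \<in> F" and q: "q \<in> lspan J {fw w * y | w y. set w \<subseteq> {1..n} \<and> y \<in> Y}"
  shows "p * q \<in> lspan J {fw w * y | w y. set w \<subseteq> {1..n} \<and> y \<in> Y}" (is "_ \<in> lspan J ?W")
proof -
  have WF: "?W \<subseteq> F" using Y by auto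
  define S where "S = {A. \<forall>q\<in>lspan J ?W. letter A * q \<in> lspan J ?W}"
  have letter: "A \<in> S" if A: "A \<in> sl n" for A
    using A
  proof (rule sl_generated)
    fix A assume A: "A \<in> cartan n"
    have "letter A * g \<in> lspan J ?W" if gW: "g \<in> ?W" for g
    proof -
      obtain w y where g: "g = fw w * y" "set w \<subseteq> {1..n}" "y \<in> Y" using gW by blast
      then have "letter A * g \<approx> scalar (wt y A - root_sum (mset w) A) * g"
        using cartan_weight_fw[OF A g(2) _ wt[OF g(3) A]] Y(1) by auto
      then show ?thesis by (rule lspan_cong) (intro lspan.scale lspan.gen gW)
    qed
    then show "A \<in> S"
      unfolding S_def using A by (intro CollectI ballI) (rule lspan_mult, auto)
  next
    fix i assume i: "i \<in> {1..n}"
    have "e i * g \<in> lspan J ?W" if gW: "g \<in> ?W" for g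
    proof -
      obtain w y where g: "g = fw w * y" "set w \<subseteq> {1..n}" "y \<in> Y" using gW by blast
      have "e i * g \<in> lspan J {fw u * y | u. add_mset i (mset u) = mset w}"
        unfolding g(1) using i g(2,3) Y wt[OF g(3), of "chev_h n i"] by (intro e_fw) auto
      moreover have "set u \<subseteq> {1..n}" if "add_mset i (mset u) = mset w" for u
        using g(2) that by (metis insert_subset set_mset_add_mset_insert set_mset_mset)
      then have "{fw u * y | u. add_mset i (mset u) = mset w} \<subseteq> ?W"
        using g(3) by blast
      ultimately show ?thesis using lspan_mono by (meson subsetD)
    qed
    then show "chev_e n i \<in> S"
      unfolding S_def by (intro CollectI ballI) (rule lspan_mult, auto)
    have "f i * g \<in> lspan J ?W" if gW: "g \<in> ?W" for g
    proof -
      obtain w y where g: "g = fw w * y" "set w \<subseteq> {1..n}" "y \<in> Y" using gW by blast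
      then have "f i * g = fw (i # w) * y" "set (i # w) \<subseteq> {1..n}"
        using i by (simp_all add: mult.assoc)
      then show ?thesis using g(3) by (intro lspan.gen) blast
    qed
    then show "chev_f n i \<in> S"
      unfolding S_def by (intro CollectI ballI) (rule lspan_mult, auto)
  next
    fix A B assume AB: "A \<in> S" "B \<in> S" "A \<in> sl n" "B \<in> sl n"
    have "letter (A + B) * q \<in> lspan J ?W" if q: "q \<in> lspan J ?W" for q
    proof -
      have "letter (A + B) * q \<approx> letter A * q + letter B * q"
        using AB q by (intro letter_add lspan_F[OF WF])
      moreover have "letter A * q + letter B * q \<in> lspan J ?W"
        using AB(1,2) q by (intro lspan.add) (auto simp: S_def)
      ultimately show ?thesis by (rule lspan_cong)
    qed
    then show "A + B \<in> S" by (simp add: S_def)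
    have "letter (bracket A B) * q \<in> lspan J ?W" if q: "q \<in> lspan J ?W" for q
    proof -
      have "letter A * (letter B * q) \<approx> letter B * (letter A * q) + letter (bracket A B) * q"
        using AB q by (intro letter_bracket lspan_F[OF WF])
      then have "letter A * (letter B * q) - (letter B * (letter A * q) + letter (bracket A B) * q) \<in> J"
        by (simp add: cong_J_def)
      from uminus_J[OF this]
      have "letter (bracket A B) * q \<approx> letter A * (letter B * q) - letter B * (letter A * q)"
        by (simp add: cong_J_def algebra_simps)
      moreover have "letter A * (letter B * q) - letter B * (letter A * q) \<in> lspan J ?W"
        using AB q by (intro lspan_diff) (auto simp: S_def)
      ultimately show ?thesis by (rule lspan_cong)
    qed
    then show "bracket A B \<in> S" by (simp add: S_def)
  next
    fix A c assume A: "A \<in> S" "A \<in> sl n"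
    have "letter (c \<cdot>\<^sub>m A) * q \<in> lspan J ?W" if q: "q \<in> lspan J ?W" for q
    proof -
      have "letter (c \<cdot>\<^sub>m A) * q \<approx> scalar c * (letter A * q)"
        using A q by (intro letter_smult lspan_F[OF WF])
      moreover have "scalar c * (letter A * q) \<in> lspan J ?W"
        using A(1) q by (intro lspan.scale) (auto simp: S_def)
      ultimately show ?thesis by (rule lspan_cong)
    qed
    then show "c \<cdot>\<^sub>m A \<in> S" by (simp add: S_def)
  qed
  show ?thesis
    using p q
  proof (induction p arbitrary: q rule: free_alg_induct)
    case (letter A p)
    have "letter A * (p * q) \<in> lspan J ?W"
      using letter(1) letter(3)[OF letter(4)] \<open>\<And>A. A \<in> sl n \<Longrightarrow> A \<in> S\<close> by (auto simp: S_def)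
    then show ?case by (simp add: mult.assoc)
  next
    case (scalar c)
    then show ?case by (rule lspan.scale)
  next
    case (add p p')
    then show ?case by (simp add: distrib_right lspan.add)
  qed
qed

text \<open>For \<open>c \<noteq> d\<close> choose \<open>A\<close> on which their weights differ.
  Multiplying the sum by \<open>letter A - scalar (wt d A)\<close> removes the term at
  \<open>d\<close> and rescales the term at \<open>c\<close> by a nonzero number, so the induction
  hypothesis applies to the rescaled family.\<close>

lemma eigen_independent:
  assumes "finite C"
    and "\<And>c. c \<in> C \<Longrightarrow> r c \<in> F"
    and "\<And>c A. c \<in> C \<Longrightarrow> A \<in> cartan n \<Longrightarrow> letter A * r c \<approx> scalar (wt c A) * r c"
    and "\<And>c d. c \<in> C \<Longrightarrow> d \<in> C \<Longrightarrow> c \<noteq> d \<Longrightarrow> \<exists>A\<in>cartan n. wt c A \<noteq> wt d A"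
    and "(\<Sum>c\<in>C. r c) \<in> J"
  shows "\<forall>c\<in>C. r c \<in> J"
  using assms
proof (induction C arbitrary: r rule: finite_induct)
  case (insert d C)
  have C: "r c \<in> J" if c: "c \<in> C" for c
  proof -
    have "c \<noteq> d" using insert.hyps c by blast
    then obtain A where A: "A \<in> cartan n" "wt c A \<noteq> wt d A"
      using insert.prems(3)[of c d] c by auto
    define s where "s x = scalar (wt x A - wt d A) * r x" for x
    have "(\<Sum>x\<in>insert d C. s x) = (\<Sum>x\<in>insert d C. scalar (wt x A) * r x) - (\<Sum>x\<in>insert d C. scalar (wt d A) * r x)"
      unfolding s_def sum_subtractf[symmetric] by (simp add: scalar_diff left_diff_distrib)
    also have "\<dots> \<approx> (\<Sum>x\<in>insert d C. letter A * r x) - (\<Sum>x\<in>insert d C. scalar (wt d A) * r x)"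
      using A insert.prems(2) by (intro cong_diff cong_sum cong_refl) (rule cong_sym, auto)
    also have "\<dots> = (letter A - scalar (wt d A)) * (\<Sum>x\<in>insert d C. r x)"
      by (simp only: sum_distrib_left left_diff_distrib sum_subtractf)
    also have "\<dots> \<approx> 0"
      using A insert.prems(4) mult_J[of "letter A - scalar (wt d A)"] by (auto simp: cong_J_def)
    finally have "(\<Sum>x\<in>insert d C. s x) \<in> J" by (simp add: J_iff)
    then have "(\<Sum>x\<in>C. s x) \<in> J"
      using insert.hyps by (simp add: s_def)
    moreover have "letter B * s x \<approx> scalar (wt x B) * s x" if "x \<in> C" "B \<in> cartan n" for x B
    proof -
      have "letter B * s x = scalar (wt x A - wt d A) * (letter B * r x)"
        unfolding s_def by (rule scalar_left_commute)
      also have "\<dots> \<approx> scalar (wt x A - wt d A) * (scalar (wt x B) * r x)"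
        using insert.prems(2) that by (intro cong_mult) auto
      also have "\<dots> = scalar (wt x B) * s x"
        unfolding s_def by (rule scalar_left_commute)
      finally show ?thesis .
    qed
    ultimately have "s c \<in> J"
      using insert.IH[of s] insert.prems(1,3) c by (auto simp: s_def)
    then show ?thesis using A(2) by (simp add: s_def scalar_J_iff)
  qed
  then have "(\<Sum>c\<in>C. r c) \<in> J"
    by (induction C rule: infinite_finite_induct) (auto intro: add_J)
  then have "r d \<in> J"
    using insert.prems(4) insert.hyps diff_J[of "sum r (insert d C)" "sum r C"] by simp
  then show ?case using C by blast
qed simp

text \<open>Sorting the words in \<open>p\<close> by content splits \<open>p\<close> into
  eigenvectors of pairwise different weights; only the one at \<open>c\<close> can survive.\<close>

lemma weight_space_words:
  assumes y: "y \<in> F" and wt: "\<And>A. A \<in> cartan n \<Longrightarrow> letter A * y \<approx> scalar (ch A) * y"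
    and p: "p \<in> lspan J {fw w * y | w. set w \<subseteq> {1..n}}"
    and c: "set_mset c \<subseteq> {1..n}"
    and pw: "\<And>A. A \<in> cartan n \<Longrightarrow> letter A * p \<approx> scalar (ch A - root_sum c A) * p"
  shows "p \<in> lspan J {fw w * y | w. mset w = c}"
proof -
  define W where "W c = {fw w * y | w. mset w = c}" for c
  have WF: "W c \<subseteq> F" for c using y by (auto simp: W_def)
  define V where "V = {c. set_mset c \<subseteq> {1..n}}"
  have "\<exists>C r. finite C \<and> C \<subseteq> V \<and> (\<forall>c. r c \<in> lspan J (W c)) \<and> (\<forall>c. c \<notin> C \<longrightarrow> r c = 0) \<and> p \<approx> (\<Sum>c\<in>C. r c)"
    using p
  proof induction
    case (ideal p)
    then show ?case by (intro exI[of _ "{}"] exI[of _ "\<lambda>_. 0"]) (auto simp: J_iff)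
  next
    case (gen g)
    then obtain w where w: "g = fw w * y" "set w \<subseteq> {1..n}" by blast
    then have "g \<in> lspan J (W (mset w))" by (intro lspan.gen) (auto simp: W_def)
    then show ?case
      using w(2) by (intro exI[of _ "{mset w}"] exI[of _ "\<lambda>c. if c = mset w then g else 0"])
        (simp add: V_def)
  next
    case (add p q)
    then obtain C r D s where
      C: "finite C" "C \<subseteq> V" "\<And>c. r c \<in> lspan J (W c)" "\<And>c. c \<notin> C \<Longrightarrow> r c = 0" "p \<approx> (\<Sum>c\<in>C. r c)"
      and D: "finite D" "D \<subseteq> V" "\<And>c. s c \<in> lspan J (W c)" "\<And>c. c \<notin> D \<Longrightarrow> s c = 0" "q \<approx> (\<Sum>c\<in>D. s c)"
      by blast
    have "(\<Sum>c\<in>C. r c) = (\<Sum>c\<in>C \<union> D. r c)"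
      using C D by (intro sum.mono_neutral_left) auto
    moreover have "(\<Sum>c\<in>D. s c) = (\<Sum>c\<in>C \<union> D. s c)"
      using C D by (intro sum.mono_neutral_left) auto
    ultimately have "p + q \<approx> (\<Sum>c\<in>C \<union> D. r c + s c)"
      using cong_add[OF C(5) D(5)] by (simp add: sum.distrib)
    then show ?case
      using C D by (intro exI[of _ "C \<union> D"] exI[of _ "\<lambda>c. r c + s c"]) (simp add: lspan.add)
  next
    case (scale p a)
    then obtain C r where
      C: "finite C" "C \<subseteq> V" "\<And>c. r c \<in> lspan J (W c)" "\<And>c. c \<notin> C \<Longrightarrow> r c = 0" "p \<approx> (\<Sum>c\<in>C. r c)"
      by blast
    then have "scalar a * p \<approx> (\<Sum>c\<in>C. scalar a * r c)"
      unfolding sum_distrib_left[symmetric] by (intro cong_mult) auto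
    then show ?case
      using C by (intro exI[of _ C] exI[of _ "\<lambda>c. scalar a * r c"]) (simp add: lspan.scale)
  qed
  then obtain C r where
    C: "finite C" "C \<subseteq> V" "\<And>c. r c \<in> lspan J (W c)" "\<And>c. c \<notin> C \<Longrightarrow> r c = 0" "p \<approx> (\<Sum>c\<in>C. r c)"
    by blast
  have pF: "p \<in> F" using p y by (intro lspan_F[OF _ p]) auto
  have eig: "letter A * q \<approx> scalar (ch A - root_sum d A) * q"
    if "q \<in> lspan J (W d)" "d \<in> V" "A \<in> cartan n" for q d A
    using that(1)
  proof induction
    case (ideal p)
    then have "letter A * p - scalar (ch A - root_sum d A) * p \<in> J"
      using that by (intro diff_J mult_J) auto
    then show ?case by (simp add: cong_J_def)
  next
    case (gen g)
    then obtain w where w: "g = fw w * y" "mset w = d" by (auto simp: W_def)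
    then have "set w \<subseteq> {1..n}" using that(2) by (auto simp: V_def)
    from cartan_weight_fw[OF that(3) this y wt[OF that(3)]]
    show ?case by (simp add: w)
  next
    case (add p q)
    then show ?case by (simp add: distrib_left cong_add)
  next
    case (scale p a)
    have "scalar a * (letter A * p) \<approx> scalar a * (scalar (ch A - root_sum d A) * p)"
      using scale by (intro cong_mult) auto
    then show ?case by (simp only: scalar_left_commute[of "letter A"] scalar_left_commute[of "scalar a"])
  qed
  \<comment> \<open>Subtracting \<open>p\<close> from the component at \<open>c\<close> makes the
    sum of all components vanish modulo \<open>J\<close>, and the corrected component still is an
    eigenvector for the same weight.\<close>
  define s where "s d = (if d = c then r d - p else r d)" for d
  have cV: "c \<in> V" using c by (simp add: V_def)
  have sum_s: "(\<Sum>d\<in>insert c C. s d) = (\<Sum>d\<in>insert c C. r d) - p"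
  proof -
    have "(\<Sum>d\<in>insert c C. s d) = s c + (\<Sum>d\<in>C - {c}. s d)"
      using C(1) by (simp add: sum.insert_remove)
    also have "(\<Sum>d\<in>C - {c}. s d) = (\<Sum>d\<in>C - {c}. r d)"
      by (intro sum.cong) (auto simp: s_def)
    also have "s c + (\<Sum>d\<in>C - {c}. r d) = (\<Sum>d\<in>insert c C. r d) - p"
      using C(1) by (simp add: sum.insert_remove s_def)
    finally show ?thesis .
  qed
  have "(\<Sum>d\<in>insert c C. r d) = (\<Sum>d\<in>C. r d)"
    using C by (intro sum.mono_neutral_right) auto
  then have sJ: "(\<Sum>d\<in>insert c C. s d) \<in> J"
    using cong_sym[OF C(5)] unfolding sum_s by (simp add: cong_J_def)
  have "\<forall>d\<in>insert c C. s d \<in> J"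
  proof (rule eigen_independent[where wt = "\<lambda>d A. ch A - root_sum d A"])
    show "s d \<in> F" if "d \<in> insert c C" for d
      using lspan_F[OF WF C(3)] pF by (auto simp: s_def)
    show "letter A * s d \<approx> scalar (ch A - root_sum d A) * s d" if "d \<in> insert c C" "A \<in> cartan n" for d A
    proof -
      have "letter A * r d \<approx> scalar (ch A - root_sum d A) * r d"
        using that C(2) cV by (intro eig[OF C(3)]) auto
      then show ?thesis
        using cong_diff[OF _ pw[OF that(2)]]
        by (cases "d = c") (simp_all add: s_def right_diff_distrib)
    qed
    show "\<exists>A\<in>cartan n. ch A - root_sum d A \<noteq> ch A - root_sum d' A"
      if dd: "d \<in> insert c C" "d' \<in> insert c C" "d \<noteq> d'" for d d'
    proof -
      obtain k where k: "count d k \<noteq> count d' k" using dd(3) by (meson multiset_eqI)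
      have V: "d \<in> V" "d' \<in> V" using dd C(2) cV by auto
      have "k \<in># d \<or> k \<in># d'"
        using k by (metis count_eq_zero_iff)
      then have "k \<in> {1..n}" using V by (auto simp: V_def)
      then show ?thesis
        using k V coweight_in_cartan[of k n]
        by (intro bexI[of _ "coweight n k"]) (auto simp: root_sum_coweight V_def)
    qed
  qed (use C(1) sJ in auto)
  then have "r c - p \<in> J" by (auto simp: s_def)
  then have "p \<approx> r c" by (intro cong_sym[of "r c"]) (simp add: cong_J_def)
  then have "p \<in> lspan J (W c)" using C(3) by (rule lspan_cong)
  then show ?thesis by (simp add: W_def)
qed

end

section \<open>A Weyl algebra model\<close>

text \<open>An element of the model is the family of coefficients of a formal sum of monomials in
  variables \<open>x\<^sub>k\<^sub>,\<^sub>r\<close> with \<open>k \<in> {1..n}\<close> and \<open>r \<in> {0..n}\<close>, where \<open>x\<^sub>k\<^sub>,\<^sub>k\<close> carries the additional complex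
  exponent \<open>s k\<close>. A matrix acts on each of the \<open>n\<close> rows through its natural vector fields; the
  Fourier transform for the variables with \<open>r < k\<close> makes the lowering operators act injectively.\<close>

type_synonym fock = "(nat \<times> nat \<Rightarrow> int) \<Rightarrow> complex"

definition fmul :: "nat \<times> nat \<Rightarrow> fock \<Rightarrow> fock" where
  "fmul p \<Phi> = (\<lambda>x. \<Phi> (x(p := x p - 1)))"

definition fder :: "(nat \<Rightarrow> complex) \<Rightarrow> nat \<times> nat \<Rightarrow> fock \<Rightarrow> fock" where
  "fder s p \<Phi> = (\<lambda>x. ((if fst p = snd p then s (fst p) else 0) + of_int (x p) + 1) * \<Phi> (x(p := x p + 1)))"

definition opX :: "(nat \<Rightarrow> complex) \<Rightarrow> nat \<times> nat \<Rightarrow> fock \<Rightarrow> fock" where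
  "opX s p \<Phi> = (if snd p < fst p then (\<lambda>x. - fder s p \<Phi> x) else fmul p \<Phi>)"

definition opD :: "(nat \<Rightarrow> complex) \<Rightarrow> nat \<times> nat \<Rightarrow> fock \<Rightarrow> fock" where
  "opD s p \<Phi> = (if snd p < fst p then fmul p \<Phi> else fder s p \<Phi>)"

lemma fmul_fmul: "fmul p (fmul q \<Phi>) = fmul q (fmul p \<Phi>)"
  by (cases "p = q") (auto simp: fmul_def fun_upd_twist)

lemma fder_fder: "fder s p (fder s q \<Phi>) = fder s q (fder s p \<Phi>)"
  by (cases "p = q") (auto simp: fder_def fun_upd_twist)

lemma fder_fmul:
  "fder s p (fmul q \<Phi>) = (\<lambda>x. fmul q (fder s p \<Phi>) x + (if p = q then \<Phi> x else 0))"
  by (cases "p = q") (auto simp: fder_def fmul_def fun_upd_twist algebra_simps)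

lemma fmul_linear:
  "fmul p (\<lambda>x. - \<Phi> x) = (\<lambda>x. - fmul p \<Phi> x)"
  "fmul p (\<lambda>x. \<Phi> x + \<Psi> x) = (\<lambda>x. fmul p \<Phi> x + fmul p \<Psi> x)"
  "fmul p (\<lambda>x. a * \<Phi> x) = (\<lambda>x. a * fmul p \<Phi> x)"
  by (simp_all add: fmul_def)

lemma fder_linear:
  "fder s p (\<lambda>x. - \<Phi> x) = (\<lambda>x. - fder s p \<Phi> x)"
  "fder s p (\<lambda>x. \<Phi> x + \<Psi> x) = (\<lambda>x. fder s p \<Phi> x + fder s p \<Psi> x)"
  "fder s p (\<lambda>x. a * \<Phi> x) = (\<lambda>x. a * fder s p \<Phi> x)"
  by (simp_all add: fder_def algebra_simps)

lemma opX_opX: "opX s p (opX s q \<Phi>) = opX s q (opX s p \<Phi>)"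
  using fmul_fmul[of p q \<Phi>] fder_fder[of s p q \<Phi>]
  by (cases "p = q") (auto simp: opX_def fder_linear fmul_linear fder_fmul)

lemma opD_opD: "opD s p (opD s q \<Phi>) = opD s q (opD s p \<Phi>)"
  using fmul_fmul[of p q \<Phi>] fder_fder[of s p q \<Phi>]
  by (cases "p = q") (auto simp: opD_def fder_fmul)

text \<open>The Fourier transform, which replaces multiplication by minus the derivative and the
  derivative by multiplication, preserves the Weyl relation; hence one formula covers both kinds of
  variables.\<close>

lemma opD_opX:
  "opD s p (opX s q \<Phi>) = (\<lambda>x. opX s q (opD s p \<Phi>) x + (if p = q then \<Phi> x else 0))"
  using fmul_fmul[of p q \<Phi>] fder_fder[of s p q \<Phi>]
  by (cases "p = q") (auto simp: opX_def opD_def fder_linear fmul_linear fder_fmul)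

lemma opX_linear:
  "opX s p (\<lambda>x. \<Phi> x + \<Psi> x) = (\<lambda>x. opX s p \<Phi> x + opX s p \<Psi> x)"
  "opX s p (\<lambda>x. a * \<Phi> x) = (\<lambda>x. a * opX s p \<Phi> x)"
  by (simp_all add: opX_def fder_linear fmul_linear)

lemma opD_linear:
  "opD s p (\<lambda>x. \<Phi> x + \<Psi> x) = (\<lambda>x. opD s p \<Phi> x + opD s p \<Psi> x)"
  "opD s p (\<lambda>x. a * \<Phi> x) = (\<lambda>x. a * opD s p \<Phi> x)"
  by (simp_all add: opD_def fder_linear fmul_linear)

lemma opX_zero [simp]: "opX s p (\<lambda>x. 0) = (\<lambda>x. 0)"
  using opX_linear(2)[of s p 0 "\<lambda>x. 0"] by simp

lemma opD_zero [simp]: "opD s p (\<lambda>x. 0) = (\<lambda>x. 0)"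
  using opD_linear(2)[of s p 0 "\<lambda>x. 0"] by simp

lemma opX_sum: "opX s p (\<lambda>x. \<Sum>i\<in>S. \<Phi> i x) = (\<lambda>x. \<Sum>i\<in>S. opX s p (\<Phi> i) x)"
  by (induction S rule: infinite_finite_induct) (simp_all add: opX_linear)

lemma opD_sum: "opD s p (\<lambda>x. \<Sum>i\<in>S. \<Phi> i x) = (\<lambda>x. \<Sum>i\<in>S. opD s p (\<Phi> i) x)"
  by (induction S rule: infinite_finite_induct) (simp_all add: opD_linear)

section \<open>Matrices acting by first-order differential operators\<close>

definition act_index :: "nat \<Rightarrow> (nat \<times> nat \<times> nat) set" where
  "act_index n = {1..n} \<times> {..<n + 1} \<times> {..<n + 1}"

lemma sum_act_index:
  "(\<Sum>(k, r, c)\<in>act_index n. h k r c) = (\<Sum>k\<in>{1..n}. \<Sum>r<n + 1. \<Sum>c<n + 1. h k r c)"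
  by (simp only: act_index_def sum.cartesian_product)

definition lie_act :: "nat \<Rightarrow> (nat \<Rightarrow> complex) \<Rightarrow> complex mat \<Rightarrow> fock \<Rightarrow> fock" where
  "lie_act n s A \<Phi> = (\<lambda>x. \<Sum>(k, r, c)\<in>act_index n. A $$ (r, c) * opX s (k, r) (opD s (k, c) \<Phi>) x)"

lemma lie_act_linear:
  "lie_act n s A (\<lambda>x. \<Phi> x + \<Psi> x) = (\<lambda>x. lie_act n s A \<Phi> x + lie_act n s A \<Psi> x)"
  "lie_act n s A (\<lambda>x. a * \<Phi> x) = (\<lambda>x. a * lie_act n s A \<Phi> x)"
  unfolding lie_act_def opX_linear opD_linear sum.distrib[symmetric] sum_distrib_left
  by (intro ext sum.cong refl; simp add: split_def algebra_simps)+

lemma lie_act_zero [simp]: "lie_act n s A (\<lambda>x. 0) = (\<lambda>x. 0)"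
  using lie_act_linear(2)[of n s A 0 "\<lambda>x. 0"] by simp

lemma lie_act_add:
  assumes "A \<in> carrier_mat (n + 1) (n + 1)" "B \<in> carrier_mat (n + 1) (n + 1)"
  shows "lie_act n s (A + B) \<Phi> x = lie_act n s A \<Phi> x + lie_act n s B \<Phi> x"
  unfolding lie_act_def sum.distrib[symmetric]
  using assms by (intro sum.cong) (auto simp: act_index_def algebra_simps)

lemma lie_act_smult:
  assumes "A \<in> carrier_mat (n + 1) (n + 1)"
  shows "lie_act n s (a \<cdot>\<^sub>m A) \<Phi> x = a * lie_act n s A \<Phi> x"
  unfolding lie_act_def sum_distrib_left
  using assms by (intro sum.cong) (auto simp: act_index_def)

lemma lie_act_diff:
  assumes "A \<in> carrier_mat (n + 1) (n + 1)" "B \<in> carrier_mat (n + 1) (n + 1)"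
  shows "lie_act n s (A - B) \<Phi> x = lie_act n s A \<Phi> x - lie_act n s B \<Phi> x"
  unfolding lie_act_def sum_subtractf[symmetric]
  using assms by (intro sum.cong) (auto simp: act_index_def algebra_simps)

lemma sum_contract:
  fixes g :: "'a \<Rightarrow> 'b \<Rightarrow> 'b \<Rightarrow> 'b \<Rightarrow> 'c::comm_monoid_add"
  assumes K: "finite K" and N: "finite N"
  shows "(\<Sum>(k, r, c)\<in>K \<times> N \<times> N. \<Sum>(l, u, v)\<in>K \<times> N \<times> N. if l = k \<and> u = c then g k r c v else 0)
    = (\<Sum>(k, r, v)\<in>K \<times> N \<times> N. \<Sum>c\<in>N. g k r c v)"
proof -
  have cp: "(\<Sum>(k, r, c)\<in>K \<times> N \<times> N. h k r c) = (\<Sum>k\<in>K. \<Sum>r\<in>N. \<Sum>c\<in>N. h k r c)"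
    for h :: "'a \<Rightarrow> 'b \<Rightarrow> 'b \<Rightarrow> 'c"
    by (simp add: sum.cartesian_product)
  have inner: "(\<Sum>(l, u, v)\<in>K \<times> N \<times> N. if l = k \<and> u = c then g k r c v else 0) = (\<Sum>v\<in>N. g k r c v)"
    if "k \<in> K" "c \<in> N" for k r c
  proof -
    have "(\<Sum>(l, u, v)\<in>K \<times> N \<times> N. if l = k \<and> u = c then g k r c v else 0)
      = (\<Sum>l\<in>K. \<Sum>u\<in>N. \<Sum>v\<in>N. if l = k \<and> u = c then g k r c v else 0)"
      by (simp add: sum.cartesian_product)
    also have "\<dots> = (\<Sum>l\<in>K. if l = k then \<Sum>u\<in>N. if u = c then \<Sum>v\<in>N. g k r c v else 0 else 0)"
      by (intro sum.cong refl) (auto intro!: sum.cong)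
    also have "\<dots> = (\<Sum>v\<in>N. g k r c v)"
      using that K N by (simp add: sum.delta)
    finally show ?thesis .
  qed
  have "(\<Sum>(k, r, c)\<in>K \<times> N \<times> N. \<Sum>(l, u, v)\<in>K \<times> N \<times> N. if l = k \<and> u = c then g k r c v else 0)
    = (\<Sum>(k, r, c)\<in>K \<times> N \<times> N. \<Sum>v\<in>N. g k r c v)"
    by (intro sum.cong refl) (auto simp: inner)
  also have "\<dots> = (\<Sum>k\<in>K. \<Sum>r\<in>N. \<Sum>c\<in>N. \<Sum>v\<in>N. g k r c v)"
    by (rule cp)
  also have "\<dots> = (\<Sum>k\<in>K. \<Sum>r\<in>N. \<Sum>v\<in>N. \<Sum>c\<in>N. g k r c v)"
    by (intro sum.cong refl sum.swap)
  also have "\<dots> = (\<Sum>(k, r, v)\<in>K \<times> N \<times> N. \<Sum>c\<in>N. g k r c v)"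
    by (rule cp[symmetric])
  finally show ?thesis .
qed

definition normal_act ::
    "nat \<Rightarrow> (nat \<Rightarrow> complex) \<Rightarrow> complex mat \<Rightarrow> complex mat \<Rightarrow> fock \<Rightarrow> fock" where
  "normal_act n s A B \<Phi> = (\<lambda>x. \<Sum>(k, r, c)\<in>act_index n. \<Sum>(l, u, v)\<in>act_index n.
     A $$ (r, c) * B $$ (u, v) * opX s (k, r) (opX s (l, u) (opD s (k, c) (opD s (l, v) \<Phi>))) x)"

lemma normal_act_commute: "normal_act n s A B \<Phi> = normal_act n s B A \<Phi>"
  unfolding normal_act_def split_def
  by (intro ext, subst sum.swap, intro sum.cong refl, subst opX_opX, subst opD_opD)
    (simp add: mult.commute)

lemma opX_opD_opX:
  "opX s (k, r) (opD s (k, c) (opX s (l, u) \<Phi>)) x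
    = opX s (k, r) (opX s (l, u) (opD s (k, c) \<Phi>)) x + (if l = k \<and> u = c then opX s (k, r) \<Phi> x else 0)"
  unfolding opD_opX prod.inject by (cases "l = k"; cases "u = c"; simp add: opX_linear)

text \<open>Moving the derivations of \<open>A\<close> past the multiplications of \<open>B\<close> leaves a normally ordered
  term that is symmetric in \<open>A\<close> and \<open>B\<close> and a contraction that acts as the product \<open>A * B\<close>.\<close>

lemma lie_act_lie_act:
  assumes "A \<in> carrier_mat (n + 1) (n + 1)" "B \<in> carrier_mat (n + 1) (n + 1)"
  shows "lie_act n s A (lie_act n s B \<Phi>) x = normal_act n s A B \<Phi> x + lie_act n s (A * B) \<Phi> x"
proof -
  have "lie_act n s A (lie_act n s B \<Phi>) x
    = (\<Sum>(k, r, c)\<in>act_index n. \<Sum>(l, u, v)\<in>act_index n. A $$ (r, c) * B $$ (u, v)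
         * opX s (k, r) (opD s (k, c) (opX s (l, u) (opD s (l, v) \<Phi>))) x)"
    unfolding lie_act_def split_def opX_sum opD_sum opX_linear opD_linear sum_distrib_left
    by (simp add: mult.assoc)
  also have "\<dots> = normal_act n s A B \<Phi> x
     + (\<Sum>(k, r, c)\<in>act_index n. \<Sum>(l, u, v)\<in>act_index n. if l = k \<and> u = c then
          A $$ (r, c) * B $$ (c, v) * opX s (k, r) (opD s (k, v) \<Phi>) x else 0)"
    unfolding normal_act_def sum.distrib[symmetric] split_def opX_opD_opX
    by (intro sum.cong refl) (auto simp: algebra_simps)
  also have "(\<Sum>(k, r, c)\<in>act_index n. \<Sum>(l, u, v)\<in>act_index n. if l = k \<and> u = c then
          A $$ (r, c) * B $$ (c, v) * opX s (k, r) (opD s (k, v) \<Phi>) x else 0)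
     = (\<Sum>(k, r, v)\<in>act_index n. \<Sum>c<n + 1.
          A $$ (r, c) * B $$ (c, v) * opX s (k, r) (opD s (k, v) \<Phi>) x)"
    unfolding act_index_def by (rule sum_contract) simp_all
  also have "\<dots> = lie_act n s (A * B) \<Phi> x"
    unfolding lie_act_def using assms
    by (intro sum.cong refl)
      (auto simp: act_index_def scalar_prod_def lessThan_atLeast0 sum_distrib_right simp del: sum.op_ivl_Suc)
  finally show ?thesis .
qed

lemma lie_act_bracket:
  assumes "A \<in> carrier_mat (n + 1) (n + 1)" "B \<in> carrier_mat (n + 1) (n + 1)"
  shows "lie_act n s (bracket A B) \<Phi> x
    = lie_act n s A (lie_act n s B \<Phi>) x - lie_act n s B (lie_act n s A \<Phi>) x"
  using assms normal_act_commute[of n s A B \<Phi>] lie_act_diff[of "A * B" n "B * A" s \<Phi> x]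
  by (simp add: lie_act_lie_act bracket_def)

section \<open>Extension of the action to the free algebra, and the vacuum\<close>

definition alg_act :: "nat \<Rightarrow> (nat \<Rightarrow> complex) \<Rightarrow> (complex mat fword \<Rightarrow>\<^sub>0 complex) \<Rightarrow> fock \<Rightarrow> fock" where
  "alg_act n s p \<Phi> = (\<lambda>x. \<Sum>w\<in>Poly_Mapping.keys p. Poly_Mapping.lookup p w * foldr (lie_act n s) (fletters w) \<Phi> x)"

lemma alg_act_superset:
  assumes "finite S" "Poly_Mapping.keys p \<subseteq> S"
  shows "alg_act n s p \<Phi> x = (\<Sum>w\<in>S. Poly_Mapping.lookup p w * foldr (lie_act n s) (fletters w) \<Phi> x)"
  unfolding alg_act_def using assms
  by (intro sum.mono_neutral_left) (auto simp: in_keys_iff)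

lemma alg_act_add: "alg_act n s (p + q) \<Phi> x = alg_act n s p \<Phi> x + alg_act n s q \<Phi> x"
proof -
  let ?S = "Poly_Mapping.keys p \<union> Poly_Mapping.keys q"
  have "alg_act n s (p + q) \<Phi> x = (\<Sum>w\<in>?S. Poly_Mapping.lookup (p + q) w * foldr (lie_act n s) (fletters w) \<Phi> x)"
    by (rule alg_act_superset) (auto simp: keys_add)
  then show ?thesis
    by (simp add: alg_act_superset[of ?S p] alg_act_superset[of ?S q] lookup_add distrib_right sum.distrib)
qed

lemma alg_act_single:
  "alg_act n s (Poly_Mapping.single w a) \<Phi> x = a * foldr (lie_act n s) (fletters w) \<Phi> x"
  by (subst alg_act_superset[of "{w}"]) auto

lemma alg_act_zero [simp]: "alg_act n s 0 \<Phi> = (\<lambda>x. 0)"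
  by (simp add: alg_act_def)

lemma alg_act_uminus: "alg_act n s (- p) \<Phi> x = - alg_act n s p \<Phi> x"
  using alg_act_add[of n s p "- p" \<Phi> x] by (simp add: add_eq_0_iff)

lemma alg_act_diff: "alg_act n s (p - q) \<Phi> x = alg_act n s p \<Phi> x - alg_act n s q \<Phi> x"
  using alg_act_add[of n s p "- q" \<Phi> x] by (simp add: alg_act_uminus)

lemma foldr_lie_act_linear:
  "foldr (lie_act n s) w (\<lambda>x. \<Phi> x + \<Psi> x) = (\<lambda>x. foldr (lie_act n s) w \<Phi> x + foldr (lie_act n s) w \<Psi> x)"
  "foldr (lie_act n s) w (\<lambda>x. a * \<Phi> x) = (\<lambda>x. a * foldr (lie_act n s) w \<Phi> x)"
  by (induction w) (simp_all add: lie_act_linear)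

lemma foldr_lie_act_zero: "foldr (lie_act n s) w (\<lambda>x. 0) = (\<lambda>x. 0)"
  by (induction w) simp_all

lemma alg_act_on_zero [simp]: "alg_act n s p (\<lambda>x. 0) = (\<lambda>x. 0)"
  by (simp add: alg_act_def foldr_lie_act_zero)

lemma alg_act_mult: "alg_act n s (p * q) \<Phi> = alg_act n s p (alg_act n s q \<Phi>)"
proof (induction p rule: poly_mapping_induct)
  case (single w a)
  show ?case
  proof (induction q rule: poly_mapping_induct)
    case (single u b)
    have "alg_act n s (Poly_Mapping.single u b) \<Phi> = (\<lambda>x. b * foldr (lie_act n s) (fletters u) \<Phi> x)"
      by (intro ext) (rule alg_act_single)
    then show ?case
      by (intro ext) (simp add: mult_single alg_act_single plus_fword_def foldr_lie_act_linear)
  next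
    case (add p q)
    have "alg_act n s (p + q) \<Phi> = (\<lambda>x. alg_act n s p \<Phi> x + alg_act n s q \<Phi> x)"
      by (intro ext) (rule alg_act_add)
    then show ?case using add
      by (intro ext) (simp add: distrib_left alg_act_add alg_act_single foldr_lie_act_linear algebra_simps)
  qed simp
next
  case (add p q)
  then show ?case by (intro ext) (simp add: distrib_right alg_act_add)
qed simp

lemma alg_act_letter: "alg_act n s (letter A) \<Phi> = lie_act n s A \<Phi>"
  by (intro ext) (simp add: letter_def alg_act_single)

lemma alg_act_scalar: "alg_act n s (scalar a) \<Phi> = (\<lambda>x. a * \<Phi> x)"
  by (intro ext) (simp add: scalar_def alg_act_single zero_fword_def)

lemma alg_act_env_ideal:
  assumes "p \<in> env_ideal (sl n)"
  shows "alg_act n s p \<Phi> = (\<lambda>x. 0)"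
proof -
  \<comment> \<open>Vanishing on every \<open>\<Phi>\<close>, not just on one vector, makes
    \<open>K\<close> closed under right multiplication as well, so that it is a two-sided
    ideal.\<close>
  define K where "K = {p \<in> carrier (free_alg (sl n)). \<forall>\<Phi>. alg_act n s p \<Phi> = (\<lambda>x. 0)}"
  have "ideal K (free_alg (sl n))"
  proof (rule idealI[OF free_alg_ring])
    show "subgroup K (add_monoid (free_alg (sl n)))"
    proof (rule group.subgroupI)
      show "Group.group (add_monoid (free_alg (sl n)))"
        using ring.is_abelian_group[OF free_alg_ring] abelian_group.a_group by blast
      fix p assume p: "p \<in> K"
      then have "inv\<^bsub>add_monoid (free_alg (sl n))\<^esub> p = - p"
        using free_alg_a_inv[of p "sl n"] by (simp add: K_def a_inv_def)
      then show "inv\<^bsub>add_monoid (free_alg (sl n))\<^esub> p \<in> K"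
        using p by (auto simp: K_def alg_act_uminus fun_eq_iff)
    next
      show "K \<noteq> {}" using free_alg_zero[of "sl n"] by (auto simp: K_def intro!: exI[of _ 0])
    qed (auto simp: K_def alg_act_add fun_eq_iff)
  qed (auto simp: K_def alg_act_mult)
  moreover have "env_relations (sl n) \<subseteq> K"
  proof
    fix r assume r: "r \<in> env_relations (sl n)"
    then have "r \<in> carrier (free_alg (sl n))" using env_relations_subset by blast
    moreover have "alg_act n s r \<Phi> x = 0" for \<Phi> x
      using r unfolding env_relations_def
      by (auto simp: alg_act_diff alg_act_mult alg_act_letter alg_act_scalar lie_act_add lie_act_smult
          lie_act_bracket sl_carrier[simplified])
    ultimately show "r \<in> K" by (auto simp: K_def)
  qed
  ultimately have "env_ideal (sl n) \<subseteq> K" by (rule env_ideal_minimal)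
  then show ?thesis using assms by (auto simp: K_def)
qed

text \<open>The product of all \<open>x\<^sub>k\<^sub>,\<^sub>k\<close> to the power
  \<open>s k\<close>. The integer exponents are relative to \<open>s\<close>, which enters only
  through \<open>fder\<close>.\<close>

definition vacuum :: fock where
  "vacuum = (\<lambda>x. if x = (\<lambda>_. 0) then 1 else 0)"

definition model_ideal :: "nat \<Rightarrow> (nat \<Rightarrow> complex) \<Rightarrow> (complex mat fword \<Rightarrow>\<^sub>0 complex) set" where
  "model_ideal n s = {p \<in> carrier (free_alg (sl n)). alg_act n s p vacuum = (\<lambda>x. 0)}"

lemma model_left_ideal: "left_ideal n (model_ideal n s)"
proof
  show "env_ideal (sl n) \<subseteq> model_ideal n s"
    using env_ideal_subset by (auto simp: model_ideal_def alg_act_env_ideal)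
  show "p + q \<in> model_ideal n s" if "p \<in> model_ideal n s" "q \<in> model_ideal n s" for p q
    using that by (auto simp: model_ideal_def alg_act_add)
  show "q * p \<in> model_ideal n s" if "q \<in> carrier (free_alg (sl n))" "p \<in> model_ideal n s" for p q
    using that by (auto simp: model_ideal_def alg_act_mult)
qed (auto simp: model_ideal_def)

lemma fder_vacuum: "fst p \<noteq> snd p \<Longrightarrow> fder s p vacuum = (\<lambda>x. 0)"
proof
  fix x assume p: "fst p \<noteq> snd p"
  show "fder s p vacuum x = 0"
  proof (cases "x(p := x p + 1) = (\<lambda>_. 0)")
    case True
    then have "(x(p := x p + 1)) p = 0" by (simp only:)
    then have "x p = - 1" by simp
    then show ?thesis using p by (simp add: fder_def)
  qed (simp add: fder_def vacuum_def)
qed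

text \<open>One of the two factors is a derivative in a variable of exponent zero:
  \<open>opX\<close> if \<open>r < k\<close>, where the Fourier transform applies, and
  \<open>opD\<close> otherwise, because then \<open>c > k\<close>. In the first case the factors
  commute, since \<open>r \<noteq> c\<close>.\<close>

lemma opX_opD_vacuum_raising:
  assumes "r < c"
  shows "opX s (k, r) (opD s (k, c) vacuum) = (\<lambda>x. 0)"
proof (cases "r < k")
  case True
  have "opX s (k, r) (opD s (k, c) vacuum) = opD s (k, c) (opX s (k, r) vacuum)"
    using assms by (simp add: opD_opX)
  also have "opX s (k, r) vacuum = (\<lambda>x. 0)"
    using True fder_vacuum[of "(k, r)" s] by (simp add: opX_def)
  finally show ?thesis by simp
next
  case False
  then have "opD s (k, c) vacuum = (\<lambda>x. 0)"
    using assms fder_vacuum[of "(k, c)" s] by (simp add: opD_def)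
  then show ?thesis by simp
qed

text \<open>For \<open>r < k\<close> multiplication comes before differentiation; reordering them
  produces the constant \<open>- 1\<close>.\<close>

lemma opX_opD_vacuum_diagonal:
  "opX s (k, r) (opD s (k, r) vacuum) x = (if r < k then - 1 else if r = k then s k else 0) * vacuum x"
proof -
  have d: "fmul p (fder s p vacuum) x = (if fst p = snd p then s (fst p) else 0) * vacuum x" for p
    by (cases "x = (\<lambda>_. 0)") (simp_all add: fmul_def fder_def vacuum_def)
  show ?thesis
    using d[of "(k, r)"] by (auto simp: opX_def opD_def fder_fmul)
qed

lemma nplus_vacuum:
  assumes "A \<in> nplus n"
  shows "lie_act n s A vacuum = (\<lambda>x. 0)"
proof
  fix x
  show "lie_act n s A vacuum x = 0"
    unfolding lie_act_def
  proof (intro sum.neutral ballI)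
    fix i assume "i \<in> act_index n"
    moreover obtain k r c where "i = (k, r, c)" by (cases i)
    ultimately show "(case i of (k, r, c) \<Rightarrow> A $$ (r, c) * opX s (k, r) (opD s (k, c) vacuum) x) = 0"
      using assms opX_opD_vacuum_raising[of r c s k]
      by (cases "r < c") (auto simp: nplus_def act_index_def)
  qed
qed

lemma chev_h_entry:
  assumes "i \<in> {1..n}" "r < n + 1" "c < n + 1"
  shows "chev_h n i $$ (r, c) = (if c = r then (if r = i - 1 then 1 else 0) - (if r = i then 1 else 0) else 0)"
  using assms by (auto simp: chev_h_def)

text \<open>Only the rows \<open>i - 1\<close> and \<open>i\<close> contribute: in any other row the
  eigenvalues at the columns \<open>i - 1\<close> and \<open>i\<close> agree and cancel. For
  \<open>i = 1\<close> there is no row \<open>0\<close>, and \<open>s 0 = 0\<close> stands for its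
  missing contribution.\<close>

lemma chev_h_vacuum:
  assumes i: "i \<in> {1..n}" and s: "s 0 = 0"
  shows "lie_act n s (chev_h n i) vacuum x = (s (i - 1) - 1 - s i) * vacuum x"
proof -
  define g where "g k r = (if r < k then - 1 else if r = k then s k else (0 :: complex))" for k r :: nat
  have "lie_act n s (chev_h n i) vacuum x
    = (\<Sum>k\<in>{1..n}. \<Sum>r<n + 1. \<Sum>c<n + 1. chev_h n i $$ (r, c) * opX s (k, r) (opD s (k, c) vacuum) x)"
    unfolding lie_act_def by (rule sum_act_index)
  also have "\<dots> = (\<Sum>k\<in>{1..n}. \<Sum>r<n + 1. \<Sum>c<n + 1. if c = r then
      (if r = i - 1 then g k (i - 1) * vacuum x else 0) - (if r = i then g k i * vacuum x else 0) else 0)"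
  proof (intro sum.cong refl)
    fix k r c assume "k \<in> {1..n}" "r \<in> {..<n + 1}" "c \<in> {..<n + 1}"
    then have "chev_h n i $$ (r, c) * opX s (k, r) (opD s (k, c) vacuum) x
      = (if c = r then ((if r = i - 1 then 1 else 0) - (if r = i then 1 else 0)) * (g k r * vacuum x) else 0)"
      using i by (simp add: chev_h_entry opX_opD_vacuum_diagonal g_def del: if_distrib)
    then show "chev_h n i $$ (r, c) * opX s (k, r) (opD s (k, c) vacuum) x
      = (if c = r then (if r = i - 1 then g k (i - 1) * vacuum x else 0)
          - (if r = i then g k i * vacuum x else 0) else 0)"
      by (simp add: left_diff_distrib)
  qed
  also have "\<dots> = (\<Sum>k\<in>{1..n}. g k (i - 1) * vacuum x - g k i * vacuum x)"
  proof (intro sum.cong refl)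
    have "i - 1 < n + 1" "i < n + 1" using i by auto
    then show "(\<Sum>r<n + 1. \<Sum>c<n + 1. if c = r then (if r = i - 1 then g k (i - 1) * vacuum x else 0)
          - (if r = i then g k i * vacuum x else 0) else 0) = g k (i - 1) * vacuum x - g k i * vacuum x" for k
      by (simp add: sum_subtractf sum.delta del: sum.lessThan_Suc)
  qed
  also have "\<dots> = (\<Sum>k\<in>{1..n}. ((if k = i - 1 then s (i - 1) else 0) + (if k = i then - 1 - s i else 0)) * vacuum x)"
    using i by (intro sum.cong refl) (auto simp: g_def algebra_simps)
  also have "\<dots> = (s (i - 1) - 1 - s i) * vacuum x"
  proof -
    have "(\<Sum>k\<in>{1..n}. if k = i - 1 then s (i - 1) else 0) = s (i - 1)"
      using i s by (cases "i = 1") (auto simp: sum.delta)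
    moreover have "(\<Sum>k\<in>{1..n}. if k = i then - 1 - s i else 0) = - 1 - s i"
      using i by (simp add: sum.delta)
    ultimately show ?thesis
      by (simp only: sum_distrib_right[symmetric] sum.distrib) (simp add: algebra_simps)
  qed
  finally show ?thesis .
qed

text \<open>The solution of \<open>s (i - 1) - 1 - s i = lam (h\<^sub>i)\<close> with \<open>s 0 = 0\<close>.\<close>

definition model_param :: "nat \<Rightarrow> (complex mat \<Rightarrow> complex) \<Rightarrow> nat \<Rightarrow> complex" where
  "model_param n lam k = - (\<Sum>l\<in>{1..k}. 1 + lam (chev_h n l))"

lemma model_param_step:
  "i \<in> {1..n} \<Longrightarrow> model_param n lam (i - 1) - 1 - model_param n lam i = lam (chev_h n i)"
  by (cases i) (auto simp: model_param_def)

section \<open>A functional that detects lowering words\<close>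

definition nonneg_support :: "fock \<Rightarrow> bool" where
  "nonneg_support \<Phi> \<longleftrightarrow> (\<forall>x k r. k \<noteq> r \<longrightarrow> x (k, r) < 0 \<longrightarrow> \<Phi> x = 0)"

lemma nonneg_support_fmul:
  assumes "nonneg_support \<Phi>"
  shows "nonneg_support (fmul p \<Phi>)"
  unfolding nonneg_support_def
proof (intro allI impI)
  fix x :: "nat \<times> nat \<Rightarrow> int" and k r :: nat
  assume kr: "k \<noteq> r" "x (k, r) < 0"
  then have "(x(p := x p - 1)) (k, r) < 0" by auto
  then show "fmul p \<Phi> x = 0" using assms kr(1) by (auto simp: fmul_def nonneg_support_def)
qed

lemma nonneg_support_fder:
  assumes "nonneg_support \<Phi>"
  shows "nonneg_support (fder s p \<Phi>)"
  unfolding nonneg_support_def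
proof (intro allI impI)
  fix x :: "nat \<times> nat \<Rightarrow> int" and k r :: nat
  assume kr: "k \<noteq> r" "x (k, r) < 0"
  show "fder s p \<Phi> x = 0"
  proof (cases "p = (k, r) \<and> x p = - 1")
    \<comment> \<open>A derivative cannot lower an exponent from \<open>0\<close> to
      \<open>- 1\<close>, because its factor vanishes there. On the diagonal \<open>s k\<close> is
      added to this factor, which is why \<open>nonneg_support\<close> leaves the diagonal variables
      unconstrained.\<close>
    case True
    then show ?thesis using kr by (auto simp: fder_def)
  next
    case False
    then have "(x(p := x p + 1)) (k, r) < 0" using kr by auto
    then show ?thesis using assms kr by (auto simp: fder_def nonneg_support_def)
  qed
qed

lemma nonneg_support_lie_act:
  assumes "nonneg_support \<Phi>"
  shows "nonneg_support (lie_act n s A \<Phi>)"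
proof -
  have "nonneg_support (opD s q \<Phi>)" for q
    using assms by (simp add: opD_def nonneg_support_fmul nonneg_support_fder)
  moreover have "nonneg_support (opX s p \<Psi>)" if "nonneg_support \<Psi>" for p \<Psi>
    using nonneg_support_fder[OF that, of s p] nonneg_support_fmul[OF that, of p]
    by (auto simp: opX_def nonneg_support_def)
  ultimately have "nonneg_support (opX s p (opD s q \<Phi>))" for p q
    by blast
  then show ?thesis
    unfolding nonneg_support_def lie_act_def by (auto intro!: sum.neutral)
qed

lemma nonneg_support_vacuum: "nonneg_support vacuum"
  by (auto simp: nonneg_support_def vacuum_def)

text \<open>In row \<open>k\<close> the operator of \<open>chev_f n k\<close> is multiplication by
  the product of \<open>x\<^sub>k\<^sub>,\<^sub>k\<^sub>-\<^sub>1\<close> and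
  \<open>x\<^sub>k\<^sub>,\<^sub>k\<close>. One such product for every element of \<open>c\<close>
  gives the monomial with these exponents.\<close>

definition exponent :: "nat multiset \<Rightarrow> nat \<times> nat \<Rightarrow> int" where
  "exponent c = (\<lambda>(k, r). if r = k \<or> r + 1 = k then int (count c k) else 0)"

text \<open>The coefficient at \<open>exponent c\<close> is multiplicative on lowering words: it factors through the
  abelianisation of the lower triangular subalgebra.\<close>

lemma chev_f_exponent:
  assumes i: "i \<in> {1..n}" and \<Phi>: "nonneg_support \<Phi>"
  shows "lie_act n s (chev_f n i) \<Phi> (exponent c) = (if i \<in># c then \<Phi> (exponent (c - {#i#})) else 0)"
proof -
  have "lie_act n s (chev_f n i) \<Phi> (exponent c)
    = (\<Sum>k\<in>{1..n}. \<Sum>r<n + 1. \<Sum>d<n + 1. chev_f n i $$ (r, d) * opX s (k, r) (opD s (k, d) \<Phi>) (exponent c))"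
    unfolding lie_act_def by (rule sum_act_index)
  also have "\<dots> = (\<Sum>k\<in>{1..n}. \<Sum>r<n + 1. if r = i then \<Sum>d<n + 1. if d = i - 1 then opX s (k, i) (opD s (k, i - 1) \<Phi>) (exponent c) else 0 else 0)"
  proof (intro sum.cong refl)
    fix k r assume r: "r \<in> {..<n + 1}"
    have "chev_f n i $$ (r, d) = (if r = i then if d = i - 1 then 1 else 0 else 0)" if "d < n + 1" for d
      using i r that by (auto simp: chev_f_def)
    then show "(\<Sum>d<n + 1. chev_f n i $$ (r, d) * opX s (k, r) (opD s (k, d) \<Phi>) (exponent c))
      = (if r = i then \<Sum>d<n + 1. if d = i - 1 then opX s (k, i) (opD s (k, i - 1) \<Phi>) (exponent c) else 0 else 0)"
      by (auto intro!: sum.cong simp del: sum.lessThan_Suc sum.delta sum.delta')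
  qed
  also have "\<dots> = (\<Sum>k\<in>{1..n}. opX s (k, i) (opD s (k, i - 1) \<Phi>) (exponent c))"
  proof (intro sum.cong refl)
    have "i - 1 < n + 1" "i < n + 1" using i by auto
    then show "(\<Sum>r<n + 1. if r = i then \<Sum>d<n + 1. if d = i - 1 then opX s (k, i) (opD s (k, i - 1) \<Phi>) (exponent c) else 0 else 0)
      = opX s (k, i) (opD s (k, i - 1) \<Phi>) (exponent c)" for k
      by (simp add: sum.delta del: sum.lessThan_Suc)
  qed
  also have "\<dots> = (\<Sum>k\<in>{1..n}. if k = i then if i \<in># c then \<Phi> (exponent (c - {#i#})) else 0 else 0)"
  proof (intro sum.cong refl)
    fix k assume "k \<in> {1..n}"
    have zero: "\<Phi> x = 0" if "k' \<noteq> r'" "x (k', r') < 0" for x k' r'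
      using \<Phi> that by (auto simp: nonneg_support_def)
    \<comment> \<open>Every row other than \<open>i\<close> contributes zero. One factor there is
      multiplication by a variable that is absent from the monomial \<open>exponent c\<close>,
      namely \<open>(k, i)\<close> if \<open>k < i\<close> and \<open>(k, i - 1)\<close> if
      \<open>i < k\<close>; it asks for a coefficient of \<open>\<Phi>\<close> at a negative
      exponent.\<close>
    consider "k = i" | "k < i" | "i < k" by linarith
    then show "opX s (k, i) (opD s (k, i - 1) \<Phi>) (exponent c)
      = (if k = i then if i \<in># c then \<Phi> (exponent (c - {#i#})) else 0 else 0)"
    proof cases
      case 1
      let ?x = "(exponent c)((i, i) := exponent c (i, i) - 1, (i, i - 1) := exponent c (i, i - 1) - 1)"
      have "opX s (k, i) (opD s (k, i - 1) \<Phi>) (exponent c) = \<Phi> ?x"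
        using 1 i by (auto simp: opX_def opD_def fmul_def)
      moreover have "\<Phi> ?x = 0" if "i \<notin># c"
        using that i by (intro zero[of i "i - 1"]) (auto simp: exponent_def not_in_iff)
      moreover have "?x = exponent (c - {#i#})" if "i \<in># c"
        using that i by (auto simp: exponent_def fun_eq_iff of_nat_diff)
      ultimately show ?thesis using 1 by auto
    next
      case 2
      have "opX s (k, i) (opD s (k, i - 1) \<Phi>) (exponent c)
        = opD s (k, i - 1) \<Phi> ((exponent c)((k, i) := exponent c (k, i) - 1))"
        using 2 by (auto simp: opX_def fmul_def)
      also have "\<dots> = 0"
        using 2 i by (auto simp: opD_def fder_def fmul_def exponent_def intro!: zero[of k i])
      finally show ?thesis using 2 by simp
    next
      case 3
      have "opX s (k, i) (opD s (k, i - 1) \<Phi>) (exponent c) = 0"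
        using 3 i by (auto simp: opX_def opD_def fder_def fmul_def exponent_def intro!: zero[of k "i - 1"])
      then show ?thesis using 3 by simp
    qed
  qed
  also have "\<dots> = (if i \<in># c then \<Phi> (exponent (c - {#i#})) else 0)"
    using i by (simp add: sum.delta)
  finally show ?thesis .
qed

text \<open>The order of the letters is lost and only the content remains. This is enough: multiples
  of hole vectors will be excluded by comparing contents.\<close>

lemma alg_act_word_exponent:
  assumes "set w \<subseteq> {1..n}"
  shows "alg_act n s (fword_f n w) vacuum (exponent c) = (if mset w = c then 1 else 0)"
proof -
  have "nonneg_support (alg_act n s (fword_f n w) vacuum) \<and>
    (\<forall>c. alg_act n s (fword_f n w) vacuum (exponent c) = (if mset w = c then 1 else 0))"
    using assms
  proof (induction w)
    case Nil
    have "exponent c = (\<lambda>_. 0) \<longleftrightarrow> c = {#}" for c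
    proof
      assume "exponent c = (\<lambda>_. 0)"
      then have "exponent c (k, k) = 0" for k by simp
      then show "c = {#}" by (intro multiset_eqI) (simp add: exponent_def)
    qed (auto simp: exponent_def)
    moreover have "alg_act n s (fword_f n []) vacuum = vacuum"
      using alg_act_scalar[of n s 1 vacuum] by simp
    ultimately show ?case using nonneg_support_vacuum by (auto simp: vacuum_def)
  next
    case (Cons i w)
    have "alg_act n s (fword_f n (i # w)) vacuum = lie_act n s (chev_f n i) (alg_act n s (fword_f n w) vacuum)"
      by (simp add: alg_act_mult alg_act_letter)
    moreover have "i \<in># c \<and> mset w = c - {#i#} \<longleftrightarrow> mset (i # w) = c" for c
      by auto
    ultimately show ?case
      using Cons nonneg_support_lie_act by (auto simp: chev_f_exponent)
  qed
  then show ?thesis by blast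
qed

section \<open>Cyclic modules over the enveloping algebra\<close>

definition cls :: "nat \<Rightarrow> (complex mat fword \<Rightarrow>\<^sub>0 complex) \<Rightarrow> env" where
  "cls n p = env_ideal (sl n) +>\<^bsub>free_alg (sl n)\<^esub> p"

lemma env_of_cls: "env_of (sl n) A = cls n (letter A)"
  by (simp add: env_of_def cls_def)

lemma env_scalar_cls: "env_scalar (sl n) c = cls n (scalar c)"
  by (simp add: env_scalar_def cls_def)

lemma Usl_ring: "ring (Usl n)"
  unfolding env_alg_def by (rule ideal.quotient_is_ring[OF env_ideal_ideal])

lemma cls_hom: "cls n \<in> Ring.ring_hom (free_alg (sl n)) (Usl n)"
  unfolding env_alg_def cls_def[abs_def] by (rule ideal.rcos_ring_hom[OF env_ideal_ideal])

lemma carrier_Usl: "carrier (Usl n) = cls n ` carrier (free_alg (sl n))"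
  by (auto simp: env_alg_def FactRing_def A_RCOSETS_def' cls_def)

lemma cls_closed [simp, intro]: "p \<in> carrier (free_alg (sl n)) \<Longrightarrow> cls n p \<in> carrier (Usl n)"
  by (simp add: carrier_Usl)

lemma cls_add: "p \<in> carrier (free_alg (sl n)) \<Longrightarrow> q \<in> carrier (free_alg (sl n)) \<Longrightarrow>
    cls n p \<oplus>\<^bsub>Usl n\<^esub> cls n q = cls n (p + q)"
  using Ring.ring_hom_add[OF cls_hom] by simp

lemma cls_mult: "p \<in> carrier (free_alg (sl n)) \<Longrightarrow> q \<in> carrier (free_alg (sl n)) \<Longrightarrow>
    cls n p \<otimes>\<^bsub>Usl n\<^esub> cls n q = cls n (p * q)"
  using Ring.ring_hom_mult[OF cls_hom] by simp

lemma cls_one: "\<one>\<^bsub>Usl n\<^esub> = cls n 1"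
  using Ring.ring_hom_one[OF cls_hom] by simp

lemma cls_zero: "\<zero>\<^bsub>Usl n\<^esub> = cls n 0"
  using Ring.ring_hom_zero[OF cls_hom free_alg_ring Usl_ring] by simp

lemma cls_uminus: "p \<in> carrier (free_alg (sl n)) \<Longrightarrow> \<ominus>\<^bsub>Usl n\<^esub> cls n p = cls n (- p)"
  using abelian_group.minus_equality[OF ring.is_abelian_group[OF Usl_ring], of n "cls n (- p)" "cls n p"]
  by (simp add: cls_add cls_zero)

lemma cls_minus: "p \<in> carrier (free_alg (sl n)) \<Longrightarrow> q \<in> carrier (free_alg (sl n)) \<Longrightarrow>
    cls n p \<ominus>\<^bsub>Usl n\<^esub> cls n q = cls n (p - q)"
  by (simp add: a_minus_def cls_uminus cls_add)

lemma cls_pow: "p \<in> carrier (free_alg (sl n)) \<Longrightarrow> cls n p [^]\<^bsub>Usl n\<^esub> (k::nat) = cls n (p ^ k)"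
proof (induction k)
  case 0
  then show ?case by (simp add: cls_one monoid.nat_pow_0[OF ring.is_monoid[OF Usl_ring]])
next
  case (Suc k)
  then show ?case
    by (simp add: monoid.nat_pow_Suc[OF ring.is_monoid[OF Usl_ring]] cls_mult power_commutes)
qed

lemma cls_eq_iff:
  assumes "p \<in> carrier (free_alg (sl n))" "q \<in> carrier (free_alg (sl n))"
  shows "cls n p = cls n q \<longleftrightarrow> p - q \<in> env_ideal (sl n)"
proof -
  interpret I: ideal "env_ideal (sl n)" "free_alg (sl n)" by (rule env_ideal_ideal)
  have "cls n p = cls n q \<longleftrightarrow> p \<in> cls n q"
    unfolding cls_def
    using I.a_rcos_self[OF assms(1)] I.a_repr_independence[OF _ assms(2) I.a_subgroup] by auto
  then show ?thesis
    using I.a_rcos_module[OF assms(2,1)] assms by (simp add: cls_def)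
qed

text \<open>Identifies \<open>V\<close> with the quotient of the free algebra by \<open>J\<close>;
  \<open>vec p\<close> is the result of applying \<open>p\<close> to the cyclic vector
  \<open>vec 1\<close>. Afterwards only congruences modulo \<open>J\<close> have to be
  handled.\<close>

locale cyclic_module = left_ideal n J + V: left_module "Usl n" V
  for n J and V :: "(env, 'm) module" +
  fixes vec :: "(complex mat fword \<Rightarrow>\<^sub>0 complex) \<Rightarrow> 'm"
  assumes carrier_V: "carrier V = vec ` F"
    and vec_add: "p \<in> F \<Longrightarrow> q \<in> F \<Longrightarrow> vec (p + q) = vec p \<oplus>\<^bsub>V\<^esub> vec q"
    and vec_smult: "q \<in> F \<Longrightarrow> p \<in> F \<Longrightarrow> cls n q \<odot>\<^bsub>V\<^esub> vec p = vec (q * p)"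
    and vec_zero_iff: "p \<in> F \<Longrightarrow> vec p = \<zero>\<^bsub>V\<^esub> \<longleftrightarrow> p \<in> J"
begin

lemma vec_closed [simp, intro]: "p \<in> F \<Longrightarrow> vec p \<in> carrier V"
  by (simp add: carrier_V)

lemma vec_zero: "vec 0 = \<zero>\<^bsub>V\<^esub>"
  by (simp add: vec_zero_iff)

lemma vec_eq_iff: "p \<in> F \<Longrightarrow> q \<in> F \<Longrightarrow> vec p = vec q \<longleftrightarrow> p \<approx> q"
proof -
  assume pq: "p \<in> F" "q \<in> F"
  have "vec p = vec (p - q) \<oplus>\<^bsub>V\<^esub> vec q"
    using vec_add[of "p - q" q] pq by simp
  then have "vec p = vec q \<longleftrightarrow> vec (p - q) = \<zero>\<^bsub>V\<^esub>"
    using pq by (metis V.add.l_cancel_one' V.add.r_cancel_one free_alg_diff V.l_zero vec_closed)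
  then show ?thesis using pq by (simp add: vec_zero_iff cong_J_def)
qed

text \<open>The full preimage of a weight space under \<open>vec\<close>; in particular it contains
  \<open>J\<close>.\<close>

definition weight_set :: "(complex mat \<Rightarrow> complex) \<Rightarrow> (complex mat fword \<Rightarrow>\<^sub>0 complex) set" where
  "weight_set \<mu> = {p \<in> F. \<forall>A\<in>cartan n. letter A * p \<approx> scalar (\<mu> A) * p}"

lemma weight_set_F: "p \<in> weight_set \<mu> \<Longrightarrow> p \<in> F"
  by (simp add: weight_set_def)

lemma carrier_weight_space: "carrier (weight_space n V \<mu>) = vec ` weight_set \<mu>"
proof -
  have "vec p \<in> carrier (weight_space n V \<mu>) \<longleftrightarrow> p \<in> weight_set \<mu>" if p: "p \<in> F" for p
  proof -
    have "env_of (sl n) A \<odot>\<^bsub>V\<^esub> vec p = env_scalar (sl n) (\<mu> A) \<odot>\<^bsub>V\<^esub> vec p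
      \<longleftrightarrow> letter A * p \<approx> scalar (\<mu> A) * p" if "A \<in> cartan n" for A
    proof -
      have "letter A \<in> F" using that by auto
      then show ?thesis using p by (simp add: env_of_cls env_scalar_cls vec_smult vec_eq_iff)
    qed
    then show ?thesis using p by (simp add: weight_space_def weight_set_def)
  qed
  moreover have "carrier (weight_space n V \<mu>) \<subseteq> vec ` F"
    by (auto simp: weight_space_def carrier_V)
  ultimately show ?thesis using weight_set_F by blast
qed

lemma weight_set_add: "p \<in> weight_set \<mu> \<Longrightarrow> q \<in> weight_set \<mu> \<Longrightarrow> p + q \<in> weight_set \<mu>"
  by (auto simp: weight_set_def distrib_left cong_add)

lemma weight_set_scalar:
  assumes "p \<in> weight_set \<mu>"
  shows "scalar c * p \<in> weight_set \<mu>"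
proof -
  have "letter A * (scalar c * p) \<approx> scalar (\<mu> A) * (scalar c * p)" if "A \<in> cartan n" for A
    unfolding scalar_left_commute[of _ c]
    using that assms by (intro cong_mult) (auto simp: weight_set_def)
  then show ?thesis using assms by (simp add: weight_set_def)
qed

lemma weight_set_J: "J \<subseteq> weight_set \<mu>"
proof
  fix p assume p: "p \<in> J"
  then have "letter A * p - scalar (\<mu> A) * p \<in> J" if "A \<in> cartan n" for A
    using that by (intro diff_J mult_J) auto
  then show "p \<in> weight_set \<mu>" using J_F[OF p] by (simp add: weight_set_def cong_J_def)
qed

lemma weight_space_simps [simp]:
  "zero (weight_space n V \<mu>) = \<zero>\<^bsub>V\<^esub>" "add (weight_space n V \<mu>) = add V"
  "c \<odot>\<^bsub>weight_space n V \<mu>\<^esub> v = cls n (scalar c) \<odot>\<^bsub>V\<^esub> v"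
  by (simp_all add: weight_space_def env_scalar_cls)

lemma weight_space_module: "Module.module (class_ring :: complex ring) (weight_space n V \<mu>)"
proof (rule moduleI)
  show "cring (class_ring :: complex ring)" by (rule class_cring.is_cring)
  show "abelian_group (weight_space n V \<mu>)"
  proof (rule abelian_groupI)
    fix x assume "x \<in> carrier (weight_space n V \<mu>)"
    then obtain p where p: "p \<in> weight_set \<mu>" "x = vec p" by (auto simp: carrier_weight_space)
    have "scalar (- 1) * p \<in> weight_set \<mu>" by (rule weight_set_scalar[OF p(1)])
    moreover have "vec (scalar (- 1) * p) \<oplus>\<^bsub>V\<^esub> vec p = \<zero>\<^bsub>V\<^esub>"
      using p weight_set_F by (simp add: vec_add[symmetric] vec_zero scalar_minus)
    ultimately show "\<exists>y\<in>carrier (weight_space n V \<mu>). y \<oplus>\<^bsub>weight_space n V \<mu>\<^esub> x = \<zero>\<^bsub>weight_space n V \<mu>\<^esub>"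
      using p(2) by (auto simp: carrier_weight_space)
  next
    have "0 \<in> weight_set \<mu>" using weight_set_J zero_J by blast
    then show "\<zero>\<^bsub>weight_space n V \<mu>\<^esub> \<in> carrier (weight_space n V \<mu>)"
      using vec_zero by (force simp: carrier_weight_space)
  qed (auto simp: carrier_weight_space weight_set_F vec_add[symmetric] weight_set_add ac_simps)
qed (auto simp: carrier_weight_space weight_set_F weight_set_scalar vec_smult vec_add[symmetric]
    distrib_left distrib_right scalar_add scalar_mult mult.assoc)

lemma weight_space_vectorspace: "vectorspace (class_ring :: complex ring) (weight_space n V \<mu>)"
  by (rule vectorspace.intro[OF weight_space_module class_field.field_axioms])

lemma weight_space_fin_dim:
  assumes fin: "finite G" and G: "G \<subseteq> weight_set \<mu>" and span: "weight_set \<mu> \<subseteq> lspan J G"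
  shows "vectorspace.fin_dim (class_ring :: complex ring) (weight_space n V \<mu>)"
proof -
  interpret W: vectorspace "class_ring :: complex ring" "weight_space n V \<mu>"
    by (rule weight_space_vectorspace)
  have GC: "vec ` G \<subseteq> carrier (weight_space n V \<mu>)"
    using G by (auto simp: carrier_weight_space)
  have GF: "G \<subseteq> F" using G weight_set_F by blast
  have sub: "LinearCombinations.submodule class_ring (W.span (vec ` G)) (weight_space n V \<mu>)"
    using W.span_is_submodule[OF GC] .
  have "vec p \<in> W.span (vec ` G)" if "p \<in> lspan J G" for p
    using that
  proof induction
    case (ideal p)
    then have "vec p = \<zero>\<^bsub>weight_space n V \<mu>\<^esub>" using J_F by (simp add: vec_zero_iff)
    then show ?case using LinearCombinations.submodule.zero_closed[OF sub] by simp
  next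
    case (gen g)
    then show ?case using W.in_own_span[OF GC] by blast
  next
    case (add p q)
    then show ?case
      using LinearCombinations.submodule.m_closed[OF sub] vec_add[of p q] lspan_F[OF GF] by auto
  next
    case (scale p c)
    then show ?case
      using LinearCombinations.submodule.smult_closed[OF sub, of c "vec p"] vec_smult[of "scalar c" p] lspan_F[OF GF]
      by auto
  qed
  then have "carrier (weight_space n V \<mu>) \<subseteq> W.span (vec ` G)"
    using span by (auto simp: carrier_weight_space)
  then have "W.span (vec ` G) = carrier (weight_space n V \<mu>)"
    using W.span_is_subset2[OF GC] by blast
  then show ?thesis
    unfolding W.fin_dim_def using fin GC by blast
qed

lemma weight_space_linear_map:
  assumes r: "r \<in> F" and maps: "\<And>p. p \<in> weight_set \<mu> \<Longrightarrow> r * p \<in> weight_set \<nu>"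
  shows "linear_map (class_ring :: complex ring) (weight_space n V \<mu>) (weight_space n V \<nu>) (\<lambda>v. cls n r \<odot>\<^bsub>V\<^esub> v)"
proof (intro linear_map.intro mod_hom.intro weight_space_vectorspace weight_space_module mod_hom_axioms.intro)
  have "cls n r \<odot>\<^bsub>V\<^esub> v \<in> carrier (weight_space n V \<nu>)" if "v \<in> carrier (weight_space n V \<mu>)" for v
    using that r maps weight_set_F by (auto simp: carrier_weight_space vec_smult)
  moreover have "cls n r \<odot>\<^bsub>V\<^esub> (cls n (scalar a) \<odot>\<^bsub>V\<^esub> v) = cls n (scalar a) \<odot>\<^bsub>V\<^esub> (cls n r \<odot>\<^bsub>V\<^esub> v)"
    if "v \<in> carrier (weight_space n V \<mu>)" for v a
    using that r weight_set_F by (auto simp: carrier_weight_space vec_smult scalar_left_commute)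
  moreover have "v \<in> carrier V" if "v \<in> carrier (weight_space n V \<mu>)" for v
    using that by (simp add: weight_space_def)
  ultimately show "(\<lambda>v. cls n r \<odot>\<^bsub>V\<^esub> v)
      \<in> LinearCombinations.module_hom class_ring (weight_space n V \<mu>) (weight_space n V \<nu>)"
    using r by (auto simp: LinearCombinations.module_hom_def V.smult_r_distr)
qed

lemma weight_dim_pos:
  assumes "vectorspace.fin_dim (class_ring :: complex ring) (weight_space n V \<mu>)"
    and "p \<in> weight_set \<mu>" "p \<notin> J"
  shows "weight_dim n V \<mu> > 0"
  unfolding weight_dim_def
  using assms weight_set_F[OF assms(2)]
  by (intro dim_pos[where v = "vec p"] weight_space_vectorspace)
    (auto simp: carrier_weight_space vec_zero_iff)

lemma weight_dim_le:
  assumes "vectorspace.fin_dim (class_ring :: complex ring) (weight_space n V \<mu>)"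
    and "vectorspace.fin_dim (class_ring :: complex ring) (weight_space n V \<nu>)"
    and "r \<in> F" "\<And>p. p \<in> weight_set \<mu> \<Longrightarrow> r * p \<in> weight_set \<nu>"
    and "\<And>p. p \<in> weight_set \<mu> \<Longrightarrow> r * p \<in> J \<Longrightarrow> p \<in> J"
  shows "weight_dim n V \<mu> \<le> weight_dim n V \<nu>"
  unfolding weight_dim_def
proof (rule dim_le_of_inj[OF weight_space_linear_map[OF assms(3,4)] assms(1,2)])
  fix v assume "v \<in> carrier (weight_space n V \<mu>)" "cls n r \<odot>\<^bsub>V\<^esub> v = \<zero>\<^bsub>weight_space n V \<nu>\<^esub>"
  then show "v = \<zero>\<^bsub>weight_space n V \<mu>\<^esub>"
    using assms(3,5) weight_set_F by (auto simp: carrier_weight_space vec_smult vec_zero_iff)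
qed

lemma weight_dim_less:
  assumes "vectorspace.fin_dim (class_ring :: complex ring) (weight_space n V \<mu>)"
    and r: "r \<in> F" and maps: "\<And>p. p \<in> weight_set \<mu> \<Longrightarrow> r * p \<in> weight_set \<nu>"
    and surj: "\<And>q. q \<in> weight_set \<nu> \<Longrightarrow> \<exists>p\<in>weight_set \<mu>. q \<approx> r * p"
    and p: "p \<in> weight_set \<mu>" "p \<notin> J" "r * p \<in> J"
  shows "weight_dim n V \<nu> < weight_dim n V \<mu>"
proof -
  have "carrier (weight_space n V \<nu>) \<subseteq> (\<lambda>v. cls n r \<odot>\<^bsub>V\<^esub> v) ` carrier (weight_space n V \<mu>)"
  proof
    fix w assume "w \<in> carrier (weight_space n V \<nu>)"
    then obtain q where q: "q \<in> weight_set \<nu>" "w = vec q" by (auto simp: carrier_weight_space)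
    then obtain p where p: "p \<in> weight_set \<mu>" "q \<approx> r * p" using surj by blast
    then have "w = cls n r \<odot>\<^bsub>V\<^esub> vec p"
      using q r weight_set_F by (simp add: vec_smult vec_eq_iff)
    then show "w \<in> (\<lambda>v. cls n r \<odot>\<^bsub>V\<^esub> v) ` carrier (weight_space n V \<mu>)"
      using p(1) by (auto simp: carrier_weight_space)
  qed
  moreover have "(\<lambda>v. cls n r \<odot>\<^bsub>V\<^esub> v) ` carrier (weight_space n V \<mu>) \<subseteq> carrier (weight_space n V \<nu>)"
    using r maps weight_set_F by (auto simp: carrier_weight_space vec_smult)
  ultimately have im: "(\<lambda>v. cls n r \<odot>\<^bsub>V\<^esub> v) ` carrier (weight_space n V \<mu>) = carrier (weight_space n V \<nu>)"
    by blast
  show ?thesis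
    unfolding weight_dim_def
    using p r weight_set_F[OF p(1)]
    by (intro dim_less_of_surj[OF weight_space_linear_map[OF r maps] assms(1) im, of "vec p"])
      (auto simp: carrier_weight_space vec_smult vec_zero_iff)
qed

end

section \<open>Higher order Verma modules as cyclic modules\<close>

definition hole_poly :: "nat \<Rightarrow> (complex mat \<Rightarrow> complex) \<Rightarrow> nat list \<Rightarrow> complex mat fword \<Rightarrow>\<^sub>0 complex" where
  "hole_poly n lam w = foldr (\<lambda>i u. letter (chev_f n i) ^ (dyn_label n lam i + 1) * u) w 1"

lemma hole_poly_simps [simp]:
  "hole_poly n lam [] = 1"
  "hole_poly n lam (i # w) = letter (chev_f n i) ^ (dyn_label n lam i + 1) * hole_poly n lam w"
  by (simp_all add: hole_poly_def)

lemma hole_poly_in [simp, intro]: "hole_poly n lam w \<in> carrier (free_alg (sl n))"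
  by (induction w) auto

lemma hole_element_cls: "hole_element n lam H = cls n (hole_poly n lam (sorted_list_of_set H))"
proof -
  have "foldr (\<lambda>i u. (env_of (sl n) (chev_f n i) [^]\<^bsub>Usl n\<^esub> (dyn_label n lam i + 1)) \<otimes>\<^bsub>Usl n\<^esub> u) w \<one>\<^bsub>Usl n\<^esub>
    = cls n (hole_poly n lam w)" for w
  proof (induction w)
    case Nil
    then show ?case by (simp add: cls_one)
  next
    case (Cons i w)
    have "foldr (\<lambda>i u. (env_of (sl n) (chev_f n i) [^]\<^bsub>Usl n\<^esub> (dyn_label n lam i + 1)) \<otimes>\<^bsub>Usl n\<^esub> u) (i # w) \<one>\<^bsub>Usl n\<^esub>
      = (env_of (sl n) (chev_f n i) [^]\<^bsub>Usl n\<^esub> (dyn_label n lam i + 1)) \<otimes>\<^bsub>Usl n\<^esub> cls n (hole_poly n lam w)"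
      using Cons by simp
    also have "env_of (sl n) (chev_f n i) [^]\<^bsub>Usl n\<^esub> (dyn_label n lam i + 1) = cls n (letter (chev_f n i) ^ (dyn_label n lam i + 1))"
      unfolding env_of_cls by (rule cls_pow) auto
    finally show ?case by (simp add: cls_mult del: power_Suc)
  qed
  then show ?thesis by (simp add: hole_element_def)
qed

definition verma_generators :: "nat \<Rightarrow> (complex mat \<Rightarrow> complex) \<Rightarrow> (complex mat fword \<Rightarrow>\<^sub>0 complex) set" where
  "verma_generators n lam = letter ` nplus n \<union>
     {letter (chev_h n i) - scalar (lam (chev_h n i)) | i. i \<in> {1..n}}"

lemma nplus_in_sl: "A \<in> nplus n \<Longrightarrow> A \<in> sl n"
  by (auto simp: nplus_def sl_def simp del: sum.lessThan_Suc)

lemma verma_generators_F: "verma_generators n lam \<subseteq> carrier (free_alg (sl n))"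
  using nplus_in_sl chev_h_in_sl by (auto simp: verma_generators_def)

text \<open>The carrier consists of cosets of cosets of classes of polynomials; here both module
  quotients and the enveloping algebra are unwound into a single left ideal. The last clause, that
  \<open>J\<close> is least, serves to prove nonmembership: it suffices to exhibit one left ideal
  \<open>T\<close> that contains the generators and misses the polynomial in question.\<close>

theorem hverma_cyclic:
  fixes n :: nat and lam :: "complex mat \<Rightarrow> complex" and \<H> :: "nat set set"
  obtains J vec where "cyclic_module n J (hverma n lam \<H>) vec"
    and "verma_generators n lam \<subseteq> J"
    and "\<And>H. H \<in> \<H> \<Longrightarrow> hole_poly n lam (sorted_list_of_set H) \<in> J"
    and "\<And>T. left_ideal n T \<Longrightarrow> verma_generators n lam \<subseteq> T \<Longrightarrow>
      (\<And>H. H \<in> \<H> \<Longrightarrow> hole_poly n lam (sorted_list_of_set H) \<in> T) \<Longrightarrow> J \<subseteq> T"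
proof -
  let ?F = "carrier (free_alg (sl n))"
  let ?R = "regular_module (Usl n)"
  interpret R: left_module "Usl n" ?R by (rule regular_left_module[OF Usl_ring])
  have R_simps: "carrier ?R = carrier (Usl n)" "add ?R = add (Usl n)" "zero ?R = zero (Usl n)"
    "smult ?R = mult (Usl n)"
    by (simp_all add: regular_module_def)
  define N1 where "N1 = verma_ideal n lam"
  have gens: "env_of (sl n) ` nplus n \<union>
      {env_of (sl n) (chev_h n i) \<ominus>\<^bsub>Usl n\<^esub> env_scalar (sl n) (lam (chev_h n i)) | i. i \<in> {1..n}}
      = cls n ` verma_generators n lam"
    using chev_h_in_sl
    by (auto simp: verma_generators_def env_of_cls env_scalar_cls cls_minus image_Un image_image)
      (force simp: image_iff cls_minus)+
  have N1_def': "N1 = submodule_gen (Usl n) ?R (cls n ` verma_generators n lam)"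
    unfolding N1_def verma_ideal_def gens ..
  have N1: "Module.submodule N1 (Usl n) ?R"
    unfolding N1_def' using verma_generators_F
    by (intro R.submodule_gen_is_submodule) (auto simp: R_simps)
  interpret A: left_module_quotient "Usl n" ?R N1
    by (intro left_module_quotient.intro left_module_quotient_axioms.intro R.left_module_axioms N1)
  have M_eq: "verma n lam = A.Q" by (simp add: verma_def N1_def)
  interpret M: left_module "Usl n" "verma n lam" unfolding M_eq by (rule A.left_module_quotient)
  define pr where "pr p = N1 +>\<^bsub>?R\<^esub> cls n p" for p
  have pr_closed: "pr p \<in> carrier (verma n lam)" if "p \<in> ?F" for p
    using that by (auto simp: M_eq A.carrier_quotient pr_def R_simps)
  have carrier_M: "carrier (verma n lam) = pr ` ?F"
    by (auto simp: M_eq A.carrier_quotient pr_def R_simps carrier_Usl image_image)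
  have pr_add: "pr p \<oplus>\<^bsub>verma n lam\<^esub> pr q = pr (p + q)" if "p \<in> ?F" "q \<in> ?F" for p q
    using that A.add_quotient[of "cls n p" "cls n q"] by (simp add: M_eq pr_def R_simps cls_add)
  have pr_smult: "cls n q \<odot>\<^bsub>verma n lam\<^esub> pr p = pr (q * p)" if "p \<in> ?F" "q \<in> ?F" for p q
    using that A.smult_quotient[of "cls n q" "cls n p"] by (simp add: M_eq pr_def R_simps cls_mult)
  have pr_zero: "pr p = \<zero>\<^bsub>verma n lam\<^esub> \<longleftrightarrow> cls n p \<in> N1" if "p \<in> ?F" for p
    using that A.proj_eq_zero_iff[of "cls n p"] by (simp add: M_eq pr_def R_simps)
  have pr_eq: "pr p = pr q \<longleftrightarrow> cls n (p - q) \<in> N1" if "p \<in> ?F" "q \<in> ?F" for p q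
  proof -
    have "\<ominus>\<^bsub>?R\<^esub> cls n q = cls n (- q)"
      using that by (intro R.M.minus_equality) (simp_all add: R_simps cls_add cls_zero)
    then have "cls n p \<ominus>\<^bsub>?R\<^esub> cls n q = cls n (p - q)"
      using that by (simp add: a_minus_def R_simps cls_add)
    then show ?thesis
      using that A.proj_eq_iff[of "cls n p" "cls n q"] by (simp add: pr_def R_simps)
  qed
  define N2 where "N2 = submodule_gen (Usl n) (verma n lam)
      {hole_element n lam H \<odot>\<^bsub>verma n lam\<^esub> verma_hw n lam | H. H \<in> \<H>}"
  have hw: "verma_hw n lam = pr 1"
    by (simp add: verma_hw_def pr_def N1_def cls_one)
  have gens2: "{hole_element n lam H \<odot>\<^bsub>verma n lam\<^esub> verma_hw n lam | H. H \<in> \<H>}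
    = {pr (hole_poly n lam (sorted_list_of_set H)) | H. H \<in> \<H>}"
    by (simp add: hw hole_element_cls pr_smult)
  have N2: "Module.submodule N2 (Usl n) (verma n lam)"
    unfolding N2_def gens2 by (intro M.submodule_gen_is_submodule) (auto simp: pr_closed)
  interpret B: left_module_quotient "Usl n" "verma n lam" N2
    by (intro left_module_quotient.intro left_module_quotient_axioms.intro M.left_module_axioms N2)
  have V_eq: "hverma n lam \<H> = B.Q" by (simp add: hverma_def N2_def)
  interpret V: left_module "Usl n" "hverma n lam \<H>" unfolding V_eq by (rule B.left_module_quotient)
  define J where "J = {p \<in> ?F. pr p \<in> N2}"
  define vec where "vec p = N2 +>\<^bsub>verma n lam\<^esub> pr p" for p
  have N1_zero: "pr p \<in> N2" if "p \<in> ?F" "cls n p \<in> N1" for p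
    using that pr_zero[OF that(1)] B.N.zero_closed by simp
  show thesis
  proof (rule that)
    show "cyclic_module n J (hverma n lam \<H>) vec"
    proof (intro cyclic_module.intro left_ideal.intro cyclic_module_axioms.intro V.left_module_axioms)
      show "J \<subseteq> ?F" by (auto simp: J_def)
      show "env_ideal (sl n) \<subseteq> J"
      proof
        fix p assume p: "p \<in> env_ideal (sl n)"
        then have pF: "p \<in> ?F" using env_ideal_subset by blast
        have "cls n p = \<zero>\<^bsub>Usl n\<^esub>"
          using p pF by (simp add: cls_zero cls_eq_iff)
        then have "cls n p \<in> N1" using A.N.zero_closed by (simp add: R_simps)
        then show "p \<in> J" using pF N1_zero by (simp add: J_def)
      qed
      show "p + q \<in> J" if "p \<in> J" "q \<in> J" for p q
        using that B.N.a_closed[of "pr p" "pr q"] by (auto simp: J_def pr_add)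
      show "q * p \<in> J" if "q \<in> ?F" "p \<in> J" for q p
        using that Module.submodule.smult_closed[OF N2, of "cls n q" "pr p"] by (auto simp: J_def pr_smult)
      show "carrier (hverma n lam \<H>) = vec ` ?F"
        by (auto simp: V_eq B.carrier_quotient carrier_M vec_def image_image)
      show "vec (p + q) = vec p \<oplus>\<^bsub>hverma n lam \<H>\<^esub> vec q" if "p \<in> ?F" "q \<in> ?F" for p q
        using that B.add_quotient[OF pr_closed pr_closed] by (simp add: V_eq vec_def pr_add)
      show "cls n q \<odot>\<^bsub>hverma n lam \<H>\<^esub> vec p = vec (q * p)" if "q \<in> ?F" "p \<in> ?F" for q p
        using that B.smult_quotient[OF _ pr_closed, of "cls n q"] by (simp add: V_eq vec_def pr_smult)
      show "vec p = \<zero>\<^bsub>hverma n lam \<H>\<^esub> \<longleftrightarrow> p \<in> J" if "p \<in> ?F" for p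
        using that B.proj_eq_zero_iff[OF pr_closed] by (simp add: V_eq vec_def J_def)
    qed
    show "verma_generators n lam \<subseteq> J"
    proof
      fix p assume p: "p \<in> verma_generators n lam"
      then have pF: "p \<in> ?F" using verma_generators_F by blast
      have "cls n p \<in> N1"
        unfolding N1_def' by (rule subsetD[OF R.submodule_gen_subset imageI[OF p]])
      then show "p \<in> J" using pF N1_zero[OF pF] by (simp add: J_def)
    qed
    show "hole_poly n lam (sorted_list_of_set H) \<in> J" if "H \<in> \<H>" for H
    proof -
      have "pr (hole_poly n lam (sorted_list_of_set H)) \<in> N2"
        unfolding N2_def gens2 by (rule subsetD[OF M.submodule_gen_subset]) (use that in blast)
      then show ?thesis by (simp add: J_def)
    qed
    \<comment> \<open>The images of \<open>T\<close> under \<open>cls n\<close> and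
      \<open>pr\<close> are submodules that contain the respective generators, hence
      \<open>N1\<close> and \<open>N2\<close>. Pulling them back leads into \<open>T\<close> again,
      because \<open>T\<close> contains \<open>env_ideal\<close> and the preimage of
      \<open>N1\<close>.\<close>
    show "J \<subseteq> T" if T: "left_ideal n T" "verma_generators n lam \<subseteq> T"
      "\<And>H. H \<in> \<H> \<Longrightarrow> hole_poly n lam (sorted_list_of_set H) \<in> T" for T
    proof
      interpret T: left_ideal n T by (rule T(1))
      have "Module.submodule (cls n ` T) (Usl n) ?R"
      proof (rule R.submoduleI)
        show "cls n ` T \<subseteq> carrier ?R" using T.J_F by (auto simp: R_simps)
        show "\<zero>\<^bsub>?R\<^esub> \<in> cls n ` T"
          unfolding R_simps cls_zero by (intro imageI T.zero_J)
        show "x \<oplus>\<^bsub>?R\<^esub> y \<in> cls n ` T" if xy: "x \<in> cls n ` T" "y \<in> cls n ` T" for x y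
        proof -
          obtain p q where pq: "x = cls n p" "p \<in> T" "y = cls n q" "q \<in> T" using xy by blast
          have "x \<oplus>\<^bsub>?R\<^esub> y = cls n (p + q)"
            unfolding R_simps pq by (intro cls_add T.J_F pq)
          then show ?thesis using T.add_J[OF pq(2,4)] by simp
        qed
        show "r \<odot>\<^bsub>?R\<^esub> x \<in> cls n ` T" if rx: "r \<in> carrier (Usl n)" "x \<in> cls n ` T" for r x
        proof -
          obtain q p where pq: "r = cls n q" "q \<in> ?F" "x = cls n p" "p \<in> T"
            using rx unfolding carrier_Usl by blast
          have "r \<odot>\<^bsub>?R\<^esub> x = cls n (q * p)"
            unfolding R_simps pq by (intro cls_mult T.J_F pq)
          then show ?thesis using T.mult_J[OF pq(2,4)] by simp
        qed
      qed
      then have "N1 \<subseteq> cls n ` T"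
        unfolding N1_def' using T(2) by (intro R.submodule_gen_minimal) auto
      moreover have inT: "p \<in> T" if p: "p \<in> ?F" "cls n p \<in> cls n ` T" for p
      proof -
        obtain t where t: "t \<in> T" "cls n p = cls n t" using p(2) by auto
        then have "p - t \<in> T" using cls_eq_iff[OF p(1) T.J_F] T.env_J by auto
        then show ?thesis using t(1) T.add_J[of "p - t" t] by simp
      qed
      ultimately have N1T: "p \<in> T" if "p \<in> ?F" "cls n p \<in> N1" for p using that by blast
      have "Module.submodule (pr ` T) (Usl n) (verma n lam)"
      proof (rule M.submoduleI)
        show "pr ` T \<subseteq> carrier (verma n lam)" using T.J_F pr_closed by auto
        have "pr 0 = \<zero>\<^bsub>verma n lam\<^esub>"
          using A.N.zero_closed by (simp add: pr_zero R_simps cls_zero[symmetric])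
        then show "\<zero>\<^bsub>verma n lam\<^esub> \<in> pr ` T" using imageI[OF T.zero_J, of pr] by simp
        show "x \<oplus>\<^bsub>verma n lam\<^esub> y \<in> pr ` T" if xy: "x \<in> pr ` T" "y \<in> pr ` T" for x y
        proof -
          obtain p q where pq: "x = pr p" "p \<in> T" "y = pr q" "q \<in> T" using xy by blast
          have "x \<oplus>\<^bsub>verma n lam\<^esub> y = pr (p + q)"
            unfolding pq by (intro pr_add T.J_F pq)
          then show ?thesis using T.add_J[OF pq(2,4)] by simp
        qed
        show "r \<odot>\<^bsub>verma n lam\<^esub> x \<in> pr ` T" if rx: "r \<in> carrier (Usl n)" "x \<in> pr ` T" for r x
        proof -
          obtain q p where pq: "r = cls n q" "q \<in> ?F" "x = pr p" "p \<in> T"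
            using rx unfolding carrier_Usl by blast
          have "r \<odot>\<^bsub>verma n lam\<^esub> x = pr (q * p)"
            unfolding pq by (intro pr_smult T.J_F pq)
          then show ?thesis using T.mult_J[OF pq(2,4)] by simp
        qed
      qed
      then have N2T: "N2 \<subseteq> pr ` T"
        unfolding N2_def gens2 using T(3) by (intro M.submodule_gen_minimal) auto
      fix p assume "p \<in> J"
      then have p: "p \<in> ?F" "pr p \<in> N2" by (auto simp: J_def)
      then obtain t where t: "t \<in> T" "pr p = pr t" using N2T by auto
      then have "cls n (p - t) \<in> N1" using pr_eq[OF p(1) T.J_F[OF t(1)]] by simp
      then have "p - t \<in> T" using N1T p(1) T.J_F[OF t(1)] by simp
      then show "p \<in> T" using t(1) T.add_J[of "p - t" t] by simp
    qed
  qed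
qed

section \<open>Highest weight ideals\<close>

lemma eps_add: "A \<in> cartan n \<Longrightarrow> B \<in> cartan n \<Longrightarrow> i \<in> {1..n + 1} \<Longrightarrow> eps i (A + B) = eps i A + eps i B"
  by (auto simp: eps_def cartan_def sl_def)

lemma eps_smult: "A \<in> cartan n \<Longrightarrow> i \<in> {1..n + 1} \<Longrightarrow> eps i (c \<cdot>\<^sub>m A) = c * eps i A"
  by (auto simp: eps_def cartan_def sl_def)

lemma root_sum_add:
  "A \<in> cartan n \<Longrightarrow> B \<in> cartan n \<Longrightarrow> set_mset c \<subseteq> {1..n} \<Longrightarrow> root_sum c (A + B) = root_sum c A + root_sum c B"
  by (induction c) (auto simp: simple_root_def eps_add)

lemma root_sum_smult:
  "A \<in> cartan n \<Longrightarrow> set_mset c \<subseteq> {1..n} \<Longrightarrow> root_sum c (a \<cdot>\<^sub>m A) = a * root_sum c A"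
  by (induction c) (auto simp: simple_root_def eps_smult algebra_simps)

lemma root_chev_h:
  assumes "i \<in> {1..n}" "k \<in> {1..n}"
  shows "simple_root k (chev_h n i) = (if k = i then 2 else if dynkin_adjacent k i then - 1 else 0)"
  using assms by (auto simp: simple_root_def eps_def chev_h_def dynkin_adjacent_def)

lemma root_sum_chev_h_zero:
  assumes "i \<in> {1..n}" "set_mset c \<subseteq> {1..n}" "\<And>k. k \<in># c \<Longrightarrow> k \<noteq> i \<and> \<not> dynkin_adjacent k i"
  shows "root_sum c (chev_h n i) = 0"
  using assms(2,3) by (induction c) (auto simp: root_chev_h[OF assms(1)])

lemma root_sum_replicate: "root_sum (replicate_mset p i) A = of_nat p * simple_root i A"
  by (induction p) (auto simp: algebra_simps)

lemma cartan_smult_add: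
  "A \<in> cartan n \<Longrightarrow> B \<in> cartan n \<Longrightarrow> A + B \<in> cartan n"
  "A \<in> cartan n \<Longrightarrow> c \<cdot>\<^sub>m A \<in> cartan n"
  by (auto simp: cartan_def diagonal_mat_def) (auto simp: sl_def)

text \<open>Gaussian elimination on the diagonal from the bottom up: a multiple of
  \<open>chev_h n m\<close> clears position \<open>m\<close>. When only position \<open>0\<close> is
  left, the vanishing trace clears it too.\<close>

lemma cartan_generated:
  assumes A: "A \<in> cartan n"
    and zero: "0\<^sub>m (n + 1) (n + 1) \<in> S"
    and h: "\<And>i. i \<in> {1..n} \<Longrightarrow> chev_h n i \<in> S"
    and add: "\<And>A B. A \<in> S \<Longrightarrow> B \<in> S \<Longrightarrow> A \<in> cartan n \<Longrightarrow> B \<in> cartan n \<Longrightarrow> A + B \<in> S"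
    and smult: "\<And>A c. A \<in> S \<Longrightarrow> A \<in> cartan n \<Longrightarrow> c \<cdot>\<^sub>m A \<in> S"
  shows "A \<in> S"
proof -
  have "A \<in> S" if "A \<in> cartan n" "m \<le> n" "\<And>r. m < r \<Longrightarrow> r \<le> n \<Longrightarrow> A $$ (r, r) = 0" for m A
    using that
  proof (induction m arbitrary: A)
    case 0
    have c: "A \<in> carrier_mat (n + 1) (n + 1)" and d: "diagonal_mat A"
      and tr: "(\<Sum>k<n + 1. A $$ (k, k)) = 0"
      using 0(1) by (auto simp: cartan_def sl_def simp del: sum.lessThan_Suc)
    have "(\<Sum>k<n + 1. A $$ (k, k)) = (\<Sum>k\<in>{0}. A $$ (k, k))"
      using 0(3) by (intro sum.mono_neutral_right) auto
    then have "A $$ (0, 0) = 0" using tr by simp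
    then have "A $$ (r, r) = 0" if "r < n + 1" for r
      using 0(3)[of r] that by (cases "r = 0") auto
    then have "A = 0\<^sub>m (n + 1) (n + 1)"
      using c d by (intro eq_matI) (auto simp: diagonal_mat_def)
    then show ?case using zero by simp
  next
    case (Suc m)
    let ?h = "chev_h n (Suc m)" and ?a = "A $$ (Suc m, Suc m)"
    have hc: "?h \<in> cartan n" using Suc.prems(2) by auto
    have c: "A \<in> carrier_mat (n + 1) (n + 1)" using Suc.prems(1) by (auto simp: cartan_def sl_def)
    \<comment> \<open>Counted from 0, the entry of \<open>chev_h n (Suc m)\<close> at position
      \<open>Suc m\<close> is \<open>- 1\<close>, so adding the multiple by \<open>?a\<close> is
      what cancels the entry.\<close>
    define B where "B = A + ?a \<cdot>\<^sub>m ?h"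
    have BC: "B \<in> cartan n" unfolding B_def by (intro cartan_smult_add Suc.prems hc)
    have "B \<in> S"
    proof (rule Suc.IH[OF BC])
      fix r assume r: "m < r" "r \<le> n"
      have "B $$ (r, r) = A $$ (r, r) + ?a * ?h $$ (r, r)"
        using c r by (simp add: B_def chev_h_def)
      also have "?h $$ (r, r) = (if r = Suc m then - 1 else 0)"
        using r by (simp add: chev_h_def)
      finally show "B $$ (r, r) = 0" using r Suc.prems(3)[of r] by auto
    qed (use Suc.prems in simp)
    moreover have "(- ?a) \<cdot>\<^sub>m ?h \<in> S" "(- ?a) \<cdot>\<^sub>m ?h \<in> cartan n"
      using h[of "Suc m"] Suc.prems(2) hc by (auto intro: smult cartan_smult_add)
    moreover have "A = B + (- ?a) \<cdot>\<^sub>m ?h"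
      using c by (intro eq_matI) (auto simp: B_def chev_h_def)
    ultimately show ?case using add[OF _ _ BC] by metis
  qed
  from this[of A n] show ?thesis using A by simp
qed

section \<open>Strings for \<open>sl\<^sub>2\<close>, and higher powers in the Serre
  relations\<close>

context left_ideal
begin

lemma e_f_other:
  assumes "i \<in> {1..n}" "k \<in> {1..n}" "i \<noteq> k" "q \<in> F"
  shows "e k * (f i ^ t * q) \<approx> f i ^ t * (e k * q)"
proof (induction t)
  case (Suc t)
  have "e k * (f i * (f i ^ t * q)) \<approx> f i * (e k * (f i ^ t * q)) + (if k = i then h k * (f i ^ t * q) else 0)"
    using assms by (intro e_f) auto
  also have "\<dots> = f i * (e k * (f i ^ t * q))" using assms by simp
  also have "\<dots> \<approx> f i * (f i ^ t * (e k * q))"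
    using Suc by (intro cong_mult) auto
  finally show ?case by (simp add: mult.assoc)
qed simp

lemma weight_f_power:
  assumes "A \<in> cartan n" "i \<in> {1..n}" "q \<in> F" "letter A * q \<approx> scalar c * q"
  shows "letter A * (f i ^ t * q) \<approx> scalar (c - of_nat t * simple_root i A) * (f i ^ t * q)"
proof (induction t)
  case (Suc t)
  have "letter A * (f i * (f i ^ t * q)) \<approx> scalar (c - of_nat t * simple_root i A - simple_root i A) * (f i * (f i ^ t * q))"
    using assms Suc by (intro cartan_weight_f) auto
  then show ?case by (simp add: algebra_simps)
qed (use assms in simp)

lemma weight_e_power:
  assumes "A \<in> cartan n" "i \<in> {1..n}" "q \<in> F" "letter A * q \<approx> scalar c * q"
  shows "letter A * (e i ^ t * q) \<approx> scalar (c + of_nat t * simple_root i A) * (e i ^ t * q)"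
proof (induction t)
  case (Suc t)
  have "letter A * (e i * (e i ^ t * q)) \<approx> scalar (c + of_nat t * simple_root i A + simple_root i A) * (e i * (e i ^ t * q))"
    using assms Suc by (intro cartan_weight_e) auto
  then show ?case by (simp add: algebra_simps)
qed (use assms in simp)

lemma root_self: "i \<in> {1..n} \<Longrightarrow> simple_root i (chev_h n i) = 2"
  by (simp add: root_chev_h)

text \<open>The correction term decides everything: it vanishes at \<open>c = of_nat t\<close>,
  which makes hole vectors singular, and while it does not vanish, powers of \<open>f i\<close> stay
  nonzero on a vector killed by \<open>e i\<close>.\<close>

lemma e_f_power:
  assumes i: "i \<in> {1..n}" and q: "q \<in> F" and wt: "h i * q \<approx> scalar c * q"
  shows "e i * (f i ^ Suc t * q) \<approx> f i ^ Suc t * (e i * q)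
    + scalar (of_nat (Suc t) * (c - of_nat t)) * (f i ^ t * q)"
proof (induction t)
  case 0
  have "e i * (f i * q) \<approx> f i * (e i * q) + (if i = i then h i * q else 0)"
    using i q by (intro e_f)
  also have "\<dots> \<approx> f i * (e i * q) + scalar c * q"
    using wt by (intro cong_add) auto
  finally show ?case by simp
next
  case (Suc t)
  let ?q = "f i ^ Suc t * q"
  have "e i * (f i * ?q) \<approx> f i * (e i * ?q) + (if i = i then h i * ?q else 0)"
    using i q by (intro e_f) auto
  also have "\<dots> \<approx> f i * (f i ^ Suc t * (e i * q) + scalar (of_nat (Suc t) * (c - of_nat t)) * (f i ^ t * q))
      + scalar (c - of_nat (Suc t) * simple_root i (chev_h n i)) * ?q"
    using i q wt weight_f_power[of "chev_h n i" i q c "Suc t"]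
    by (intro cong_add cong_mult Suc) auto
  also have "\<dots> = f i ^ Suc (Suc t) * (e i * q)
      + (scalar (of_nat (Suc t) * (c - of_nat t)) + scalar (c - of_nat (Suc t) * 2)) * ?q"
    unfolding root_self[OF i] by (simp add: distrib_left distrib_right scalar_left_commute mult.assoc add.assoc)
  also have "scalar (of_nat (Suc t) * (c - of_nat t)) + scalar (c - of_nat (Suc t) * 2)
      = scalar (of_nat (Suc (Suc t)) * (c - of_nat (Suc t)))"
    unfolding scalar_add[symmetric] by (simp add: algebra_simps)
  finally show ?case by (simp add: mult.assoc)
qed

lemma f_e_power:
  assumes i: "i \<in> {1..n}" and q: "q \<in> F" and wt: "h i * q \<approx> scalar c * q"
  shows "f i * (e i ^ Suc t * q) \<approx> e i ^ Suc t * (f i * q)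
    - scalar (of_nat (Suc t) * (c + of_nat t)) * (e i ^ t * q)"
proof -
  have fe: "f i * (e i * r) \<approx> e i * (f i * r) - h i * r" if "r \<in> F" for r
  proof -
    have "e i * (f i * r) - (f i * (e i * r) + h i * r) \<in> J"
      using e_f[of i i r] i that by (simp add: cong_J_def)
    from uminus_J[OF this] show ?thesis by (simp add: cong_J_def algebra_simps)
  qed
  show ?thesis
  proof (induction t)
    case 0
    have "f i * (e i * q) \<approx> e i * (f i * q) - h i * q"
      using q by (rule fe)
    also have "\<dots> \<approx> e i * (f i * q) - scalar c * q"
      using wt by (intro cong_diff) auto
    finally show ?case by simp
  next
    case (Suc t)
    let ?q = "e i ^ Suc t * q"
    have "f i * (e i * ?q) \<approx> e i * (f i * ?q) - h i * ?q"
      using q by (intro fe) auto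
    also have "\<dots> \<approx> e i * (e i ^ Suc t * (f i * q) - scalar (of_nat (Suc t) * (c + of_nat t)) * (e i ^ t * q))
        - scalar (c + of_nat (Suc t) * simple_root i (chev_h n i)) * ?q"
      using i q wt weight_e_power[of "chev_h n i" i q c "Suc t"]
      by (intro cong_diff cong_mult Suc) auto
    also have "\<dots> = e i ^ Suc (Suc t) * (f i * q)
        - (scalar (of_nat (Suc t) * (c + of_nat t)) + scalar (c + of_nat (Suc t) * 2)) * ?q"
      unfolding root_self[OF i]
      by (simp add: right_diff_distrib distrib_right scalar_left_commute mult.assoc diff_diff_eq)
    also have "scalar (of_nat (Suc t) * (c + of_nat t)) + scalar (c + of_nat (Suc t) * 2)
        = scalar (of_nat (Suc (Suc t)) * (c + of_nat (Suc t)))"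
      unfolding scalar_add[symmetric] by (simp add: algebra_simps)
    finally show ?case by (simp add: mult.assoc)
  qed
qed

text \<open>Applying \<open>e i\<close> to the power \<open>Suc N\<close> returns a nonzero multiple
  of the power \<open>N\<close>, so a vanishing power can be lowered step by step down to
  \<open>q\<close> itself.\<close>

lemma f_power_nonzero:
  assumes i: "i \<in> {1..n}" and q: "q \<in> F" and wt: "h i * q \<approx> scalar c * q"
    and eq: "e i * q \<in> J" and N: "\<And>t. t < N \<Longrightarrow> c \<noteq> of_nat t" and fq: "f i ^ N * q \<in> J"
  shows "q \<in> J"
  using N fq
proof (induction N)
  case (Suc N)
  have "e i * (f i ^ Suc N * q) - f i ^ Suc N * (e i * q) \<in> J"
    by (intro diff_J[OF mult_J[OF _ Suc.prems(2)] mult_J[OF _ eq]]) auto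
  moreover have "e i * (f i ^ Suc N * q) - f i ^ Suc N * (e i * q)
      \<approx> scalar (of_nat (Suc N) * (c - of_nat N)) * (f i ^ N * q)"
    using e_f_power[OF i q wt, of N] by (simp only: cong_J_def diff_diff_eq)
  ultimately have "scalar (of_nat (Suc N) * (c - of_nat N)) * (f i ^ N * q) \<in> J"
    using cong_J_iff by blast
  moreover have "of_nat (Suc N) * (c - of_nat N) \<noteq> 0"
    using Suc.prems(1)[of N] by (simp del: of_nat_Suc)
  ultimately have "f i ^ N * q \<in> J"
    by (simp add: scalar_J_iff)
  then show ?case using Suc by simp
qed simp

text \<open>The mirror image for a lowest weight vector. Together with the local nilpotency of
  \<open>e i\<close> it yields injectivity of \<open>f i\<close> on sufficiently negative
  weights.\<close>

lemma e_power_nonzero: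
  assumes i: "i \<in> {1..n}" and q: "q \<in> F" and wt: "h i * q \<approx> scalar c * q"
    and fq: "f i * q \<in> J" and N: "\<And>t. t < N \<Longrightarrow> c + of_nat t \<noteq> 0" and eq: "e i ^ N * q \<in> J"
  shows "q \<in> J"
  using N eq
proof (induction N)
  case (Suc N)
  have "e i ^ Suc N * (f i * q) - f i * (e i ^ Suc N * q) \<in> J"
    by (intro diff_J[OF mult_J[OF _ fq] mult_J[OF _ Suc.prems(2)]]) auto
  moreover have "e i ^ Suc N * (f i * q) - f i * (e i ^ Suc N * q)
      \<approx> scalar (of_nat (Suc N) * (c + of_nat N)) * (e i ^ N * q)"
    using uminus_J[of "f i * (e i ^ Suc N * q) - (e i ^ Suc N * (f i * q)
      - scalar (of_nat (Suc N) * (c + of_nat N)) * (e i ^ N * q))"] f_e_power[OF i q wt, of N]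
    by (simp add: cong_J_def algebra_simps del: power_Suc of_nat_Suc)
  ultimately have "scalar (of_nat (Suc N) * (c + of_nat N)) * (e i ^ N * q) \<in> J"
    using cong_J_iff by blast
  moreover have "of_nat (Suc N) * (c + of_nat N) \<noteq> 0"
    using Suc.prems(1)[of N] by (simp del: of_nat_Suc)
  ultimately have "e i ^ N * q \<in> J"
    by (simp add: scalar_J_iff)
  then show ?case using Suc by simp
qed simp

section \<open>Moving powers of a lowering operator through words\<close>

lemma f_power_commute_word:
  assumes "i \<in> {1..n}" "set w \<subseteq> {1..n}" "\<And>k. k \<in> set w \<Longrightarrow> \<not> dynkin_adjacent i k" "q \<in> F"
  shows "f i ^ t * (fw w * q) \<approx> fw w * (f i ^ t * q)"
proof -
  have one: "f i * (fw w * r) \<approx> fw w * (f i * r)" if "r \<in> F" for r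
    using assms(2,3)
  proof (induction w)
    case (Cons k w)
    have "f i * (f k * (fw w * r)) \<approx> f k * (f i * (fw w * r))"
      using Cons.prems assms(1) that by (intro f_commute) auto
    also have "\<dots> \<approx> f k * (fw w * (f i * r))"
      using Cons by (intro cong_mult) auto
    finally show ?case by (simp add: mult.assoc)
  qed simp
  show ?thesis
  proof (induction t)
    case (Suc t)
    have "f i * (f i ^ t * (fw w * q)) \<approx> f i * (fw w * (f i ^ t * q))"
      using Suc by (intro cong_mult) auto
    also have "\<dots> \<approx> fw w * (f i * (f i ^ t * q))"
      using assms by (intro one) auto
    finally show ?case by (simp add: mult.assoc)
  qed simp
qed

text \<open>Since the bracket of \<open>f i\<close> and \<open>f j\<close> commutes with
  \<open>f i\<close>, each passage of an \<open>f i\<close> across \<open>f j\<close> adds one more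
  copy of the same term: \<open>f i ^ Suc t\<close> times \<open>f j\<close> is \<open>f j\<close>
  times \<open>f i ^ Suc t\<close> plus \<open>Suc t\<close> copies of the bracket times
  \<open>f i ^ t\<close>. Expanding the bracket gives the stated form.\<close>

lemma serre_power:
  assumes i: "i \<in> {1..n}" and j: "j \<in> {1..n}" and adj: "dynkin_adjacent i j" and q: "q \<in> F"
  shows "f i ^ Suc t * (f j * q) \<approx> scalar (of_nat (Suc t)) * (f i * (f j * (f i ^ t * q)))
    - scalar (of_nat t) * (f j * (f i ^ Suc t * q))"
proof (induction t)
  case (Suc t)
  let ?q = "f i ^ t * q"
  have s: "f i * (f i * (f j * ?q)) \<approx> scalar 2 * (f i * (f j * (f i * ?q))) - f j * (f i * (f i * ?q))"
    using serre[OF i j adj, of ?q] q by (simp add: cong_J_def algebra_simps)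
  have "f i * (f i ^ Suc t * (f j * q)) \<approx> f i * (scalar (of_nat (Suc t)) * (f i * (f j * ?q))
    - scalar (of_nat t) * (f j * (f i ^ Suc t * q)))"
    using Suc by (intro cong_mult) auto
  also have "\<dots> = scalar (of_nat (Suc t)) * (f i * (f i * (f j * ?q)))
    - scalar (of_nat t) * (f i * (f j * (f i ^ Suc t * q)))"
    by (simp only: right_diff_distrib scalar_left_commute)
  also have "\<dots> \<approx> scalar (of_nat (Suc t)) * (scalar 2 * (f i * (f j * (f i * ?q))) - f j * (f i * (f i * ?q)))
    - scalar (of_nat t) * (f i * (f j * (f i ^ Suc t * q)))"
    by (intro cong_diff cong_mult s) auto
  also have "\<dots> = (scalar (of_nat (Suc t) * 2) - scalar (of_nat t)) * (f i * (f j * (f i ^ Suc t * q)))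
    - scalar (of_nat (Suc t)) * (f j * (f i ^ Suc (Suc t) * q))"
  proof -
    have "a * (b * X - Y) - c * X = (a * b - c) * X - a * Y" for a b c X Y :: "complex mat fword \<Rightarrow>\<^sub>0 complex"
      by (simp add: algebra_simps)
    then show ?thesis by (simp only: scalar_mult power_Suc mult.assoc)
  qed
  also have "scalar (of_nat (Suc t) * 2) - scalar (of_nat t) = scalar (of_nat (Suc (Suc t)))"
    unfolding scalar_diff[symmetric] by (simp add: add.commute)
  finally show ?case by (simp add: mult.assoc)
qed simp

text \<open>Both terms on the right of \<open>serre_power\<close> end in a multiple of
  \<open>f i ^ t * q\<close>; an adjacent \<open>f j\<close> therefore delays the vanishing by at
  most one power.\<close>

lemma serre_kernel:
  assumes "i \<in> {1..n}" "j \<in> {1..n}" "dynkin_adjacent i j" "q \<in> F" "f i ^ t * q \<in> J"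
  shows "f i ^ Suc t * (f j * q) \<in> J"
proof -
  have "f i * (f i ^ t * q) \<in> J" by (intro mult_J assms) auto
  then have "f i ^ Suc t * q \<in> J" by (simp add: mult.assoc)
  then have "scalar (of_nat (Suc t)) * (f i * (f j * (f i ^ t * q)))
    - scalar (of_nat t) * (f j * (f i ^ Suc t * q)) \<in> J"
    by (intro diff_J[OF mult_J[OF _ mult_J[OF _ mult_J[OF _ assms(5)]]] mult_J[OF _ mult_J]]) auto
  then show ?thesis using serre_power[OF assms(1-4)] cong_J_iff by blast
qed

lemma word_pull_commuting:
  assumes i: "i \<in> {1..n}" and w: "set w \<subseteq> {1..n}" "i \<in> set w" "\<And>k. k \<in> set w \<Longrightarrow> \<not> dynkin_adjacent i k"
    and q: "q \<in> F"
  obtains u where "fw w * q \<approx> f i * (fw u * q)" "add_mset i (mset u) = mset w"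
  using w
proof (induction w arbitrary: thesis)
  case (Cons k w)
  show thesis
  proof (cases "k = i")
    case True
    then show ?thesis using Cons.prems(1)[of w] by (simp add: mult.assoc)
  next
    case False
    then obtain u where u: "fw w * q \<approx> f i * (fw u * q)" "add_mset i (mset u) = mset w"
      using Cons.IH Cons.prems by auto
    have "f k * (fw w * q) \<approx> f k * (f i * (fw u * q))"
      by (intro cong_mult u) auto
    also have "\<dots> \<approx> f i * (f k * (fw u * q))"
      using Cons.prems i q dynkin_adjacent_def by (intro f_commute) auto
    finally show ?thesis
      using Cons.prems(1)[of "k # u"] u(2) by (simp add: mult.assoc add_mset_commute)
  qed
qed simp

text \<open>Besides \<open>f i\<close>, every letter except the single \<open>i + 1\<close> commutes
  with \<open>f i\<close>. If \<open>i + 1\<close> stands in front of all letters \<open>i\<close>,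
  two of these can be brought directly behind it, and the Serre relation rewrites the three letters
  as \<open>f i\<close> times a combination. This is why \<open>i\<close> has to occur
  twice.\<close>

lemma word_pull_serre:
  assumes i: "i \<in> {1..n}" and w: "set w \<subseteq> {1..n}" "i - 1 \<notin> set w" "count (mset w) (i + 1) = 1"
    "count (mset w) i \<ge> 2" and q: "q \<in> F"
  shows "\<exists>p\<in>lspan J {fw u * q | u. add_mset i (mset u) = mset w}. fw w * q \<approx> f i * p"
  using w
proof (induction w)
  case (Cons k w)
  let ?G = "{fw u * q | u. add_mset i (mset u) = mset (k # w)}"
  consider "k = i" | "k = i + 1" | "k \<noteq> i" "k \<noteq> i + 1" by blast
  then show ?case
  proof cases
    case 1
    then have "fw w * q \<in> ?G" by auto
    then show ?thesis
      using 1 by (intro bexI[of _ "fw w * q"] lspan.gen) (auto simp: mult.assoc)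
  next
    case 2
    have w: "set w \<subseteq> {1..n}" "\<And>l. l \<in> set w \<Longrightarrow> \<not> dynkin_adjacent i l"
      and c: "count (mset w) i \<ge> 2"
      using Cons.prems 2 by (auto simp: dynkin_adjacent_def count_eq_zero_iff)
    from c have "i \<in> set w" by (metis count_mset_0_iff not_numeral_le_zero)
    then obtain u where u: "fw w * q \<approx> f i * (fw u * q)" "add_mset i (mset u) = mset w"
      using word_pull_commuting[OF i w(1) _ w(2) q] by metis
    have uw: "set u \<subseteq> set w" using u(2) by (metis set_mset_mset set_mset_add_mset_insert subset_insertI)
    have "count (mset u) i \<ge> 1" using c u(2) by (metis count_add_mset Suc_1 Suc_le_mono One_nat_def)
    then have "i \<in> set u" by (metis count_mset_0_iff not_one_le_zero)
    then obtain v where v: "fw u * q \<approx> f i * (fw v * q)" "add_mset i (mset v) = mset u"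
      using word_pull_commuting[OF i _ _ _ q, of u] uw w by (metis subset_trans subsetD)
    let ?j = "i + 1" and ?v = "fw v * q"
    have j: "?j \<in> {1..n}" using Cons.prems 2 by auto
    have "f ?j * (fw w * q) \<approx> f ?j * (f i * (f i * ?v))"
    proof (intro cong_mult)
      show "fw w * q \<approx> f i * (f i * ?v)"
        using u(1) cong_mult[OF _ v(1), of "f i"] by (auto intro: cong_trans)
    qed auto
    also have "\<dots> \<approx> scalar 2 * (f i * (f ?j * (f i * ?v))) - f i * (f i * (f ?j * ?v))"
    proof -
      have "f i * (f i * (f ?j * ?v)) + f ?j * (f i * (f i * ?v)) \<approx> scalar 2 * (f i * (f ?j * (f i * ?v)))"
        using i j q by (intro serre) (auto simp: dynkin_adjacent_def)
      then show ?thesis by (simp add: cong_J_def algebra_simps)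
    qed
    also have "\<dots> = f i * (scalar 2 * (fw (?j # i # v) * q) - fw (i # ?j # v) * q)"
      by (simp add: right_diff_distrib mult.assoc scalar_left_commute)
    finally have "fw (k # w) * q \<approx> f i * (scalar 2 * (fw (?j # i # v) * q) - fw (i # ?j # v) * q)"
      using 2 by (simp add: mult.assoc)
    moreover have "add_mset i (mset (?j # i # v)) = mset (k # w)" "add_mset i (mset (i # ?j # v)) = mset (k # w)"
      using 2 u(2) v(2) by (auto simp: add_mset_commute)
    then have "fw (?j # i # v) * q \<in> ?G" "fw (i # ?j # v) * q \<in> ?G" by blast+
    then have "scalar 2 * (fw (?j # i # v) * q) - fw (i # ?j # v) * q \<in> lspan J ?G"
      by (intro lspan_diff lspan.scale lspan.gen)
    ultimately show ?thesis by blast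
  next
    case 3
    then obtain p where p: "p \<in> lspan J {fw u * q | u. add_mset i (mset u) = mset w}" "fw w * q \<approx> f i * p"
      using Cons by auto
    have pF: "p \<in> F" by (rule lspan_F[OF _ p(1)]) (use q in auto)
    have "f k * (fw w * q) \<approx> f k * (f i * p)"
      by (intro cong_mult p) auto
    also have "\<dots> \<approx> f i * (f k * p)"
      using 3 Cons.prems i pF by (intro f_commute) (auto simp: dynkin_adjacent_def)
    finally have "fw (k # w) * q \<approx> f i * (f k * p)" by (simp add: mult.assoc)
    moreover have "f k * p \<in> lspan J ?G"
    proof (rule lspan_mult[OF _ _ p(1)])
      fix g assume "g \<in> {fw u * q | u. add_mset i (mset u) = mset w}"
      then obtain u where u: "g = fw u * q" "add_mset i (mset u) = mset w" by blast
      then have "f k * g = fw (k # u) * q" "add_mset i (mset (k # u)) = mset (k # w)"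
        by (simp_all add: mult.assoc add_mset_commute)
      then show "f k * g \<in> lspan J ?G" by (intro lspan.gen) blast
    qed auto
    ultimately show ?thesis by blast
  qed
qed simp

end

section \<open>Quotients of the Verma module\<close>

locale highest_weight_ideal = left_ideal +
  fixes lam :: "complex mat \<Rightarrow> complex"
  assumes lam: "lam \<in> cartan_dual n" and gens: "verma_generators n lam \<subseteq> J"
begin

lemma e_in_J: "e i \<in> J"
proof -
  have "chev_e n i \<in> nplus n"
    unfolding nplus_def chev_e_def by (intro CollectI conjI allI impI mat_unit_carrier) auto
  then show ?thesis using gens by (auto simp: verma_generators_def)
qed

lemma cartan_hw:
  assumes "A \<in> cartan n"
  shows "letter A * 1 \<approx> scalar (lam A) * 1"
proof -
  define S where "S = {A. letter A * 1 \<approx> scalar (lam A) * 1}"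
  have "A \<in> S"
    using assms
  proof (rule cartan_generated)
    have z: "0\<^sub>m (n + 1) (n + 1) \<in> cartan n"
      unfolding cartan_def by (intro CollectI conjI sl_zero) (simp add: diagonal_mat_def)
    have "lam (0 \<cdot>\<^sub>m 0\<^sub>m (n + 1) (n + 1)) = 0 * lam (0\<^sub>m (n + 1) (n + 1))"
      using lam z unfolding cartan_dual_def by blast
    then have "lam (0\<^sub>m (n + 1) (n + 1)) = 0" by simp
    then show "0\<^sub>m (n + 1) (n + 1) \<in> S"
      using letter_zero[of 1] by (simp add: S_def)
  next
    fix i assume "i \<in> {1..n}"
    then have "h i - scalar (lam (chev_h n i)) \<in> J"
      using gens by (auto simp: verma_generators_def)
    then show "chev_h n i \<in> S" by (simp add: S_def cong_J_def)
  next
    fix A B assume AB: "A \<in> S" "B \<in> S" "A \<in> cartan n" "B \<in> cartan n"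
    then have l: "lam (A + B) = lam A + lam B" using lam by (simp add: cartan_dual_def)
    have "letter (A + B) * 1 \<approx> letter A * 1 + letter B * 1"
      using AB by (intro letter_add) auto
    also have "\<dots> \<approx> scalar (lam A) * 1 + scalar (lam B) * 1"
      using AB by (intro cong_add) (simp_all add: S_def)
    finally show "A + B \<in> S" by (simp add: S_def l scalar_add)
  next
    fix A c assume A: "A \<in> S" "A \<in> cartan n"
    then have l: "lam (c \<cdot>\<^sub>m A) = c * lam A" using lam by (simp add: cartan_dual_def)
    have "letter (c \<cdot>\<^sub>m A) * 1 \<approx> scalar c * (letter A * 1)"
      using A by (intro letter_smult) auto
    also have "\<dots> \<approx> scalar c * (scalar (lam A) * 1)"
      using A by (intro cong_mult) (simp_all add: S_def)
    finally show "c \<cdot>\<^sub>m A \<in> S" by (simp add: S_def l scalar_mult)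
  qed
  then show ?thesis by (simp add: S_def)
qed

lemma cartan_word:
  assumes "A \<in> cartan n" "set w \<subseteq> {1..n}"
  shows "letter A * fw w \<approx> scalar (lam A - root_sum (mset w) A) * fw w"
  using cartan_weight_fw[OF assms free_alg_one cartan_hw[OF assms(1)]] by simp

lemma F_words: "F \<subseteq> lspan J {fw w * 1 | w. set w \<subseteq> {1..n}}"
proof
  fix p assume "p \<in> F"
  then have "p * 1 \<in> lspan J {fw w * y | w y. set w \<subseteq> {1..n} \<and> y \<in> {1}}"
  proof (intro word_span_stable[where wt = "\<lambda>_. lam"])
    show "1 \<in> lspan J {fw w * y | w y. set w \<subseteq> {1..n} \<and> y \<in> {1}}"
      by (intro lspan.gen CollectI exI[of _ "[]"] exI[of _ 1]) simp
  qed (auto simp: e_in_J dest: cartan_hw)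
  then show "p \<in> lspan J {fw w * 1 | w. set w \<subseteq> {1..n}}" by simp
qed

text \<open>Each application of \<open>e i\<close> uses up one letter \<open>i\<close>, so after
  more applications than there are such letters the spanning set is empty.\<close>

lemma e_power_words:
  assumes i: "i \<in> {1..n}" and c: "set_mset c \<subseteq> {1..n}" and p: "p \<in> lspan J {fw w | w. mset w = c}"
    and N: "count c i < N"
  shows "e i ^ N * p \<in> J"
  using c p N
proof (induction N arbitrary: c p)
  case (Suc N)
  have step: "e i * p \<in> lspan J {fw u | u. add_mset i (mset u) = c}"
  proof (rule lspan_mult[OF _ _ Suc.prems(2)])
    fix g assume "g \<in> {fw w | w. mset w = c}"
    then obtain w where w: "g = fw w" "mset w = c" by blast
    have "set w \<subseteq> {1..n}" using w Suc.prems(1) by auto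
    moreover have "h i * 1 \<approx> scalar (lam (chev_h n i)) * 1"
      using cartan_hw i by blast
    ultimately have "e i * (fw w * 1) \<in> lspan J {fw u * 1 | u. add_mset i (mset u) = mset w}"
      using i e_in_J by (intro e_fw) auto
    then show "e i * g \<in> lspan J {fw u | u. add_mset i (mset u) = c}" using w by simp
  qed auto
  have comm: "e i ^ Suc N * p = e i ^ N * (e i * p)"
    by (simp only: power_Suc2 mult.assoc)
  show ?case
  proof (cases "i \<in># c")
    case True
    then have "{fw u | u. add_mset i (mset u) = c} = {fw u | u. mset u = c - {#i#}}"
      by (metis insert_DiffM add_mset_remove_trivial)
    moreover have "count (c - {#i#}) i < N"
    proof -
      obtain m where "count c i = Suc m"
        using True by (metis count_eq_zero_iff not0_implies_Suc)
      then show ?thesis using Suc.prems(3) by simp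
    qed
    moreover have "set_mset (c - {#i#}) \<subseteq> {1..n}" using Suc.prems(1) by (meson in_diffD subset_iff)
    ultimately show ?thesis using Suc.IH[of "c - {#i#}" "e i * p"] step comm by simp
  next
    case False
    then have "{fw u | u. add_mset i (mset u) = c} = {}" by auto
    then have "e i * p \<in> J" using step by (simp add: lspan_empty)
    then show ?thesis unfolding comm by (rule mult_J[rotated]) auto
  qed
qed simp

end

definition hole_word :: "(nat \<Rightarrow> nat) \<Rightarrow> nat list \<Rightarrow> nat list" where
  "hole_word a w = concat (map (\<lambda>i. replicate (a i + 1) i) w)"

lemma hole_poly_word: "hole_poly n lam w = fword_f n (hole_word (dyn_label n lam) w)"
  by (induction w) (simp_all add: hole_word_def fword_f_append fword_f_replicate del: power_Suc replicate_Suc)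

lemma set_hole_word [simp]: "set (hole_word a w) = set w"
  by (induction w) (auto simp: hole_word_def)

lemma count_hole_word: "distinct w \<Longrightarrow> count (mset (hole_word a w)) k = (if k \<in> set w then a k + 1 else 0)"
  by (induction w) (auto simp: hole_word_def)

lemma dyn_label_eq:
  assumes "lam (chev_h n i) \<in> \<nat>"
  shows "lam (chev_h n i) = of_nat (dyn_label n lam i)"
proof -
  obtain k where k: "lam (chev_h n i) = of_nat k" using assms by (auto elim: Nats_cases)
  then have "dyn_label n lam i = k" by (auto simp: dyn_label_def)
  then show ?thesis using k by simp
qed

text \<open>The nodes of a hole are pairwise orthogonal, so the later factors leave the weight at
  \<open>h i\<close> equal to the label; the coefficient in \<open>e_f_power\<close> is then zero at
  the exponent label plus one. For \<open>k \<noteq> i\<close> the raising operator passes the power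
  of \<open>f i\<close> unchanged.\<close>

lemma (in highest_weight_ideal) hole_singular:
  assumes "distinct w" "set w \<subseteq> {1..n}" "\<And>k l. k \<in> set w \<Longrightarrow> l \<in> set w \<Longrightarrow> \<not> dynkin_adjacent k l"
    and "\<And>k. k \<in> set w \<Longrightarrow> lam (chev_h n k) \<in> \<nat>" and "k \<in> {1..n}"
  shows "e k * hole_poly n lam w \<in> J"
  using assms
proof (induction w)
  case Nil
  then show ?case using e_in_J by simp
next
  case (Cons i w)
  let ?Y = "hole_poly n lam w"
  have IH: "e k * ?Y \<in> J" using Cons by simp
  have i: "i \<in> {1..n}" using Cons.prems by simp
  show ?case
  proof (cases "k = i")
    case False
    have "e k * (f i ^ (dyn_label n lam i + 1) * ?Y) \<approx> f i ^ (dyn_label n lam i + 1) * (e k * ?Y)"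
      using i False Cons.prems(5) by (intro e_f_other) auto
    moreover have "f i ^ (dyn_label n lam i + 1) * (e k * ?Y) \<in> J"
      by (rule mult_J[OF _ IH]) auto
    ultimately show ?thesis using cong_J_iff by (simp del: power_Suc)
  next
    case True
    have "root_sum (mset (hole_word (dyn_label n lam) w)) (chev_h n i) = 0"
      using Cons.prems i by (intro root_sum_chev_h_zero) auto
    then have "h i * ?Y \<approx> scalar (of_nat (dyn_label n lam i)) * ?Y"
      using cartan_word[of "chev_h n i" "hole_word (dyn_label n lam) w"] Cons.prems i
        dyn_label_eq[of lam n i]
      by (simp add: hole_poly_word)
    then have "e i * (f i ^ Suc (dyn_label n lam i) * ?Y) \<approx> f i ^ Suc (dyn_label n lam i) * (e i * ?Y)
      + scalar (of_nat (Suc (dyn_label n lam i)) * (of_nat (dyn_label n lam i) - of_nat (dyn_label n lam i))) * (f i ^ dyn_label n lam i * ?Y)"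
      using i by (intro e_f_power) auto
    moreover have "f i ^ Suc (dyn_label n lam i) * (e i * ?Y) \<in> J"
      by (rule mult_J[OF _ IH[unfolded True]]) auto
    ultimately show ?thesis using True cong_J_iff by (simp del: power_Suc)
  qed
qed

section \<open>Words that survive in a higher order Verma module\<close>

lemma verma_generators_model: "verma_generators n lam \<subseteq> model_ideal n (model_param n lam)"
proof
  fix p assume p: "p \<in> verma_generators n lam"
  have "alg_act n (model_param n lam) p vacuum = (\<lambda>x. 0)"
    using p unfolding verma_generators_def
  proof
    assume "p \<in> letter ` nplus n"
    then show ?thesis by (auto simp: alg_act_letter nplus_vacuum)
  next
    assume "p \<in> {letter (chev_h n i) - scalar (lam (chev_h n i)) | i. i \<in> {1..n}}"
    then obtain i where i: "i \<in> {1..n}" "p = letter (chev_h n i) - scalar (lam (chev_h n i))" by blast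
    have "model_param n lam 0 = 0" by (simp add: model_param_def)
    then have "alg_act n (model_param n lam) p vacuum x = 0" for x
      unfolding i(2) alg_act_diff alg_act_letter alg_act_scalar
      using chev_h_vacuum[OF i(1), of "model_param n lam" x] model_param_step[OF i(1), of lam] by simp
    then show ?thesis by blast
  qed
  then show "p \<in> model_ideal n (model_param n lam)"
    using p verma_generators_F by (auto simp: model_ideal_def)
qed

text \<open>The comparison takes place in the Weyl algebra model. The hole vectors are singular
  there as well, so they generate only what lowering words make of them; each of these products has
  too many letters at some node to have the content of \<open>w\<close>, and the functional for that
  content separates them from \<open>w\<close>.\<close>

theorem word_not_in_ideal:
  fixes n :: nat
  assumes lam: "lam \<in> cartan_dual n" and holes: "\<And>H. H \<in> \<H> \<Longrightarrow> hole n H"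
    and dom: "\<And>H. H \<in> \<H> \<Longrightarrow> lam \<in> dominant_on n H"
    and min: "\<And>T. left_ideal n T \<Longrightarrow> verma_generators n lam \<subseteq> T \<Longrightarrow>
      (\<And>H. H \<in> \<H> \<Longrightarrow> hole_poly n lam (sorted_list_of_set H) \<in> T) \<Longrightarrow> J \<subseteq> T"
    and w: "set w \<subseteq> {1..n}" and untouched: "\<And>H. H \<in> \<H> \<Longrightarrow> \<exists>k\<in>H. count (mset w) k \<le> dyn_label n lam k"
  shows "fword_f n w \<notin> J"
proof
  assume wJ: "fword_f n w \<in> J"
  define s where "s = model_param n lam"
  interpret M: left_ideal n "model_ideal n s" by (rule model_left_ideal)
  interpret M: highest_weight_ideal n "model_ideal n s" lam
    by unfold_locales (use lam verma_generators_model in \<open>auto simp: s_def\<close>)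
  define Y where "Y = {hole_poly n lam (sorted_list_of_set H) | H. H \<in> \<H>}"
  define W where "W = {fword_f n u * y | u y. set u \<subseteq> {1..n} \<and> y \<in> Y}"
  \<comment> \<open>The candidate to which leastness of \<open>J\<close> is applied. That it is a
    left ideal is the content of \<open>word_span_stable\<close>, with the hole vectors as
    \<open>Y\<close>.\<close>
  define T where "T = lspan (model_ideal n s) W"
  have fin: "finite H" if "H \<in> \<H>" for H
    using holes[OF that] finite_subset by (auto simp: hole_def)
  have hw: "set (sorted_list_of_set H) \<subseteq> {1..n}" if "H \<in> \<H>" for H
    using holes[OF that] fin[OF that] by (simp add: hole_def)
  have YF: "Y \<subseteq> carrier (free_alg (sl n))" by (auto simp: Y_def)
  have Ye: "letter (chev_e n i) * y \<in> model_ideal n s" if y: "y \<in> Y" and i: "i \<in> {1..n}" for y i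
  proof -
    obtain H where H: "H \<in> \<H>" "y = hole_poly n lam (sorted_list_of_set H)" using y by (auto simp: Y_def)
    then show ?thesis
      using holes[OF H(1)] dom[OF H(1)] fin[OF H(1)] i
      by (auto simp: hole_def dominant_on_def intro!: M.hole_singular)
  qed
  have "\<forall>y\<in>Y. \<exists>g. \<forall>A\<in>cartan n. M.cong_J (letter A * y) (scalar (g A) * y)"
  proof
    fix y assume "y \<in> Y"
    then obtain H where H: "H \<in> \<H>" "y = hole_poly n lam (sorted_list_of_set H)" by (auto simp: Y_def)
    then show "\<exists>g. \<forall>A\<in>cartan n. M.cong_J (letter A * y) (scalar (g A) * y)"
      unfolding H(2) hole_poly_word using hw[OF H(1)]
      by (intro exI[of _ "\<lambda>A. lam A - root_sum (mset (hole_word (dyn_label n lam) (sorted_list_of_set H))) A"])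
        (auto intro!: M.cartan_word)
  qed
  then obtain wt where wt: "\<And>y A. y \<in> Y \<Longrightarrow> A \<in> cartan n \<Longrightarrow> M.cong_J (letter A * y) (scalar (wt y A) * y)"
    by metis
  have WF: "W \<subseteq> carrier (free_alg (sl n))" using YF by (auto simp: W_def)
  have "left_ideal n T"
  proof
    show "T \<subseteq> carrier (free_alg (sl n))" using M.lspan_F[OF WF] by (auto simp: T_def)
    show "env_ideal (sl n) \<subseteq> T" using M.env_J by (auto simp: T_def intro: lspan.ideal)
    show "p + q \<in> T" if "p \<in> T" "q \<in> T" for p q
      using that by (simp add: T_def lspan.add)
    show "q * p \<in> T" if "q \<in> carrier (free_alg (sl n))" "p \<in> T" for q p
      using M.word_span_stable[OF YF Ye wt that(1)] that(2) by (simp add: T_def W_def)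
  qed
  moreover have "verma_generators n lam \<subseteq> T"
    using M.gens by (auto simp: T_def intro: lspan.ideal)
  moreover have "hole_poly n lam (sorted_list_of_set H) \<in> T" if "H \<in> \<H>" for H
    unfolding T_def
  proof (intro lspan.gen)
    have "fword_f n [] * hole_poly n lam (sorted_list_of_set H) \<in> W"
      unfolding W_def Y_def using that by fastforce
    then show "hole_poly n lam (sorted_list_of_set H) \<in> W" by simp
  qed
  ultimately have "J \<subseteq> T" by (rule min)
  then have wT: "fword_f n w \<in> T" using wJ by blast
  have "alg_act n s p vacuum (exponent (mset w)) = 0" if "p \<in> lspan (model_ideal n s) W" for p
    using that
  proof induction
    case (ideal p)
    then show ?case by (simp add: model_ideal_def)
  next
    case (gen g)
    then obtain u H where g: "g = fword_f n u * hole_poly n lam (sorted_list_of_set H)"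
      and u: "set u \<subseteq> {1..n}" and H: "H \<in> \<H>" by (auto simp: W_def Y_def)
    let ?v = "hole_word (dyn_label n lam) (sorted_list_of_set H)"
    obtain k where k: "k \<in> H" "count (mset w) k \<le> dyn_label n lam k" using untouched[OF H] by blast
    have "count (mset ?v) k = dyn_label n lam k + 1"
      using k fin[OF H] by (simp add: count_hole_word)
    \<comment> \<open>The hole vector alone already contains \<open>k\<close> more often than
      \<open>w\<close> does, whatever \<open>u\<close> adds.\<close>
    then have "mset (u @ ?v) \<noteq> mset w" using k(2) by (metis Suc_eq_plus1 count_union le_add2 le_trans mset_append not_less_eq_eq)
    moreover have "g = fword_f n (u @ ?v)" by (simp add: g hole_poly_word fword_f_append)
    ultimately show ?case
      using alg_act_word_exponent[of "u @ ?v" n s "mset w"] u hw[OF H] by simp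
  next
    case (add p q)
    then show ?case by (simp add: alg_act_add)
  next
    case (scale p c)
    then show ?case by (simp add: alg_act_mult alg_act_scalar)
  qed
  then have "alg_act n s (fword_f n w) vacuum (exponent (mset w)) = 0" using wT by (simp add: T_def)
  then show False using alg_act_word_exponent[OF w, of s "mset w"] by simp
qed

section \<open>The choice of the hole\<close>

lemma contains_min_hole:
  assumes "finite \<H>" "H \<in> \<H>"
  obtains K where "K \<in> min_holes \<H>" "K \<subseteq> H"
proof -
  obtain K where "K \<in> {K \<in> \<H>. K \<subseteq> H}" "\<And>L. L \<in> {K \<in> \<H>. K \<subseteq> H} \<Longrightarrow> L \<subseteq> K \<Longrightarrow> K = L"
    using finite_has_minimal[of "{K \<in> \<H>. K \<subseteq> H}"] assms by auto
  then show thesis using that[of K] by (fastforce simp: min_holes_def)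
qed

text \<open>Minimise first the spread of \<open>H\<close> and then the gap between its two smallest elements.\<close>

lemma hole_choice:
  assumes fin: "finite \<H>" and holes: "\<And>H. H \<in> \<H> \<Longrightarrow> H \<subseteq> {1..n}"
    and nonempty: "\<H> \<noteq> {}" and empty: "{} \<notin> \<H>"
    and nosing: "\<And>H. H \<in> min_holes \<H> \<Longrightarrow> \<not> is_singleton H"
  obtains H i j where "H \<in> \<H>" "i \<in> H" "j \<in> H" "i < j" "\<And>k. k \<in> H \<Longrightarrow> k = i \<or> j \<le> k"
    "\<And>K. K \<in> \<H> \<Longrightarrow> \<not> K \<subseteq> {i + 1..<j} \<union> (H - {i})"
    "\<And>K. K \<in> \<H> \<Longrightarrow> \<not> K \<subseteq> {i..<j} \<union> (H - {j})"
proof -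
  let ?M = "min_holes \<H>"
  have M: "K \<in> \<H>" "K \<subseteq> {1..n}" "finite K" "K \<noteq> {}" "K - {Min K} \<noteq> {}" if "K \<in> ?M" for K
  proof -
    show K: "K \<in> \<H>" using that by (simp add: min_holes_def)
    show "K \<subseteq> {1..n}" using holes[OF K] .
    then show "finite K" using finite_subset by blast
    show ne: "K \<noteq> {}" using K empty by blast
    show "K - {Min K} \<noteq> {}"
    proof
      assume "K - {Min K} = {}"
      then have "K = {Min K}" using ne by blast
      then show False using nosing[OF that] by (metis is_singletonI)
    qed
  qed
  \<comment> \<open>The gap is smaller than \<open>n + 1\<close>, so this number orders holes
    lexicographically by spread and gap.\<close>
  define d where "d K = (Max K - Min K) * (n + 1) + (Min (K - {Min K}) - Min K)" for K :: "nat set"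
  have dM: "Min K \<in> K" "Max K \<in> K" "Min (K - {Min K}) \<in> K" "Min K < Min (K - {Min K})"
    "1 \<le> Min K" "Max K \<le> n" "Min (K - {Min K}) \<le> n" if "K \<in> ?M" for K
  proof -
    note K = M[OF that]
    show "Min K \<in> K" "Max K \<in> K" using K by auto
    have second: "Min (K - {Min K}) \<in> K - {Min K}" using K by (intro Min_in) auto
    then show "Min (K - {Min K}) \<in> K" by blast
    have "Min K \<le> Min (K - {Min K})" using second K(3) by (intro Min_le) auto
    then show "Min K < Min (K - {Min K})" using second by force
    show "1 \<le> Min K" "Max K \<le> n" "Min (K - {Min K}) \<le> n" using K(2) \<open>Min K \<in> K\<close> \<open>Max K \<in> K\<close> second by auto
  qed
  obtain H0 where "H0 \<in> \<H>" using nonempty by blast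
  then obtain K0 where "K0 \<in> ?M" using contains_min_hole[OF fin] by metis
  then obtain H where H: "H \<in> ?M" and least: "\<And>K. K \<in> ?M \<Longrightarrow> d H \<le> d K"
    using ex_has_least_nat[of "\<lambda>K. K \<in> ?M" K0 d] by blast
  define i where "i = Min H"
  define j where "j = Min (H - {Min H})"
  note HM = M[OF H] and HdM = dM[OF H]
  \<comment> \<open>Within the interval from \<open>i\<close> to \<open>Max H\<close>, a minimal
    hole that misses an endpoint has smaller spread than \<open>H\<close>, against the choice of
    \<open>H\<close>.\<close>
  have spread: False if K: "K \<in> ?M" "K \<subseteq> {i..Max H}" "i \<notin> K \<or> Max H \<notin> K" for K
  proof -
    have "Max K - Min K < Max H - Min H"
    proof -
      have "Min K \<in> {i..Max H}" "Max K \<in> {i..Max H}" using dM(1,2)[OF K(1)] K(2) by blast+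
      moreover have "Min K \<noteq> i \<or> Max K \<noteq> Max H" using K(3) dM(1,2)[OF K(1)] by metis
      moreover have "Min H < Max H" using HdM HM Max_ge[of H "Min (H - {Min H})"] by linarith
      ultimately show ?thesis by (auto simp: i_def)
    qed
    then have "(Max K - Min K + 1) * (n + 1) \<le> (Max H - Min H) * (n + 1)"
      by (intro mult_right_mono) auto
    moreover have "(Max K - Min K + 1) * (n + 1) = (Max K - Min K) * (n + 1) + (n + 1)"
      by (simp only: distrib_right mult_1)
    moreover have "Min (K - {Min K}) - Min K < n + 1" using dM(7)[OF K(1)] by linarith
    ultimately have "d K < d H" unfolding d_def by linarith
    then show False using least[OF K(1)] by simp
  qed
  have jH: "j \<in> H" "i \<in> H" "i < j" using HdM by (auto simp: i_def j_def)
  have second: "k = i \<or> j \<le> k" if "k \<in> H" for k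
  proof (cases "k = Min H")
    case False
    then have "k \<in> H - {Min H}" using that by blast
    then show ?thesis using HM(3) by (auto simp: j_def)
  qed (simp add: i_def)
  have range: "H \<subseteq> {i..Max H}" using HM(3) by (auto simp: i_def)
  show thesis
  proof (rule that[of H i j])
    show "H \<in> \<H>" by (rule HM(1))
    show "k = i \<or> j \<le> k" if "k \<in> H" for k by (rule second[OF that])
    show "\<not> K \<subseteq> {i + 1..<j} \<union> (H - {i})" if KH: "K \<in> \<H>" for K
    proof
      assume sub: "K \<subseteq> {i + 1..<j} \<union> (H - {i})"
      obtain L where L: "L \<in> ?M" "L \<subseteq> K" using contains_min_hole[OF fin KH] by metis
      have "j \<le> Max H" using jH HM(3) by simp
      then have "L \<subseteq> {i..Max H}" "i \<notin> L"
        using L sub range by fastforce+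
      then show False using spread[OF L(1)] by blast
    qed
    show "\<not> K \<subseteq> {i..<j} \<union> (H - {j})" if KH: "K \<in> \<H>" for K
    proof
      assume sub: "K \<subseteq> {i..<j} \<union> (H - {j})"
      obtain L where L: "L \<in> ?M" "L \<subseteq> K" using contains_min_hole[OF fin KH] by metis
      have "j \<le> Max H" using jH HM(3) by simp
      then have LR: "L \<subseteq> {i..Max H}"
        using L sub range by fastforce
      then have iL: "i \<in> L" "Max H \<in> L" using spread[OF L(1)] by blast+
      have "j \<notin> L" using L sub by auto
      \<comment> \<open>Minimality of \<open>H\<close> would force \<open>L = H\<close>, but
        \<open>j \<notin> L\<close>. So \<open>L\<close> has an element between \<open>i\<close> and
        \<open>j\<close>, which makes its gap smaller at equal spread.\<close>
      then have "\<not> L \<subseteq> H"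
        using H jH(1) M(1)[OF L(1)] by (auto simp: min_holes_def)
      then obtain k where k: "k \<in> L" "k \<notin> H" by blast
      then have k': "i < k" "k < j" using L sub jH(2) by (auto simp: subset_iff) (metis le_neq_implies_less)
      have MinL: "Min L = i" using iL(1) LR M(3)[OF L(1)] by (intro Min_eqI) auto
      have MaxL: "Max L = Max H" using iL(2) LR M(3)[OF L(1)] by (intro Max_eqI) auto
      have "Min (L - {Min L}) \<le> k" using k k' M(3)[OF L(1)] MinL by (intro Min_le) auto
      then have "d L < d H"
        using k' dM(4)[OF L(1)] HdM(4) by (simp add: d_def MinL MaxL) (simp add: i_def j_def)
      then show False using least[OF L(1)] by simp
    qed
  qed (use jH in auto)
qed

section \<open>Weight spaces of cyclic highest weight modules\<close>

locale highest_weight_module = cyclic_module n J V vec + highest_weight_ideal n J lam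
  for n J and V :: "(env, 'm) module" and vec lam
begin

abbreviation wt :: "nat multiset \<Rightarrow> complex mat \<Rightarrow> complex" where
  "wt c \<equiv> \<lambda>A. lam A - root_sum c A"

lemma word_weight: "set w \<subseteq> {1..n} \<Longrightarrow> fw w \<in> weight_set (wt (mset w))"
  using cartan_word by (auto simp: weight_set_def)

lemma weight_set_span:
  assumes "set_mset c \<subseteq> {1..n}" "p \<in> weight_set (wt c)"
  shows "p \<in> lspan J {fw w | w. mset w = c}"
proof -
  have "p \<in> F" using assms(2) by (rule weight_set_F)
  then have "p \<in> lspan J {fw w * 1 | w. set w \<subseteq> {1..n}}" using F_words by blast
  then have "p \<in> lspan J {fw w * 1 | w. mset w = c}"
    using assms by (intro weight_space_words[where ch = lam] cartan_hw) (auto simp: weight_set_def)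
  then show ?thesis by simp
qed

lemma weight_fin_dim:
  assumes c: "set_mset c \<subseteq> {1..n}"
  shows "vectorspace.fin_dim (class_ring :: complex ring) (weight_space n V (wt c))"
proof (rule weight_space_fin_dim)
  have "finite {w. mset w = c}"
    by (rule finite_subset[OF _ finite_lists_length_eq[of "set_mset c" "size c"]]) auto
  then show "finite {fw w | w. mset w = c}" by simp
  show "{fw w | w. mset w = c} \<subseteq> weight_set (wt c)"
    using word_weight c by auto
  show "weight_set (wt c) \<subseteq> lspan J {fw w | w. mset w = c}"
    using weight_set_span[OF c] by blast
qed

lemma f_weight_set:
  assumes i: "i \<in> {1..n}" and p: "p \<in> weight_set (wt c)"
  shows "f i * p \<in> weight_set (wt (add_mset i c))"
  unfolding weight_set_def
proof (intro CollectI conjI ballI)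
  have pF: "p \<in> F" using p by (rule weight_set_F)
  then show "f i * p \<in> F" by (intro free_alg_mult free_alg_letter chev_f_in_sl)
  fix A assume A: "A \<in> cartan n"
  have "letter A * p \<approx> scalar (wt c A) * p" using p A unfolding weight_set_def by blast
  from cartan_weight_f[OF A i pF this]
  show "letter A * (f i * p) \<approx> scalar (wt (add_mset i c) A) * (f i * p)"
    by (simp only: root_sum_simps diff_diff_eq add.commute)
qed

lemma h_weight_set:
  "i \<in> {1..n} \<Longrightarrow> p \<in> weight_set (wt c) \<Longrightarrow> h i * p \<approx> scalar (wt c (chev_h n i)) * p"
  unfolding weight_set_def by blast

text \<open>Every word of the larger content has at least two letters \<open>i\<close>, one letter
  \<open>i + 1\<close> and none equal to \<open>i - 1\<close>, so \<open>word_pull_serre\<close>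
  factors out an \<open>f i\<close> and leaves words of content \<open>c\<close>.\<close>

lemma f_surjective:
  assumes i: "i \<in> {1..n}" and c: "set_mset c \<subseteq> {1..n}" "i - 1 \<notin># c" "count c (i + 1) = 1" "i \<in># c"
    and q: "q \<in> weight_set (wt (add_mset i c))"
  shows "\<exists>p\<in>weight_set (wt c). q \<approx> f i * p"
proof -
  have W: "{fw u | u. mset u = c} \<subseteq> weight_set (wt c)" using word_weight c(1) by auto
  have inW: "p \<in> weight_set (wt c)" if "p \<in> lspan J {fw u | u. mset u = c}" for p
    using that
  proof induction
    case (ideal p)
    then show ?case using weight_set_J by blast
  next
    case (gen g)
    then show ?case using W by blast
  qed (auto intro: weight_set_add weight_set_scalar)
  have "q \<in> lspan J {fw w | w. mset w = add_mset i c}"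
    using c i q by (intro weight_set_span) auto
  then show ?thesis
  proof induction
    case (ideal p)
    then show ?case
      by (intro bexI[of _ 0] subsetD[OF weight_set_J zero_J]) (simp add: J_iff)
  next
    case (gen g)
    then obtain w where w: "g = fw w" "mset w = add_mset i c" by blast
    have "count c i \<ge> 1" using c(4) by (simp add: Suc_le_eq)
    moreover have "set w = insert i (set_mset c)" using w(2) by (metis set_mset_add_mset_insert set_mset_mset)
    ultimately have "\<exists>p\<in>lspan J {fw u * 1 | u. add_mset i (mset u) = mset w}. fw w * 1 \<approx> f i * p"
      using i c(1-3) w(2) by (intro word_pull_serre) auto
    then show ?case using w inW by auto
  next
    case (add p q)
    then obtain p' q' where "p' \<in> weight_set (wt c)" "p \<approx> f i * p'" "q' \<in> weight_set (wt c)" "q \<approx> f i * q'"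
      by blast
    then show ?case
      by (intro bexI[of _ "p' + q'"]) (auto simp: distrib_left intro: cong_add weight_set_add)
  next
    case (scale p a)
    then obtain p' where p': "p' \<in> weight_set (wt c)" "p \<approx> f i * p'" by blast
    have "scalar a * p \<approx> scalar a * (f i * p')"
      by (intro cong_mult p') auto
    then show ?case
      using weight_set_scalar[OF p'(1), of a]
      by (intro bexI[of _ "scalar a * p'"]) (simp_all only: scalar_left_commute[of "f i" a])
  qed
qed

end

lemma of_nat_add_one_neq: "t < N + 1 \<Longrightarrow> (of_nat N + 1 :: complex) \<noteq> of_nat t"
  using of_nat_eq_iff[of "N + 1" t, where 'a = complex] by (simp add: add.commute)

theorem theorem1p7:
  fixes m n :: nat
    and lam :: "complex mat \<Rightarrow> complex"
    and \<H> :: "nat set set"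
  assumes "m \<ge> 2" and "n \<ge> 1"
    and "finite \<H>" and "\<forall>H\<in>\<H>. hole n H"
    and "lam \<in> cartan_dual n" and "\<forall>H\<in>\<H>. lam \<in> dominant_on n H"
    and "hverma_order \<H> = m"
    and "\<forall>H\<in>min_holes \<H>. \<not> is_singleton H"
  shows "let V = hverma n lam \<H> in
    \<exists>\<mu>\<in>cartan_dual n. \<exists>i\<in>{1..n + 1}. \<exists>j\<in>{1..n + 1}.
    (weight_dim n V \<mu>)\<^sup>2 <
      weight_dim n V (\<lambda>A. \<mu> A + eps i A - eps j A) *
      weight_dim n V (\<lambda>A. \<mu> A - eps i A + eps j A)"
proof -
  define a where "a = dyn_label n lam"
  have label: "lam (chev_h n k) = of_nat (a k)" if "H \<in> \<H>" "k \<in> H" for H k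
    using assms(6) that dyn_label_eq unfolding a_def dominant_on_def by blast
  \<comment> \<open>An order of at least 2 requires a nonempty minimal hole. An empty hole in the
    collection would lie below it and contradict its minimality.\<close>
  have "\<exists>K\<in>min_holes \<H>. K \<noteq> {}"
  proof (rule ccontr)
    assume "\<not> ?thesis"
    then have "card ` min_holes \<H> \<subseteq> {0}" by auto
    then have "insert 0 (card ` min_holes \<H>) = {0}" by blast
    then have "hverma_order \<H> = Max {0}" unfolding hverma_order_def by (rule arg_cong)
    then show False using assms(1,7) by simp
  qed
  then have ne: "\<H> \<noteq> {}" "{} \<notin> \<H>" by (auto simp: min_holes_def)
  obtain H i j where H: "H \<in> \<H>" "i \<in> H" "j \<in> H" and ij: "i < j"
    and second: "\<And>k. k \<in> H \<Longrightarrow> k = i \<or> j \<le> k"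
    and untouched1: "\<And>K. K \<in> \<H> \<Longrightarrow> \<not> K \<subseteq> {i + 1..<j} \<union> (H - {i})"
    and untouched2: "\<And>K. K \<in> \<H> \<Longrightarrow> \<not> K \<subseteq> {i..<j} \<union> (H - {j})"
  proof (rule hole_choice[OF assms(3) _ ne, of n])
    show "K \<subseteq> {1..n}" if "K \<in> \<H>" for K using assms(4) that by (auto simp: hole_def)
    show "\<not> is_singleton K" if "K \<in> min_holes \<H>" for K using assms(8) that by blast
  qed blast
  have Hn: "H \<subseteq> {1..n}" and adj: "\<And>k l. k \<in> H \<Longrightarrow> l \<in> H \<Longrightarrow> \<not> dynkin_adjacent k l"
    using assms(4) H(1) by (auto simp: hole_def)
  have finH: "finite H" using Hn finite_subset by blast
  have i: "i \<in> {1..n}" and j: "j \<in> {1..n}" using Hn H by auto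
  have gap: "i + 1 < j" using adj[OF H(2,3)] ij by (simp add: dynkin_adjacent_def)
  obtain J vec where cyc: "cyclic_module n J (hverma n lam \<H>) vec"
    and gens: "verma_generators n lam \<subseteq> J"
    and holeJ: "\<And>H. H \<in> \<H> \<Longrightarrow> hole_poly n lam (sorted_list_of_set H) \<in> J"
    and minJ: "\<And>T. left_ideal n T \<Longrightarrow> verma_generators n lam \<subseteq> T \<Longrightarrow>
      (\<And>H. H \<in> \<H> \<Longrightarrow> hole_poly n lam (sorted_list_of_set H) \<in> T) \<Longrightarrow> J \<subseteq> T"
    by (rule hverma_cyclic[of n lam \<H>]) (use that in blast)
  let ?V = "hverma n lam \<H>"
  interpret cyclic_module n J ?V vec by (rule cyc)
  interpret highest_weight_module n J ?V vec lam
    by (intro highest_weight_module.intro highest_weight_ideal.intro highest_weight_ideal_axioms.intro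
        cyc left_ideal_axioms assms(5) gens)
  \<comment> \<open>A hole that is not contained in the support of \<open>w\<close> has a node that
    \<open>w\<close> avoids; its count \<open>0\<close> is below any label plus one.\<close>
  have survive: "fw w \<notin> J" if w: "set w \<subseteq> {1..n}" "\<And>K. K \<in> \<H> \<Longrightarrow> \<not> K \<subseteq> set w" for w
  proof (rule word_not_in_ideal[OF assms(5) _ _ minJ w(1)])
    fix K assume K: "K \<in> \<H>"
    then obtain k where k: "k \<in> K" "k \<notin> set w" using w(2) by blast
    have "count (mset w) k = 0" using k(2) by (simp only: count_mset_0_iff not_False_eq_True)
    then show "\<exists>k\<in>K. count (mset w) k \<le> dyn_label n lam k"
      by (intro bexI[OF _ k(1)]) (simp only: le0)
  qed (use assms(4,6) in auto)
  define Y where "Y = hole_word a (sorted_list_of_set (H - {i}))"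
  define Z where "Z = hole_word a (sorted_list_of_set (H - {i, j}))"
  define D where "D = mset [i + 1..<j] + mset Y"
  define C where "C p = replicate_mset p i + D" for p
  have setY: "set Y = H - {i}" and setZ: "set Z = H - {i, j}"
    using finH by (simp_all add: Y_def Z_def)
  have YZ: "mset Y = replicate_mset (a j + 1) j + mset Z"
    using finH H(3) ij
    by (intro multiset_eqI) (auto simp: Y_def Z_def count_hole_word)
  have D_range: "set_mset D \<subseteq> {1..n}" using Hn i j by (auto simp: D_def setY)
  have C_range: "set_mset (C p) \<subseteq> {1..n}" for p
    using D_range i by (auto simp: C_def split: if_splits)
  have C_Suc: "C (Suc p) = add_mset i (C p)" for p by (simp add: C_def)
  have Y_far: "k \<noteq> i \<and> \<not> dynkin_adjacent k i" if "k \<in># mset Y" for k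
    using that adj[OF _ H(2)] by (auto simp: setY)
  have interior: "mset [i + 1..<j] = add_mset (i + 1) (mset [i + 2..<j])"
    using gap by (simp add: upt_conv_Cons)
  have root_interior_i: "root_sum (mset [i + 1..<j]) (chev_h n i) = - 1"
  proof -
    have "root_sum (mset [i + 2..<j]) (chev_h n i) = 0"
      using i j by (intro root_sum_chev_h_zero) (auto simp: dynkin_adjacent_def)
    moreover have "simple_root (i + 1) (chev_h n i) = - 1"
      using i j gap by (subst root_chev_h) (auto simp: dynkin_adjacent_def)
    ultimately show ?thesis unfolding interior by simp
  qed
  \<comment> \<open>The summand \<open>1\<close> is the contribution of the node
    \<open>i + 1\<close> of the chain; all other nodes of the chain and of \<open>H - {i}\<close>
    are orthogonal to \<open>i\<close>.\<close>
  have h_i: "wt (C p) (chev_h n i) = of_nat (a i) + 1 - 2 * of_nat p" for p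
  proof -
    have "root_sum (mset Y) (chev_h n i) = 0"
      using i Hn Y_far by (intro root_sum_chev_h_zero) (auto simp: setY)
    then show ?thesis
      unfolding C_def D_def
      by (simp only: root_sum_simps root_sum_replicate root_self[OF i] root_interior_i label[OF H(1,2)])
        (simp add: algebra_simps)
  qed
  have countC: "count (C p) i = p" "i - 1 \<notin># C p" "count (C p) (i + 1) = 1" for p
  proof -
    have iY: "i \<notin> set Y" "i - 1 \<notin> set Y" "i + 1 \<notin> set Y"
      using second[of "i - 1"] second[of "i + 1"] gap i by (auto simp: setY)
    show "count (C p) i = p"
      using iY(1) by (simp add: C_def D_def count_mset_0_iff)
    show "i - 1 \<notin># C p"
      using iY(2) i by (auto simp: C_def D_def)
    show "count (C p) (i + 1) = 1"
      using iY(3) unfolding C_def D_def interior by (simp add: count_mset_0_iff)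
  qed
  let ?b = "a i"
  have fin: "vectorspace.fin_dim (class_ring :: complex ring) (weight_space n ?V (wt (C p)))" for p
    by (rule weight_fin_dim[OF C_range])
  have fmaps: "f i * p \<in> weight_set (wt (C (Suc t)))" if "p \<in> weight_set (wt (C t))" for p t
    unfolding C_Suc by (rule f_weight_set[OF i that])
  have nonzero: "weight_dim n ?V (wt (C (?b + 2))) > 0"
  proof -
    \<comment> \<open>The word without \<open>j\<close>: no hole fits into its support, and having
      no letter \<open>j\<close> it is killed by \<open>e j\<close>.\<close>
    define z where "z = replicate (?b + 2) i @ [i + 1..<j] @ Z"
    have zset: "set z = insert i {i + 1..<j} \<union> (H - {i, j})"
      by (auto simp: z_def setZ)
    have zn: "set z \<subseteq> {1..n}" unfolding zset using i j Hn by auto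
    have zJ: "fw z \<notin> J"
    proof (rule survive[OF zn])
      fix K assume "K \<in> \<H>"
      moreover have "set z \<subseteq> {i..<j} \<union> (H - {j})" unfolding zset using ij by auto
      ultimately show "\<not> K \<subseteq> set z" using untouched2 by blast
    qed
    have "count (mset z) j = 0"
      using ij by (simp add: z_def count_mset_0_iff setZ)
    then have jz: "j \<notin># mset z" by (simp add: count_eq_zero_iff)
    have "add_mset j (mset u) \<noteq> mset z" for u
    proof
      assume "add_mset j (mset u) = mset z"
      then have "j \<in># mset z" by (metis union_single_eq_member)
      then show False using jz by simp
    qed
    then have empty: "{fw u * 1 | u. add_mset j (mset u) = mset z} = {}" by blast
    have "e j * 1 \<in> J" using e_in_J by simp
    from e_fw[OF j zn free_alg_one this cartan_hw[OF chev_h_in_cartan[OF j]]]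
    have ez: "e j * fw z \<in> J" unfolding empty lspan_empty by simp
    \<comment> \<open>The chain ends in \<open>j - 1\<close>, which lifts the weight at
      \<open>h j\<close> above the label by one, just enough for the power \<open>a j + 1\<close> of
      \<open>f j\<close> to survive.\<close>
    have "wt (mset z) (chev_h n j) = of_nat (a j) + 1"
    proof -
      have "root_sum (mset Z) (chev_h n j) = 0"
        using j Hn adj[OF _ H(3)] by (intro root_sum_chev_h_zero) (auto simp: setZ)
      moreover have "simple_root i (chev_h n j) = 0"
        using i j gap adj[OF H(2,3)] by (subst root_chev_h) auto
      moreover have "root_sum (mset [i + 1..<j]) (chev_h n j) = - 1"
      proof -
        have split: "[i + 1..<j] = [i + 1..<j - 1] @ [j - 1]"
          using gap upt_Suc_append[of "i + 1" "j - 1"] by simp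
        have "root_sum (mset [i + 1..<j - 1]) (chev_h n j) = 0"
          using i j by (intro root_sum_chev_h_zero) (auto simp: dynkin_adjacent_def)
        moreover have "simple_root (j - 1) (chev_h n j) = - 1"
          using i j gap by (subst root_chev_h) (auto simp: dynkin_adjacent_def)
        ultimately show ?thesis unfolding split by simp
      qed
      ultimately show ?thesis
        by (simp only: z_def mset_append mset_replicate root_sum_simps root_sum_replicate label[OF H(1,3)]) simp
    qed
    then have hz: "cong_J (h j * fw z) (scalar (of_nat (a j) + 1) * fw z)"
      using h_weight_set[OF j word_weight[OF zn]] by simp
    have "f j ^ (a j + 1) * fw z \<notin> J"
    proof
      assume "f j ^ (a j + 1) * fw z \<in> J"
      then have "fw z \<in> J"
      proof (rule f_power_nonzero[OF j _ hz ez, rotated 2])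
        fix t assume "t < a j + 1"
        then show "(of_nat (a j) + 1 :: complex) \<noteq> of_nat t"
          by (rule of_nat_add_one_neq)
      qed auto
      then show False using zJ by simp
    qed
    moreover have "f j ^ (a j + 1) * fw z = fw (replicate (a j + 1) j @ z)"
      by (simp only: fword_f_append fword_f_replicate)
    moreover have "mset (replicate (a j + 1) j @ z) = C (?b + 2)"
      by (simp only: C_def D_def YZ z_def mset_append mset_replicate ac_simps)
    moreover have "set (replicate (a j + 1) j @ z) \<subseteq> {1..n}" using zn j by auto
    ultimately show ?thesis
      using weight_dim_pos[OF fin] word_weight by metis
  qed
  have le: "weight_dim n ?V (wt (C (?b + 2))) \<le> weight_dim n ?V (wt (C (?b + 3)))"
  proof (rule weight_dim_le[OF fin fin, where r = "f i"])
    show "f i * p \<in> weight_set (wt (C (?b + 3)))" if "p \<in> weight_set (wt (C (?b + 2)))" for p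
      using fmaps[OF that] by (simp add: numeral_3_eq_3 numeral_2_eq_2)
    fix p assume p: "p \<in> weight_set (wt (C (?b + 2)))" "f i * p \<in> J"
    \<comment> \<open>The weight is \<open>?b + 1 - 2 * (?b + 2)\<close>. A vector killed by
      \<open>f i\<close> would be a lowest weight vector of this negative weight, with
      \<open>e i ^ t\<close> nonzero for all \<open>t \<le> ?b + 3\<close>; but the content has only
      \<open>?b + 2\<close> letters \<open>i\<close>.\<close>
    have hp: "cong_J (h i * p) (scalar (- of_nat (?b + 3)) * p)"
      using h_weight_set[OF i p(1)] unfolding h_i by (simp add: algebra_simps)
    show "p \<in> J"
    proof (rule e_power_nonzero[OF i weight_set_F[OF p(1)] hp p(2)])
      show "e i ^ (?b + 3) * p \<in> J"
        by (rule e_power_words[OF i C_range weight_set_span[OF C_range p(1)]]) (simp add: countC)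
      show "- of_nat (?b + 3) + (of_nat t :: complex) \<noteq> 0" if "t < ?b + 3" for t
        using that by (metis ab_left_minus add_left_imp_eq less_irrefl of_nat_eq_iff)
    qed
  qed auto
  have less: "weight_dim n ?V (wt (C (?b + 2))) < weight_dim n ?V (wt (C (?b + 1)))"
  proof -
    \<comment> \<open>Reversing the chain puts \<open>f (i + 1)\<close> next to \<open>fw Y\<close>,
      where the Serre relation can act; the letters to its left commute with
      \<open>f i\<close>.\<close>
    define x where "x = rev [i + 1..<j] @ Y"
    have xset: "set x = {i + 1..<j} \<union> (H - {i})"
      by (auto simp: x_def setY)
    have xn: "set x \<subseteq> {1..n}" unfolding xset using i j Hn by auto
    have xC: "mset x = C 0" by (simp add: x_def C_def D_def)
    have xJ: "fw x \<notin> J"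
      by (rule survive[OF xn]) (use untouched1 xset in auto)
    have xw: "fw x \<in> weight_set (wt (C 0))"
      using word_weight[OF xn] by (simp add: xC)
    have hx: "cong_J (h i * fw x) (scalar (of_nat ?b + 1) * fw x)"
      using h_weight_set[OF i xw] unfolding h_i by simp
    have ex: "e i * fw x \<in> J"
    proof -
      have "e i ^ 1 * fw x \<in> J"
        by (rule e_power_words[OF i C_range weight_set_span[OF C_range xw]]) (simp add: countC)
      then show ?thesis by simp
    qed
    have nz: "f i ^ (?b + 1) * fw x \<notin> J"
    proof
      assume "f i ^ (?b + 1) * fw x \<in> J"
      then have "fw x \<in> J"
      proof (rule f_power_nonzero[OF i _ hx ex, rotated 2])
        fix t assume "t < ?b + 1"
        then show "(of_nat ?b + 1 :: complex) \<noteq> of_nat t"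
          by (rule of_nat_add_one_neq)
      qed auto
      then show False using xJ by simp
    qed
    have sorted: "sorted_list_of_set H = i # sorted_list_of_set (H - {i})"
    proof -
      have "Min H = i"
        using finH H(2) second ij by (intro Min_eqI) force+
      then show ?thesis
        using sorted_list_of_set_nonempty[OF finH] H(2) by auto
    qed
    \<comment> \<open>This is the defining relation of the hole \<open>H\<close> itself; as
      \<open>i\<close> is its least element, the power of \<open>f i\<close> is the first
      factor.\<close>
    have fY: "f i ^ (?b + 1) * fw Y \<in> J"
      using holeJ[OF H(1), unfolded sorted hole_poly_simps] by (simp only: hole_poly_word Y_def a_def)
    have "f i ^ Suc (?b + 1) * (f (i + 1) * fw Y) \<in> J"
      using i j gap fY by (intro serre_kernel) (auto simp: dynkin_adjacent_def)
    moreover have "cong_J (f i ^ Suc (?b + 1) * fw x) (fw (rev [i + 2..<j]) * (f i ^ Suc (?b + 1) * (f (i + 1) * fw Y)))"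
    proof -
      have "x = rev [i + 2..<j] @ (i + 1) # Y"
        using gap by (simp add: x_def upt_conv_Cons)
      then have "fw x = fw (rev [i + 2..<j]) * (f (i + 1) * fw Y)"
        by (simp add: fword_f_append)
      then show ?thesis
        using i j by (simp only:) (intro f_power_commute_word; auto simp: dynkin_adjacent_def)
    qed
    moreover have "fw (rev [i + 2..<j]) \<in> F" by simp
    ultimately have kill: "f i ^ Suc (?b + 1) * fw x \<in> J"
      using mult_J cong_J_iff by blast
    have fpow: "f i ^ t * fw x \<in> weight_set (wt (C t))" for t
    proof (induction t)
      case (Suc t)
      then show ?case using fmaps by (simp add: mult.assoc)
    qed (use xw in simp)
    have "weight_dim n ?V (wt (C (Suc (?b + 1)))) < weight_dim n ?V (wt (C (?b + 1)))"
    proof (rule weight_dim_less[OF fin, where r = "f i"])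
      show "\<exists>p\<in>weight_set (wt (C (?b + 1))). cong_J q (f i * p)" if "q \<in> weight_set (wt (C (Suc (?b + 1))))" for q
      proof (rule f_surjective[OF i C_range countC(2,3)])
        show "i \<in># C (?b + 1)" by (simp add: C_def)
        show "q \<in> weight_set (wt (add_mset i (C (?b + 1))))" using that by (simp only: C_Suc)
      qed
      show "f i ^ (?b + 1) * fw x \<in> weight_set (wt (C (?b + 1)))" by (rule fpow)
      show "f i ^ (?b + 1) * fw x \<notin> J" by (rule nz)
      show "f i * (f i ^ (?b + 1) * fw x) \<in> J" using kill by (simp add: mult.assoc)
    qed (use fmaps in auto)
    then show ?thesis by (simp add: numeral_2_eq_2)
  qed
  have dual: "wt (C p) \<in> cartan_dual n" for p
    using assms(5) C_range root_sum_add root_sum_smult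
    by (auto simp: cartan_dual_def algebra_simps)
  \<comment> \<open>The pair of indices in the conclusion is \<open>i\<close> and
    \<open>i + 1\<close>: adding the simple root at \<open>i\<close> to the weight removes one copy
    of \<open>i\<close> from the multiset.\<close>
  have plus: "(\<lambda>A. wt (C (?b + 2)) A + eps i A - eps (i + 1) A) = wt (C (?b + 1))"
    using C_Suc[of "?b + 1"] by (auto simp: simple_root_def numeral_2_eq_2)
  have minus: "(\<lambda>A. wt (C (?b + 2)) A - eps i A + eps (i + 1) A) = wt (C (?b + 3))"
    using C_Suc[of "?b + 2"] by (auto simp: simple_root_def numeral_3_eq_3 numeral_2_eq_2)
  let ?d = "\<lambda>p. weight_dim n ?V (wt (C p))"
  have "(?d (?b + 2))\<^sup>2 = ?d (?b + 2) * ?d (?b + 2)" by (rule power2_eq_square)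
  also have "\<dots> < ?d (?b + 1) * ?d (?b + 2)" using less nonzero by simp
  also have "\<dots> \<le> ?d (?b + 1) * ?d (?b + 3)" using le by simp
  finally have "(?d (?b + 2))\<^sup>2 < ?d (?b + 1) * ?d (?b + 3)" .
  then have "(?d (?b + 2))\<^sup>2 < weight_dim n ?V (\<lambda>A. wt (C (?b + 2)) A + eps i A - eps (i + 1) A)
      * weight_dim n ?V (\<lambda>A. wt (C (?b + 2)) A - eps i A + eps (i + 1) A)"
    by (simp only: plus minus)
  moreover have "i \<in> {1..n + 1}" "i + 1 \<in> {1..n + 1}" using i by auto
  ultimately show ?thesis
    unfolding Let_def using dual by blast
qed

end
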